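(* Let $n>1$ be an integer, let $X$ be a Banach space, let $T:X\to X$ be an $n$-Ritt operator, and put $A=I-T$. Then the following are equivalent: (1) $T$ admits a quadratic $H^\infty(\mathbb{B}_{n,\gamma})$ functional calculus for some $\gamma\in(0,\frac{\pi}{n})$; (2) $A$ admits a quadratic $H^\infty(S_{n,\theta})$ functional calculus for some $\theta\in(0,\frac{\pi}{n})$.
   Context: Fix an integer $n>1$ and a complex Banach space $X$. $B(X)$ denotes the bounded operators on $X$, $\sigma(\cdot)$ the spectrum, $R(z,A)=(zI-A)^{-1}$ the resolvent. For $a\in\mathbb{C}$ and $E\subseteq\mathbb{C}$, $aE=\{az:z\in E\}$ and $1-E=\{1-z:z\in E\}$. **Rademacher space.** Let $(\epsilon_k)_{k\ge1}$ be independent Rademacher variables (the coordinate functions on $\Omega_0=\{+1,-1\}^{\mathbb{Z}}$ with normalized Haar measure). $\mathrm{Rad}(X)$ is the closure of $\mathrm{span}\{\epsilon_k\otimes x_k:k\ge1,\ x_k\in X\}$ in the Bochner space $L^2(\Omega_0;X)$, with the norm of $L^2(\Omega_0;X)$. **Square function norm.** For bounded holomorphic $g_1,\dots,g_N$ on a nonempty open set $\Omega\subseteq\mathbb{C}$, $\big\|(\sum_{k=1}^N|g_k|^2)^{1/2}\big\|_{\infty,\Omega}=\sup_{z\in\Omega}\big(\sum_{k=1}^N|g_k(z)|^2\big)^{1/2}$. **Sectors.** For $\omega\in(0,\frac{\pi}{n})$ let $\Sigma_\omega=\{z\in\mathbb{C}\setminus\{0\}:|\arg z|<\omega\}$, $\Sigma_{j,\omega}=e^{2ij\pi/n}\Sigma_\omega$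 for $0\le j\le n-1$, and $S_{n,\omega}=\bigcup_{j=0}^{n-1}\Sigma_{j,\omega}$. **$n$-sectorial operators.** A closed densely defined operator $A:D(A)\subseteq X\to X$ is $n$-sectorial of type $\omega\in(0,\frac{\pi}{n})$ if $\sigma(A)\subseteq\overline{S}_{n,\omega}$ and, for every $\nu\in(\omega,\frac{\pi}{n})$, the set $\{zR(z,A):z\in\mathbb{C}\setminus\overline{S}_{n,\nu}\}$ is bounded in $B(X)$. **Functional calculus for $n$-sectorial operators.** $H_0^\infty(S_{n,\theta})$ is the algebra of bounded holomorphic $f:S_{n,\theta}\to\mathbb{C}$ for which there are $c,s>0$ (depending on $f$) with $|f(z)|\le c\frac{|z|^s}{1+|z|^{2s}}$ for all $z\in S_{n,\theta}$. If $A$ is $n$-sectorial of type $\omega<\theta$ and $f\in H_0^\infty(S_{n,\theta})$, then $$f(A)=\frac{1}{2\pi i}\int_{\Gamma_{S_{n,\nu}}}f(z)R(z,A)\,dz,\qquad \nu\in(\omega,\theta),$$ where $\Gamma_{S_{n,\nu}}$ is the concatenation of the boundaries of the sectors $\Sigma_{j,\nu}$, $0\le j\le n-1$, each oriented anticlockwise (for $j=0$: along $te^{i\nu}$ from $t=\infty$ to $t=0$, then along $te^{-i\nu}$ from $t=0$ to $t=\infty$). The integral converges absolutely and does not depend on $\nu$. "$A$ admits a quadratic $H^\infty(S_{n,\theta})$ functional calculus" means: $A$ is $n$-sectorial of some type $\omega\in(0,\theta)$ and there is $C>0$ such that for all $N\ge1$, all $g_1,\dots,g_N\in H_0^\infty(S_{n,\theta})$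 and all $x\in X$, $$\Big\|\sum_{k=1}^N\epsilon_k\otimes g_k(A)x\Big\|_{\mathrm{Rad}(X)}\le C\|x\|\,\Big\|\Big(\sum_{k=1}^N|g_k|^2\Big)^{1/2}\Big\|_{\infty,S_{n,\theta}}.$$ **$n$-Stolz domains.** For $\gamma\in(0,\frac{\pi}{n})$ let $\mathcal{B}_\gamma$ be the interior of the convex hull of the point $1$ and the disc $D(0,\sin\gamma)$. Put $\Delta_\gamma=1-\mathcal{B}_\gamma$, $\Delta_{j,\gamma}=e^{2ij\pi/n}\Delta_\gamma$, and $\mathbb{B}_{n,\gamma}=1-\bigcup_{j=0}^{n-1}\Delta_{j,\gamma}$. **$n$-Ritt operators.** A bounded operator $T:X\to X$ is $n$-Ritt of type $\alpha\in(0,\frac{\pi}{n})$ if $\sigma(T)\subseteq\overline{\mathbb{B}}_{n,\alpha}$ and, for every $\beta\in(\alpha,\frac{\pi}{n})$, the set $\{(\lambda-1)R(\lambda,T):\lambda\in\mathbb{C}\setminus\overline{\mathbb{B}}_{n,\beta}\}$ is bounded in $B(X)$. $T$ is $n$-Ritt if it is $n$-Ritt of some type $\alpha\in(0,\frac{\pi}{n})$. **Functional calculus for $n$-Ritt operators.** $H_0^\infty(\mathbb{B}_{n,\gamma})$ is the algebra of bounded holomorphic $\phi:\mathbb{B}_{n,\gamma}\to\mathbb{C}$ for which there are $c,s>0$ (depending on $\phi$) with $|\phi(\lambda)|\le c|1-\lambda|^s$ for all $\lambda\in\mathbb{B}_{n,\gamma}$. If $T$ is $n$-Ritt of type $\alpha<\gamma$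 and $\phi\in H_0^\infty(\mathbb{B}_{n,\gamma})$, then $$\phi(T)=\frac{1}{2\pi i}\int_{\Gamma_{\mathbb{B}_{n,\beta}}}\phi(\lambda)R(\lambda,T)\,d\lambda,\qquad \beta\in(\alpha,\gamma),$$ where $\Gamma_{\mathbb{B}_{n,\beta}}$ is the concatenation of the boundaries of the $n$ sets $1-\Delta_{j,\beta}$, $0\le j\le n-1$, each oriented counterclockwise. The integral converges absolutely and does not depend on $\beta$. "$T$ admits a quadratic $H^\infty(\mathbb{B}_{n,\gamma})$ functional calculus" means: $T$ is $n$-Ritt of some type $\alpha\in(0,\gamma)$ and there is $K>0$ such that for all $N\ge1$, all $\phi_1,\dots,\phi_N\in H_0^\infty(\mathbb{B}_{n,\gamma})$ and all $x\in X$, $$\Big\|\sum_{k=1}^N\epsilon_k\otimes \phi_k(T)x\Big\|_{\mathrm{Rad}(X)}\le K\|x\|\,\Big\|\Big(\sum_{k=1}^N|\phi_k|^2\Big)^{1/2}\Big\|_{\infty,\mathbb{B}_{n,\gamma}}.$$ *)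

theory Defs
  imports
    "HOL-Analysis.Analysis"
    "HOL-Complex_Analysis.Contour_Integration"
    "HOL-Probability.Infinite_Product_Measure"
begin

section \<open>Complex Banach spaces\<close>

class scaleC = scaleR +
  fixes scaleC :: "complex \<Rightarrow> 'a \<Rightarrow> 'a" (infixr \<open>*\<^sub>C\<close> 75)
  assumes scaleR_scaleC: "r *\<^sub>R x = complex_of_real r *\<^sub>C x"

class complex_normed_vector = real_normed_vector + scaleC +
  assumes scaleC_add_right: "a *\<^sub>C (x + y) = a *\<^sub>C x + a *\<^sub>C y"
    and scaleC_add_left: "(a + b) *\<^sub>C x = a *\<^sub>C x + b *\<^sub>C x"
    and scaleC_scaleC: "a *\<^sub>C (b *\<^sub>C x) = (a * b) *\<^sub>C x"
    and scaleC_one: "1 *\<^sub>C x = x"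
    and norm_scaleC: "norm (a *\<^sub>C x) = cmod a * norm x"

class complex_banach = complex_normed_vector + banach

lemma bounded_linear_scaleC:
  "bounded_linear (\<lambda>x :: 'a :: complex_normed_vector. c *\<^sub>C x)"
  by (rule bounded_linear_intro[where K = "cmod c"])
     (simp_all add: scaleC_add_right scaleR_scaleC scaleC_scaleC norm_scaleC mult.commute)

text \<open>
  The type \<open>'a \<Rightarrow>\<^sub>L 'a\<close> consists of the bounded real-linear operators, with the operator norm.
  The algebra \<open>B(X)\<close> is its closed subspace of complex-linear operators; complex
  linearity is an explicit hypothesis below.
\<close>

instantiation blinfun :: (real_normed_vector, complex_normed_vector) complex_normed_vector
begin

lift_definition scaleC_blinfun :: "complex \<Rightarrow> ('a \<Rightarrow>\<^sub>L 'b) \<Rightarrow> ('a \<Rightarrow>\<^sub>L 'b)"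
  is "\<lambda>c T x. c *\<^sub>C T x"
  by (rule bounded_linear_compose[OF bounded_linear_scaleC])

instance
proof
  fix r :: real and a b :: complex and S T :: "'a \<Rightarrow>\<^sub>L 'b"
  show "r *\<^sub>R T = complex_of_real r *\<^sub>C T"
    by transfer (simp add: scaleR_scaleC)
  show "a *\<^sub>C (S + T) = a *\<^sub>C S + a *\<^sub>C T"
    by transfer (simp add: scaleC_add_right)
  show "(a + b) *\<^sub>C T = a *\<^sub>C T + b *\<^sub>C T"
    by transfer (simp add: scaleC_add_left)
  show "a *\<^sub>C (b *\<^sub>C T) = (a * b) *\<^sub>C T"
    by transfer (simp add: scaleC_scaleC)
  show one: "1 *\<^sub>C T = T" for T :: "'a \<Rightarrow>\<^sub>L 'b"
    by transfer (simp add: scaleC_one)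
  have le: "norm (c *\<^sub>C U) \<le> cmod c * norm U" for c and U :: "'a \<Rightarrow>\<^sub>L 'b"
  proof (rule norm_blinfun_bound)
    show "norm (blinfun_apply (c *\<^sub>C U) x) \<le> cmod c * norm U * norm x" for x
      by (simp add: scaleC_blinfun.rep_eq norm_scaleC mult.assoc mult_left_mono norm_blinfun)
  qed simp
  show "norm (a *\<^sub>C T) = cmod a * norm T"
  proof (cases "a = 0")
    case True
    then show ?thesis using le[of 0 T] by simp
  next
    case False
    have "T = inverse a *\<^sub>C (a *\<^sub>C T)"
      using False by (transfer, simp add: scaleC_scaleC scaleC_one)
    then have "norm T \<le> cmod (inverse a) * norm (a *\<^sub>C T)"
      by (metis le)
    then have "cmod a * norm T \<le> norm (a *\<^sub>C T)"
      using False by (simp add: norm_inverse norm_divide field_simps)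
    then show ?thesis using le[of a T] by simp
  qed
qed

end

instance blinfun :: (real_normed_vector, complex_banach) complex_banach ..

section \<open>Closed densely defined operators, spectrum and resolvent\<close>

text \<open>
  A possibly unbounded operator \<open>A : D(A) \<subseteq> X \<rightarrow> X\<close> is given by its domain \<open>D\<close> and a function
  whose values outside \<open>D\<close> are irrelevant.  Bounded operators have domain \<open>UNIV\<close>.
\<close>

definition complex_linear_on :: "'a :: complex_normed_vector set \<Rightarrow> ('a \<Rightarrow> 'a) \<Rightarrow> bool" where
  "complex_linear_on D A \<longleftrightarrow> 0 \<in> D \<and>
     (\<forall>x\<in>D. \<forall>y\<in>D. x + y \<in> D \<and> A (x + y) = A x + A y) \<and>
     (\<forall>c. \<forall>x\<in>D. c *\<^sub>C x \<in> D \<and> A (c *\<^sub>C x) = c *\<^sub>C A x)"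

definition closed_densely_defined :: "'a :: complex_normed_vector set \<Rightarrow> ('a \<Rightarrow> 'a) \<Rightarrow> bool" where
  "closed_densely_defined D A \<longleftrightarrow>
     complex_linear_on D A \<and> closed {(x, A x) | x. x \<in> D} \<and> closure D = UNIV"

text \<open>
  A bounded two-sided inverse of \<open>zI - A\<close>.  It is unique, and it is automatically complex linear
  if \<open>A\<close> is.
\<close>

definition is_resolvent ::
  "'a :: complex_normed_vector set \<Rightarrow> ('a \<Rightarrow> 'a) \<Rightarrow> complex \<Rightarrow> ('a \<Rightarrow>\<^sub>L 'a) \<Rightarrow> bool" where
  "is_resolvent D A z R \<longleftrightarrow>
     (\<forall>y. blinfun_apply R y \<in> D \<and> z *\<^sub>C blinfun_apply R y - A (blinfun_apply R y) = y) \<and>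
     (\<forall>x\<in>D. blinfun_apply R (z *\<^sub>C x - A x) = x)"

definition spectrum :: "'a :: complex_normed_vector set \<Rightarrow> ('a \<Rightarrow> 'a) \<Rightarrow> complex set" where
  "spectrum D A = {z. \<not> (\<exists>R. is_resolvent D A z R)}"

definition resolvent ::
  "'a :: complex_normed_vector set \<Rightarrow> ('a \<Rightarrow> 'a) \<Rightarrow> complex \<Rightarrow> ('a \<Rightarrow>\<^sub>L 'a)" where
  "resolvent D A z = (THE R. is_resolvent D A z R)"

section \<open>Rademacher sums and square functions\<close>

definition Rad_Omega :: "(int \<Rightarrow> real) measure" where
  "Rad_Omega = (\<Pi>\<^sub>M i\<in>(UNIV :: int set). uniform_count_measure {1, -1})"

definition rademacher :: "nat \<Rightarrow> (int \<Rightarrow> real) \<Rightarrow> real" where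
  "rademacher k \<omega> = \<omega> (int k)"

text \<open>
  The norm of \<open>Rad(X)\<close> is that of \<open>L\<^sup>2(\<Omega>\<^sub>0; X)\<close>; only finite sums of the
  elementary tensors \<open>\<epsilon>\<^sub>k \<otimes> x\<^sub>k\<close> are ever measured by it.
\<close>

definition L2_Rad_norm :: "((int \<Rightarrow> real) \<Rightarrow> 'a :: real_normed_vector) \<Rightarrow> real" where
  "L2_Rad_norm F = sqrt (LINT \<omega>|Rad_Omega. (norm (F \<omega>))\<^sup>2)"

definition rademacher_sum :: "nat \<Rightarrow> (nat \<Rightarrow> 'a :: real_normed_vector) \<Rightarrow> (int \<Rightarrow> real) \<Rightarrow> 'a" where
  "rademacher_sum N x = (\<lambda>\<omega>. \<Sum>k=1..N. rademacher k \<omega> *\<^sub>R x k)"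

definition square_function_norm :: "complex set \<Rightarrow> nat \<Rightarrow> (nat \<Rightarrow> complex \<Rightarrow> complex) \<Rightarrow> real" where
  "square_function_norm \<Omega> N g = (SUP z\<in>\<Omega>. sqrt (\<Sum>k=1..N. (cmod (g k z))\<^sup>2))"

section \<open>\<open>n\<close>-sectorial operators\<close>

definition rot :: "nat \<Rightarrow> nat \<Rightarrow> complex" where
  "rot n j = exp (2 * \<i> * of_nat j * of_real pi / of_nat n)"

definition sector :: "real \<Rightarrow> complex set" where
  "sector \<omega> = {z. z \<noteq> 0 \<and> \<bar>Arg z\<bar> < \<omega>}"

definition n_sector :: "nat \<Rightarrow> real \<Rightarrow> complex set" where
  "n_sector n \<omega> = (\<Union>j<n. (\<lambda>z. rot n j * z) ` sector \<omega>)"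

definition n_sectorial ::
  "nat \<Rightarrow> real \<Rightarrow> 'a :: complex_banach set \<Rightarrow> ('a \<Rightarrow> 'a) \<Rightarrow> bool" where
  "n_sectorial n \<omega> D A \<longleftrightarrow>
     closed_densely_defined D A \<and> \<omega> \<in> {0<..<pi / real n} \<and>
     spectrum D A \<subseteq> closure (n_sector n \<omega>) \<and>
     (\<forall>\<nu>\<in>{\<omega><..<pi / real n}.
        bounded {z *\<^sub>C resolvent D A z | z. z \<notin> closure (n_sector n \<nu>)})"

definition H0_sector :: "nat \<Rightarrow> real \<Rightarrow> (complex \<Rightarrow> complex) set" where
  "H0_sector n \<theta> = {f. f holomorphic_on n_sector n \<theta> \<and> bounded (f ` n_sector n \<theta>) \<and>
     (\<exists>c>0. \<exists>s>0. \<forall>z\<in>n_sector n \<theta>.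
        cmod (f z) \<le> c * (cmod z powr s / (1 + cmod z powr (2 * s))))}"

text \<open>
  The integral of \<open>F(z) dz\<close> along the ray \<open>{t w | t > 0}\<close>, from \<open>0\<close> to \<open>\<infinity>\<close>.  It is a
  Henstock-Kurzweil integral, since the Bochner integral of the library requires a separable
  target space; for the absolutely convergent integrals of continuous functions used here
  both notions agree.
\<close>

definition ray_integral :: "complex \<Rightarrow> (complex \<Rightarrow> 'b :: complex_banach) \<Rightarrow> 'b" where
  "ray_integral w F = integral {0<..} (\<lambda>t :: real. w *\<^sub>C F (of_real t * w))"

text \<open>
  The boundary of each sector is oriented anticlockwise: in along the upper ray, out along the
  lower one.
\<close>

definition sector_contour_integral ::
  "nat \<Rightarrow> real \<Rightarrow> (complex \<Rightarrow> 'b :: complex_banach) \<Rightarrow> 'b" where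
  "sector_contour_integral n \<nu> F =
     (\<Sum>j<n. ray_integral (rot n j * cis (- \<nu>)) F - ray_integral (rot n j * cis \<nu>) F)"

text \<open>
  The operator \<open>f(A)\<close> is the common value of the contour integrals for all admissible \<open>\<nu>\<close>.
\<close>

definition sectorial_calculus ::
  "nat \<Rightarrow> real \<Rightarrow> 'a :: complex_banach set \<Rightarrow> ('a \<Rightarrow> 'a) \<Rightarrow> (complex \<Rightarrow> complex) \<Rightarrow> ('a \<Rightarrow>\<^sub>L 'a)" where
  "sectorial_calculus n \<theta> D A f = (THE S.
     \<exists>\<omega>\<in>{0<..<\<theta>}. n_sectorial n \<omega> D A \<and>
       (\<forall>\<nu>\<in>{\<omega><..<\<theta>}. S = (1 / (2 * of_real pi * \<i>)) *\<^sub>C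
          sector_contour_integral n \<nu> (\<lambda>z. f z *\<^sub>C resolvent D A z)))"

definition quadratic_sectorial_calculus ::
  "nat \<Rightarrow> real \<Rightarrow> 'a :: complex_banach set \<Rightarrow> ('a \<Rightarrow> 'a) \<Rightarrow> bool" where
  "quadratic_sectorial_calculus n \<theta> D A \<longleftrightarrow>
     (\<exists>\<omega>\<in>{0<..<\<theta>}. n_sectorial n \<omega> D A) \<and>
     (\<exists>C>0. \<forall>N\<ge>1. \<forall>g. (\<forall>k\<in>{1..N}. g k \<in> H0_sector n \<theta>) \<longrightarrow> (\<forall>x.
        L2_Rad_norm (rademacher_sum N (\<lambda>k. blinfun_apply (sectorial_calculus n \<theta> D A (g k)) x))
          \<le> C * norm x * square_function_norm (n_sector n \<theta>) N g))"

section \<open>\<open>n\<close>-Ritt operators\<close>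

definition stolz :: "real \<Rightarrow> complex set" where
  "stolz \<gamma> = interior (convex hull (insert 1 (ball 0 (sin \<gamma>))))"

definition stolz_delta :: "real \<Rightarrow> complex set" where
  "stolz_delta \<gamma> = (\<lambda>z. 1 - z) ` stolz \<gamma>"

definition n_stolz :: "nat \<Rightarrow> real \<Rightarrow> complex set" where
  "n_stolz n \<gamma> = (\<lambda>z. 1 - z) ` (\<Union>j<n. (\<lambda>z. rot n j * z) ` stolz_delta \<gamma>)"

definition n_Ritt_type :: "nat \<Rightarrow> real \<Rightarrow> ('a :: complex_banach \<Rightarrow>\<^sub>L 'a) \<Rightarrow> bool" where
  "n_Ritt_type n \<alpha> T \<longleftrightarrow>
     complex_linear_on UNIV (blinfun_apply T) \<and> \<alpha> \<in> {0<..<pi / real n} \<and>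
     spectrum UNIV (blinfun_apply T) \<subseteq> closure (n_stolz n \<alpha>) \<and>
     (\<forall>\<beta>\<in>{\<alpha><..<pi / real n}.
        bounded {(z - 1) *\<^sub>C resolvent UNIV (blinfun_apply T) z | z. z \<notin> closure (n_stolz n \<beta>)})"

definition n_Ritt :: "nat \<Rightarrow> ('a :: complex_banach \<Rightarrow>\<^sub>L 'a) \<Rightarrow> bool" where
  "n_Ritt n T \<longleftrightarrow> (\<exists>\<alpha>\<in>{0<..<pi / real n}. n_Ritt_type n \<alpha> T)"

definition H0_stolz :: "nat \<Rightarrow> real \<Rightarrow> (complex \<Rightarrow> complex) set" where
  "H0_stolz n \<gamma> = {\<phi>. \<phi> holomorphic_on n_stolz n \<gamma> \<and> bounded (\<phi> ` n_stolz n \<gamma>) \<and>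
     (\<exists>c>0. \<exists>s>0. \<forall>z\<in>n_stolz n \<gamma>. cmod (\<phi> z) \<le> c * cmod (1 - z) powr s)}"

text \<open>The vector-valued version of the library's \<^const>\<open>contour_integral\<close>.\<close>

definition vec_contour_integral ::
  "(real \<Rightarrow> complex) \<Rightarrow> (complex \<Rightarrow> 'b :: complex_banach) \<Rightarrow> 'b" where
  "vec_contour_integral g F =
     integral {0..1} (\<lambda>t. vector_derivative g (at t within {0..1}) *\<^sub>C F (g t))"

text \<open>
  The boundary of \<^term>\<open>stolz \<beta>\<close>, counterclockwise from the vertex \<open>1\<close>.  The tangents from \<open>1\<close> to
  the circle of radius \<open>sin \<beta>\<close> about \<open>0\<close> touch it at the arguments \<open>\<plusminus>(\<pi>/2 - \<beta>)\<close>; the part of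
  the boundary on the circle is the long arc between these two points.
\<close>

definition stolz_path :: "real \<Rightarrow> real \<Rightarrow> complex" where
  "stolz_path \<beta> =
     linepath 1 (of_real (sin \<beta>) * cis (pi / 2 - \<beta>)) +++
     (part_circlepath 0 (sin \<beta>) (pi / 2 - \<beta>) (3 * pi / 2 + \<beta>) +++
      linepath (of_real (sin \<beta>) * cis (3 * pi / 2 + \<beta>)) 1)"

text \<open>The boundary of \<open>1 - \<Delta>\<^sub>j\<^sub>,\<^sub>\<beta> = 1 - e\<^sup>2\<^sup>i\<^sup>j\<^sup>\<pi>\<^sup>/\<^sup>n (1 - B\<^sub>\<beta>)\<close>, counterclockwise.\<close>

definition stolz_petal_path :: "nat \<Rightarrow> nat \<Rightarrow> real \<Rightarrow> real \<Rightarrow> complex" where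
  "stolz_petal_path n j \<beta> = (\<lambda>t. 1 - rot n j * (1 - stolz_path \<beta> t))"

definition stolz_contour_integral ::
  "nat \<Rightarrow> real \<Rightarrow> (complex \<Rightarrow> 'b :: complex_banach) \<Rightarrow> 'b" where
  "stolz_contour_integral n \<beta> F = (\<Sum>j<n. vec_contour_integral (stolz_petal_path n j \<beta>) F)"

definition Ritt_calculus ::
  "nat \<Rightarrow> real \<Rightarrow> ('a :: complex_banach \<Rightarrow>\<^sub>L 'a) \<Rightarrow> (complex \<Rightarrow> complex) \<Rightarrow> ('a \<Rightarrow>\<^sub>L 'a)" where
  "Ritt_calculus n \<gamma> T \<phi> = (THE S.
     \<exists>\<alpha>\<in>{0<..<\<gamma>}. n_Ritt_type n \<alpha> T \<and>
       (\<forall>\<beta>\<in>{\<alpha><..<\<gamma>}. S = (1 / (2 * of_real pi * \<i>)) *\<^sub>C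
          stolz_contour_integral n \<beta> (\<lambda>z. \<phi> z *\<^sub>C resolvent UNIV (blinfun_apply T) z)))"

definition quadratic_Ritt_calculus ::
  "nat \<Rightarrow> real \<Rightarrow> ('a :: complex_banach \<Rightarrow>\<^sub>L 'a) \<Rightarrow> bool" where
  "quadratic_Ritt_calculus n \<gamma> T \<longleftrightarrow>
     (\<exists>\<alpha>\<in>{0<..<\<gamma>}. n_Ritt_type n \<alpha> T) \<and>
     (\<exists>K>0. \<forall>N\<ge>1. \<forall>\<phi>. (\<forall>k\<in>{1..N}. \<phi> k \<in> H0_stolz n \<gamma>) \<longrightarrow> (\<forall>x.
        L2_Rad_norm (rademacher_sum N (\<lambda>k. blinfun_apply (Ritt_calculus n \<gamma> T (\<phi> k)) x))
          \<le> K * norm x * square_function_norm (n_stolz n \<gamma>) N \<phi>))"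

end

theory Submission
  imports Defs "HOL-Complex_Analysis.Riemann_Mapping"
begin

text \<open>
  Since \<open>R(z, A) = - R(1 - z, T)\<close>, both calculi integrate the same resolvent, over the boundary of
  \<open>1 - \<B>\<close> and of the surrounding sectors.  Tested against a functional, the integrand has a primitive
  off the spectrum (the complement of each petal region is connected and unbounded), and the
  integral over the boundary of a petal as well as that over the two rays of a sector equals the
  difference of the two limits of the primitive at the vertex.  So all these contour integrals agree,
  and a quadratic calculus for \<open>T\<close> restricts to one for \<open>A\<close>.

  Conversely, let \<open>f = \<phi>(1 - z)\<close> on a petal.  Splitting the Cauchy integral of \<open>f\<close> over a small triangle
  at the vertex gives \<open>f = g + e\<close>, where \<open>g\<close> extends to the sector with a comparable square function
  and \<open>e\<close> is \<open>O(|z|)\<close> with a comparable constant.  The quadratic calculus of \<open>A\<close> controls \<open>g(A)\<close>, and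
  \<open>e(A)\<close> is an absolutely convergent integral because \<open>|z| R(z, A)\<close> is bounded on the contour.
\<close>

section \<open>Geometry of sectors and Stolz domains\<close>

text \<open>Both calculi are defined through the existence of some admissible type, and
  \<open>A\<close> may be sectorial of an angle smaller than every Ritt type of \<open>T\<close>.
  The integrals are therefore compared on regions that leave out only the intersection of the two
  sets known to contain the spectrum: the petal and the cone. The primitive has a limit at the
  vertex along each ray because the integrand is O(|z|^(s-1)), and arcs of radius t contribute
  O(t^s). The limits from above and from below the axis differ in general, since the spectrum may
  separate the two sides; their difference is the common value of the integrals. Square functions
  survive the splitting because the Cauchy kernel is the same for all k: Minkowski's inequality
  moves the square sum inside the integral. Norm bounds on the resolvent suffice for
  \<open>e(A)\<close>: for fixed signs the coefficients form one scalar in front of a common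
  operator, and averaging over the signs gives back the square sum. The price of the splitting is a
  loss of angle, from \<gamma> for \<open>\<phi>\<close> to a smaller \<theta> for
  \<open>g\<close>.\<close>

lemma sector_iff:
  assumes "0 < \<omega>" "\<omega> < pi / 2"
  shows "z \<in> sector \<omega> \<longleftrightarrow> Re z > 0 \<and> \<bar>Im z\<bar> < tan \<omega> * Re z"
proof -
  have "z \<in> sector \<omega> \<longleftrightarrow> Re z > 0 \<and> \<bar>arctan (Im z / Re z)\<bar> < \<omega>"
  proof (cases "Re z > 0")
    case True
    then show ?thesis by (auto simp: sector_def arg_conv_arctan)
  next
    case False
    then have "z = 0 \<or> \<bar>Arg z\<bar> \<ge> pi / 2"
      using Re_Ln_pos_lt[of z] by (cases "z = 0") (auto simp: Arg_eq_Im_Ln not_less)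
    then show ?thesis using False assms by (auto simp: sector_def)
  qed
  also have "\<bar>arctan (Im z / Re z)\<bar> < \<omega> \<longleftrightarrow> \<bar>Im z / Re z\<bar> < tan \<omega>"
  proof -
    have *: "\<omega> = arctan (tan \<omega>)" "- \<omega> = arctan (- tan \<omega>)"
      using assms by (simp_all add: arctan_tan arctan_minus)
    show ?thesis
      using arctan_less_iff[of "Im z / Re z" "tan \<omega>"] arctan_less_iff[of "- tan \<omega>" "Im z / Re z"]
      unfolding *[symmetric] by linarith
  qed
  also have "Re z > 0 \<and> \<bar>Im z / Re z\<bar> < tan \<omega> \<longleftrightarrow> Re z > 0 \<and> \<bar>Im z\<bar> < tan \<omega> * Re z"
    by (cases "Re z > 0") (simp_all add: abs_divide pos_divide_less_eq)
  finally show ?thesis .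
qed

lemma tan_strict_mono: "0 < a \<Longrightarrow> a < b \<Longrightarrow> b < pi / 2 \<Longrightarrow> tan a < tan b"
  by (rule tan_monotone) auto

lemma sin_strict_mono: "0 < a \<Longrightarrow> a < b \<Longrightarrow> b < pi / 2 \<Longrightarrow> sin a < sin b"
  by (rule sin_monotone_2pi) auto

lemma cos_pos_acute: "0 < a \<Longrightarrow> a < pi / 2 \<Longrightarrow> cos a > 0"
  by (rule cos_gt_zero_pi) auto

lemma sin_less_one_acute:
  assumes "0 < a" "a < pi / 2"
  shows "sin a < 1"
proof -
  have "sin a < sin ((a + pi / 2) / 2)" using assms by (intro sin_strict_mono) auto
  then show ?thesis using sin_le_one[of "(a + pi / 2) / 2"] by linarith
qed

text \<open>For acute positive angles this is the closure of \<open>sector\<close>. The linear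
  inequality treats the vertex 0, where \<open>Arg\<close> carries no information, on the same
  footing as the other points.\<close>

definition closed_sector :: "real \<Rightarrow> complex set" where
  "closed_sector \<omega> = {z. \<bar>Im z\<bar> \<le> tan \<omega> * Re z}"

lemma closed_sector_Re_pos:
  assumes "0 < \<omega>" "\<omega> < pi / 2" "z \<in> closed_sector \<omega>" "z \<noteq> 0"
  shows "Re z > 0"
proof (rule ccontr)
  assume "\<not> Re z > 0"
  moreover have t: "tan \<omega> > 0" using assms by (simp add: tan_gt_zero)
  ultimately have "tan \<omega> * Re z \<le> 0" by (simp add: mult_nonneg_nonpos)
  moreover have *: "\<bar>Im z\<bar> \<le> tan \<omega> * Re z" using assms(3) by (simp add: closed_sector_def)
  ultimately have "Im z = 0" "tan \<omega> * Re z = 0" by linarith+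
  moreover from this have "Re z = 0" using t by (metis less_irrefl mult_eq_0_iff)
  ultimately show False using \<open>z \<noteq> 0\<close> by (simp add: complex_eq_iff)
qed

lemma sector_subset_closed_sector: "0 < \<omega> \<Longrightarrow> \<omega> < pi / 2 \<Longrightarrow> sector \<omega> \<subseteq> closed_sector \<omega>"
  by (auto simp: sector_iff closed_sector_def)

lemma closed_sector_subset_sector:
  assumes "0 < \<omega>" "\<omega> < \<theta>" "\<theta> < pi / 2"
  shows "closed_sector \<omega> - {0} \<subseteq> sector \<theta>"
proof
  fix z assume z: "z \<in> closed_sector \<omega> - {0}"
  then have "Re z > 0" using closed_sector_Re_pos[of \<omega> z] assms by auto
  then have "tan \<omega> * Re z < tan \<theta> * Re z" using tan_strict_mono[of \<omega> \<theta>] assms by simp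
  moreover have "\<bar>Im z\<bar> \<le> tan \<omega> * Re z" using z by (simp add: closed_sector_def)
  ultimately have "\<bar>Im z\<bar> < tan \<theta> * Re z" by linarith
  then show "z \<in> sector \<theta>" using \<open>Re z > 0\<close> assms by (simp add: sector_iff)
qed

lemma closed_sector_closed: "closed (closed_sector \<omega>)"
  unfolding closed_sector_def by (intro closed_Collect_le continuous_intros)

lemma closed_sector_scale: "z \<in> closed_sector \<omega> \<Longrightarrow> t \<ge> 0 \<Longrightarrow> of_real t * z \<in> closed_sector \<omega>"
  using mult_left_mono[of "\<bar>Im z\<bar>" "tan \<omega> * Re z" t] by (auto simp: closed_sector_def abs_mult mult_ac)

lemma cis_mem_sector:
  assumes "0 < \<theta>" "\<theta> < pi / 2" "\<bar>a\<bar> < \<theta>" "r > 0"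
  shows "of_real r * cis a \<in> sector \<theta>"
proof -
  have "a \<in> {- pi<..pi}" using assms by auto
  then have "Arg (of_real r * cis a) = a"
    using assms by (simp add: Arg_times_of_real Arg_cis)
  then show ?thesis using assms by (auto simp: sector_def)
qed

text \<open>Otherwise the point would lie in the open sector of an angle halfway between \<omega>
  and |a|, which contradicts its argument.\<close>

lemma cis_not_mem_closed_sector:
  assumes "0 < \<omega>" "\<omega> < \<bar>a\<bar>" "\<bar>a\<bar> < pi / 2" "r > 0"
  shows "of_real r * cis a \<notin> closed_sector \<omega>"
proof
  define \<theta> where "\<theta> = (\<omega> + \<bar>a\<bar>) / 2"
  assume "of_real r * cis a \<in> closed_sector \<omega>"
  moreover have "of_real r * cis a \<noteq> 0" using assms by simp
  ultimately have "of_real r * cis a \<in> sector \<theta>"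
    using closed_sector_subset_sector[of \<omega> \<theta>] assms by (auto simp: \<theta>_def)
  moreover have "a \<in> {- pi<..pi}" using assms by auto
  then have "Arg (of_real r * cis a) = a"
    using assms by (simp add: Arg_times_of_real Arg_cis)
  ultimately show False using assms by (auto simp: sector_def \<theta>_def)
qed

lemma open_sector:
  assumes "0 < \<omega>" "\<omega> < pi / 2"
  shows "open (sector \<omega>)"
proof -
  have "sector \<omega> = {z. 0 < Re z} \<inter> {z. \<bar>Im z\<bar> < tan \<omega> * Re z}"
    using sector_iff[OF assms] by auto
  also have "open \<dots>" by (intro open_Int open_Collect_less continuous_intros)
  finally show ?thesis .
qed

text \<open>The hull of the vertex \<open>0\<close> and the disc of radius \<open>sin \<gamma>\<close> about \<open>1\<close> is the union of the
  discs obtained by scaling that disc by \<open>t \<in> [0, 1]\<close>; \<open>scaled_discs\<close> below is the closed version.\<close>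

lemma stolz_delta_iff:
  assumes "0 < \<gamma>" "\<gamma> < pi / 2"
  shows "z \<in> stolz_delta \<gamma> \<longleftrightarrow> (\<exists>t\<in>{0<..1}. cmod (z - of_real t) < t * sin \<gamma>)"
proof -
  define s where "s = sin \<gamma>"
  have s: "0 < s" "s < 1"
    using assms sin_less_one_acute[of \<gamma>] by (auto simp: s_def sin_gt_zero2)
  define U where "U = (\<Union>t\<in>{0<..1}. ball (1 - complex_of_real t) (t * s))"
  have hb: "convex hull (ball 0 s) = (ball 0 s :: complex set)"
    by (simp add: convex_hull_eq)
  have "convex hull (insert 1 (ball 0 s)) = insert 1 U"
  proof (intro equalityI subsetI)
    fix z :: complex assume "z \<in> convex hull (insert 1 (ball 0 s))"
    then have "z \<in> {x. \<exists>u\<ge>0. \<exists>v\<ge>0. \<exists>b. u + v = 1 \<and> b \<in> convex hull (ball 0 s) \<and> x = u *\<^sub>R 1 + v *\<^sub>R b}"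
      using s by (subst (asm) convex_hull_insert) auto
    then obtain u v b where uv: "u \<ge> 0" "v \<ge> 0" "u + v = (1 :: real)" and b: "b \<in> ball 0 s"
      and z: "z = u *\<^sub>R 1 + v *\<^sub>R b"
      unfolding hb by auto
    show "z \<in> insert 1 U"
    proof (cases "v = 0")
      case True
      then show ?thesis using uv z by simp
    next
      case False
      have "z - (1 - of_real v) = v *\<^sub>R b"
        using uv z by (simp add: scaleR_conv_of_real algebra_simps flip: of_real_add)
      then have "dist (1 - of_real v) z = v * norm b"
        using uv by (simp add: dist_norm norm_minus_commute)
      then have "z \<in> ball (1 - of_real v) (v * s)"
        using b uv False by simp
      then show ?thesis using uv False by (auto simp: U_def)
    qed
  next
    fix z assume z: "z \<in> insert 1 U"
    show "z \<in> convex hull (insert 1 (ball 0 s))"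
    proof (cases "z = 1")
      case True
      then show ?thesis by (simp add: hull_inc)
    next
      case False
      then obtain t where t: "t \<in> {0<..1}" "z \<in> ball (1 - of_real t) (t * s)"
        using z by (auto simp: U_def)
      define b where "b = (z - (1 - of_real t)) / of_real t"
      have "cmod (z - (1 - of_real t)) < t * s" using t(2) by (simp add: dist_norm norm_minus_commute)
      then have "b \<in> ball 0 s" using t by (simp add: b_def norm_divide field_simps)
      moreover have "z = (1 - t) *\<^sub>R 1 + t *\<^sub>R b"
        using t by (simp add: b_def scaleR_conv_of_real)
      ultimately show ?thesis
        using convexD[OF convex_convex_hull, of 1 "insert 1 (ball 0 s)" b "1 - t" t] t
        by (simp add: hull_inc)
    qed
  qed
  moreover have "interior (insert 1 U) = U"
  proof (rule interior_unique)
    show "open U" by (auto simp: U_def)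
    show "V \<subseteq> U" if V: "V \<subseteq> insert 1 U" "open V" for V
    proof -
      \<comment> \<open>An open set around the vertex contains points \<open>1 + e / 2\<close> to
        its right. No disc of the union reaches them: the centre \<open>1 - t\<close> is at distance
        \<open>t + e / 2\<close>, and its radius is below \<open>t\<close>.\<close>
      have "1 \<notin> V"
      proof
        assume "1 \<in> V"
        then obtain e where e: "e > 0" "ball 1 e \<subseteq> V" using V(2) openE by blast
        then have "1 + of_real (e / 2) \<in> V" by (auto simp: dist_norm)
        then have "1 + of_real (e / 2) \<in> U" using V(1) e(1) by auto
        then obtain t where t: "t \<in> {0<..1}" "1 + of_real (e / 2) \<in> ball (1 - complex_of_real t) (t * s)"
          by (auto simp: U_def)
        have "1 - complex_of_real t - (1 + of_real (e / 2)) = of_real (- (t + e / 2))" by simp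
        then have "dist (1 - complex_of_real t) (1 + of_real (e / 2)) = t + e / 2"
          using t e(1) by (simp only: dist_norm norm_of_real) simp
        then have "t + e / 2 < t * s" using t(2) by simp
        moreover have "t * s < t" using t s by simp
        ultimately show False using e(1) by simp
      qed
      then show ?thesis using V(1) by auto
    qed
  qed auto
  ultimately have "stolz \<gamma> = U" by (simp add: stolz_def s_def)
  then have "z \<in> stolz_delta \<gamma> \<longleftrightarrow> 1 - z \<in> U"
    by (auto simp: stolz_delta_def intro: image_eqI[of _ _ "1 - z"])
  also have "\<dots> \<longleftrightarrow> (\<exists>t\<in>{0<..1}. cmod (z - of_real t) < t * s)"
    by (simp add: U_def dist_norm)
  finally show ?thesis by (simp add: s_def)
qed

lemma open_stolz_delta: "open (stolz_delta \<gamma>)"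
proof -
  have "stolz_delta \<gamma> = (\<lambda>z. 1 - z) -` stolz \<gamma>"
    by (force simp: stolz_delta_def image_iff)
  moreover have "open ((\<lambda>z. 1 - z) -` stolz \<gamma>)"
    unfolding stolz_def by (intro open_vimage open_interior continuous_intros)
  ultimately show ?thesis by simp
qed

lemma convex_stolz_delta: "convex (stolz_delta \<gamma>)"
proof -
  have "stolz_delta \<gamma> = (\<lambda>z. 1 + z) ` uminus ` stolz \<gamma>"
    by (auto simp: stolz_delta_def image_image)
  then show ?thesis by (simp add: stolz_def convex_translation convex_negations)
qed

definition scaled_discs :: "real \<Rightarrow> complex set" where
  "scaled_discs \<alpha> = {z. \<exists>t\<in>{0..1}. cmod (z - of_real t) \<le> t * sin \<alpha>}"

text \<open>An infinite union of closed discs need not be closed; this one is the projection of a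
  compact set of pairs of a point and a parameter.\<close>

lemma closed_scaled_discs: "closed (scaled_discs \<alpha>)"
proof -
  let ?S = "{p :: complex \<times> real. cmod (fst p - of_real (snd p)) \<le> snd p * sin \<alpha>} \<inter> (UNIV \<times> {0..1})"
  have "closed ?S"
    by (intro closed_Int closed_Collect_le continuous_intros closed_Times closed_UNIV closed_atLeastAtMost)
  moreover have "bounded ?S"
  proof (rule bounded_subset)
    show "?S \<subseteq> cball 0 2 \<times> {0..1}"
    proof safe
      fix z :: complex and t :: real
      assume *: "cmod (fst (z, t) - of_real (snd (z, t))) \<le> snd (z, t) * sin \<alpha>" "t \<in> {0..1}"
      then have "cmod (z - of_real t) \<le> t * sin \<alpha>" by simp
      also have "\<dots> \<le> t * 1" using * by (intro mult_left_mono) auto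
      also have "\<dots> \<le> 1" using * by simp
      finally have "cmod z \<le> 1 + cmod (of_real t)"
        using norm_triangle_ineq[of "z - of_real t" "of_real t"] by simp
      then show "z \<in> cball 0 2" using * by simp
    qed
  qed (simp add: bounded_Times)
  ultimately have "compact (fst ` ?S)"
    by (intro compact_continuous_image continuous_intros) (simp add: compact_eq_bounded_closed)
  moreover have "fst ` ?S = scaled_discs \<alpha>" by (force simp: scaled_discs_def image_iff)
  ultimately show ?thesis by (simp add: compact_imp_closed)
qed

lemma scaled_discs_scale:
  assumes "z \<in> scaled_discs \<alpha>" "0 \<le> u" "u \<le> 1"
  shows "of_real u * z \<in> scaled_discs \<alpha>"
proof -
  obtain t where t: "t \<in> {0..1}" "cmod (z - of_real t) \<le> t * sin \<alpha>" using assms(1) by (auto simp: scaled_discs_def)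
  have "cmod (of_real u * z - of_real (u * t)) = u * cmod (z - of_real t)"
    using assms by (metis abs_of_nonneg norm_mult norm_of_real of_real_mult right_diff_distrib)
  also have "\<dots> \<le> (u * t) * sin \<alpha>" using mult_left_mono[OF t(2) assms(2)] by simp
  finally show ?thesis using t assms mult_le_one[of u t] by (auto simp: scaled_discs_def intro!: bexI[of _ "u * t"])
qed

lemma zero_mem_scaled_discs: "0 \<in> scaled_discs \<alpha>"
  by (auto simp: scaled_discs_def intro: bexI[of _ 0])

lemma stolz_delta_subset_scaled_discs: "0 < \<gamma> \<Longrightarrow> \<gamma> < pi / 2 \<Longrightarrow> stolz_delta \<gamma> \<subseteq> scaled_discs \<gamma>"
proof
  fix z assume "0 < \<gamma>" "\<gamma> < pi / 2" "z \<in> stolz_delta \<gamma>"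
  then obtain t where "t \<in> {0<..1}" "cmod (z - of_real t) < t * sin \<gamma>"
    using stolz_delta_iff by blast
  then show "z \<in> scaled_discs \<gamma>" by (auto simp: scaled_discs_def intro!: bexI[of _ t])
qed

lemma scaled_discs_subset_stolz_delta:
  assumes "0 < \<beta>" "\<beta> < \<gamma>" "\<gamma> < pi / 2"
  shows "scaled_discs \<beta> - {0} \<subseteq> stolz_delta \<gamma>"
proof
  fix z assume z: "z \<in> scaled_discs \<beta> - {0}"
  then obtain t where t: "t \<in> {0..1}" "cmod (z - of_real t) \<le> t * sin \<beta>" by (auto simp: scaled_discs_def)
  have "t \<noteq> 0" using t z by auto
  then have "t * sin \<beta> < t * sin \<gamma>" using t sin_strict_mono[of \<beta> \<gamma>] assms by simp
  then have "cmod (z - of_real t) < t * sin \<gamma>" using t(2) by linarith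
  then show "z \<in> stolz_delta \<gamma>"
    using t(1) \<open>t \<noteq> 0\<close> assms by (subst stolz_delta_iff) (auto intro!: bexI[of _ t])
qed

text \<open>The disc of radius \<open>t sin \<alpha>\<close> about \<open>t\<close> touches the two
  rays at angles \<alpha> and -\<alpha>, since \<open>t\<close> has exactly that distance from
  them.\<close>

lemma scaled_discs_subset_closed_sector:
  assumes "0 < \<alpha>" "\<alpha> < pi / 2"
  shows "scaled_discs \<alpha> \<subseteq> closed_sector \<alpha>"
proof
  fix z assume "z \<in> scaled_discs \<alpha>"
  then obtain t where t: "t \<in> {0..1}" "cmod (z - of_real t) \<le> t * sin \<alpha>" by (auto simp: scaled_discs_def)
  let ?c = "cos \<alpha>" and ?s = "sin \<alpha>" and ?x = "Re z - t" and ?y = "\<bar>Im z\<bar>"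
  have pos: "?c > 0" "?s > 0" using assms by (auto simp: cos_pos_acute sin_gt_zero2)
  have "(cmod (z - of_real t))\<^sup>2 \<le> (t * ?s)\<^sup>2" using t by (intro power_mono) auto
  then have le: "?x\<^sup>2 + ?y\<^sup>2 \<le> (t * ?s)\<^sup>2" by (simp add: cmod_power2)
  \<comment> \<open>A rotation by \<alpha> preserves the norm; \<open>?y * ?c - ?s * ?x\<close> is
    the component normal to the boundary ray.\<close>
  have "(?y * ?c - ?s * ?x)\<^sup>2 + (?x * ?c + ?y * ?s)\<^sup>2 = (?x\<^sup>2 + ?y\<^sup>2) * (?s\<^sup>2 + ?c\<^sup>2)"
    unfolding power2_eq_square by algebra
  then have "(?y * ?c - ?s * ?x)\<^sup>2 \<le> ?x\<^sup>2 + ?y\<^sup>2"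
    using zero_le_power2[of "?x * ?c + ?y * ?s"] unfolding sin_cos_squared_add mult_1_right by linarith
  then have "(?y * ?c - ?s * ?x)\<^sup>2 \<le> (t * ?s)\<^sup>2" using le by (rule order_trans)
  then have "?y * ?c - ?s * ?x \<le> t * ?s"
    by (rule power2_le_imp_le) (use t pos in simp)
  then have "?y * ?c \<le> ?s * Re z" by (simp add: algebra_simps)
  then show "z \<in> closed_sector \<alpha>" using pos by (simp add: closed_sector_def tan_def field_simps)
qed

lemma scaled_discs_norm_less:
  assumes "0 < \<alpha>" "\<alpha> < pi / 2" "z \<in> scaled_discs \<alpha>"
  shows "cmod z < 2"
proof -
  obtain t where t: "t \<in> {0..1}" "cmod (z - of_real t) \<le> t * sin \<alpha>" using assms by (auto simp: scaled_discs_def)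
  have "t * sin \<alpha> \<le> 1 * sin \<alpha>" using t assms by (intro mult_right_mono) (auto simp: sin_ge_zero)
  moreover have "cmod z \<le> cmod (z - of_real t) + cmod (of_real t)"
    using norm_triangle_ineq[of "z - of_real t" "of_real t"] by simp
  ultimately show ?thesis using t sin_less_one_acute[OF assms(1,2)] by simp
qed

text \<open>Within radius \<open>cos \<gamma>\<close> of the vertex the petal has only its straight
  sides, so it coincides there with the sector.\<close>

lemma sector_near_zero:
  assumes "0 < \<gamma>" "\<gamma> < pi / 2" "z \<in> sector \<gamma>" "cmod z < cos \<gamma>"
  shows "z \<in> stolz_delta \<gamma>"
proof -
  let ?c = "cos \<gamma>" and ?s = "sin \<gamma>"
  have pos: "?c > 0" "?s > 0" using assms by (auto simp: cos_pos_acute sin_gt_zero2)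
  have z: "Re z > 0" "\<bar>Im z\<bar> < tan \<gamma> * Re z" using assms(1-3) by (auto simp: sector_iff)
  \<comment> \<open>Membership in the disc at \<open>t\<close> reads |z|^2 + t^2 cos^2 \<gamma> < 2
    t Re z. Divided by \<open>t\<close>, the left side is smallest for this \<open>t\<close>, where
    the condition becomes |z| cos \<gamma> < Re z, a statement about the argument alone. The
    hypothesis on |z| gives \<open>t \<le> 1\<close>.\<close>
  define t where "t = cmod z / ?c"
  have nz: "cmod z > 0" using z by auto
  have t: "0 < t" "t \<le> 1"
    unfolding t_def using nz pos(1) assms(4) by (auto intro: divide_pos_pos simp only: divide_le_eq_1_pos)
  have tc: "t * ?c = cmod z" using pos by (simp add: t_def)
  have "\<bar>Im z\<bar> * ?c < ?s * Re z" using z pos by (simp add: tan_def field_simps)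
  then have "(\<bar>Im z\<bar> * ?c)\<^sup>2 < (?s * Re z)\<^sup>2" using pos by (intro power_strict_mono) auto
  moreover have "?s\<^sup>2 = 1 - ?c\<^sup>2" by (simp add: sin_squared_eq)
  ultimately have "((Re z)\<^sup>2 + (Im z)\<^sup>2) * ?c\<^sup>2 < (Re z)\<^sup>2"
    by (simp add: power_mult_distrib algebra_simps)
  then have "(cmod z * ?c)\<^sup>2 < (Re z)\<^sup>2" by (simp add: power_mult_distrib cmod_power2)
  then have "cmod z * ?c < Re z" using z(1) by (meson less_imp_le power2_less_imp_less)
  then have "2 * t * (cmod z * ?c) < 2 * t * Re z" using t by simp
  moreover have "2 * t * (cmod z * ?c) = (cmod z)\<^sup>2 + t\<^sup>2 * ?c\<^sup>2"
    using tc by (simp add: power2_eq_square flip: tc)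
  moreover have "(cmod (z - of_real t))\<^sup>2 = (cmod z)\<^sup>2 - 2 * t * Re z + t\<^sup>2"
    unfolding cmod_power2 by (simp add: power2_eq_square algebra_simps)
  moreover have "(t * ?s)\<^sup>2 = t\<^sup>2 - t\<^sup>2 * ?c\<^sup>2"
    by (simp add: power_mult_distrib sin_squared_eq algebra_simps)
  ultimately have "(cmod (z - of_real t))\<^sup>2 < (t * ?s)\<^sup>2" by simp
  then have "cmod (z - of_real t) < t * ?s"
    by (rule power2_less_imp_less) (use t pos in simp)
  then show ?thesis using t assms by (subst stolz_delta_iff) (auto intro!: bexI[of _ t])
qed

text \<open>The path \<open>1 - stolz_path\<close> with its joins unfolded: out along the lower ray,
  around the circle about 1, back along the upper ray. The right-nested \<open>+++\<close> puts the
  corners at 1/2 and 3/4.\<close>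

definition petal :: "real \<Rightarrow> real \<Rightarrow> complex" where
  "petal \<beta> t = (if t \<le> 1/2 then of_real (2 * t * cos \<beta>) * cis (- \<beta>)
     else if t \<le> 3/4 then 1 - of_real (sin \<beta>) * cis ((pi / 2 - \<beta>) + (4 * t - 2) * (pi + 2 * \<beta>))
     else of_real (4 * (1 - t) * cos \<beta>) * cis \<beta>)"

lemma one_minus_tangent_point:
  "1 - of_real (sin \<beta>) * cis (pi / 2 - \<beta>) = of_real (cos \<beta>) * cis (- \<beta>)"
  "1 - of_real (sin \<beta>) * cis (3 * pi / 2 + \<beta>) = of_real (cos \<beta>) * cis \<beta>"
proof -
  show "1 - of_real (sin \<beta>) * cis (pi / 2 - \<beta>) = of_real (cos \<beta>) * cis (- \<beta>)"
    using sin_squared_eq[of \<beta>] by (simp add: complex_eq_iff cos_diff sin_diff power2_eq_square)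
  have "cos (3 * pi / 2 + \<beta>) = sin \<beta>" "sin (3 * pi / 2 + \<beta>) = - cos \<beta>"
    using cos_periodic_pi2[of "pi / 2 + \<beta>"] sin_periodic_pi2[of "pi / 2 + \<beta>"]
    by (simp_all add: cos_add sin_add algebra_simps)
  then show "1 - of_real (sin \<beta>) * cis (3 * pi / 2 + \<beta>) = of_real (cos \<beta>) * cis \<beta>"
    using sin_squared_eq[of \<beta>] by (simp add: complex_eq_iff power2_eq_square)
qed

lemma stolz_path_eq: "stolz_path \<beta> t = 1 - petal \<beta> t"
proof -
  consider "t \<le> 1/2" | "1/2 < t" "t \<le> 3/4" | "3/4 < t" by linarith
  then show ?thesis
  proof cases
    case 1
    have "stolz_path \<beta> t = 1 - of_real (2 * t) * (1 - of_real (sin \<beta>) * cis (pi / 2 - \<beta>))"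
      using 1 by (simp add: stolz_path_def joinpaths_def linepath_def scaleR_conv_of_real algebra_simps)
    then show ?thesis using 1 by (simp add: one_minus_tangent_point petal_def mult_ac)
  next
    case 2
    have "linepath (pi / 2 - \<beta>) (3 * pi / 2 + \<beta>) (2 * (2 * t - 1)) = (pi / 2 - \<beta>) + (4 * t - 2) * (pi + 2 * \<beta>)"
      by (simp add: linepath_def field_simps)
    then show ?thesis
      using 2 by (simp add: stolz_path_def joinpaths_def part_circlepath_def petal_def cis_conv_exp mult_ac)
  next
    case 3
    have "stolz_path \<beta> t = 1 - of_real (4 - 4 * t) * (1 - of_real (sin \<beta>) * cis (3 * pi / 2 + \<beta>))"
      using 3 by (simp add: stolz_path_def joinpaths_def linepath_def scaleR_conv_of_real algebra_simps)
    then show ?thesis using 3 unfolding one_minus_tangent_point by (simp add: petal_def algebra_simps)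
  qed
qed

section \<open>Separating functionals and primitives\<close>

text \<open>Homogeneity is stated as an inequality because that is what passes to infima; applying
  it to \<open>t\<close> and to \<open>1 / t\<close> yields equality.\<close>

definition sublinear :: "('a :: real_vector \<Rightarrow> real) \<Rightarrow> bool" where
  "sublinear p \<longleftrightarrow> (\<forall>x y. p (x + y) \<le> p x + p y) \<and> (\<forall>t\<ge>0. \<forall>x. p (t *\<^sub>R x) \<le> t * p x)"

lemma sublinearD:
  assumes "sublinear p"
  shows "p (x + y) \<le> p x + p y" "t \<ge> 0 \<Longrightarrow> p (t *\<^sub>R x) = t * p x" "- p (- x) \<le> p x"
proof -
  show add: "p (x + y) \<le> p x + p y" for x y
    using assms by (auto simp: sublinear_def)
  have le: "p (t *\<^sub>R x) \<le> t * p x" if "t \<ge> 0" for t x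
    using assms that by (auto simp: sublinear_def)
  have zero: "p 0 = 0"
    using add[of 0 0] le[of 0 0] by simp
  show "p (t *\<^sub>R x) = t * p x" if "t \<ge> 0"
  proof (cases "t = 0")
    case False
    then show ?thesis
      using le[of t x] le[of "inverse t" "t *\<^sub>R x"] that by (simp add: field_simps)
  qed (simp add: zero)
  show "- p (- x) \<le> p x"
    using add[of x "- x"] zero by simp
qed

text \<open>A sublinear minorant of \<open>p\<close> that is linear along \<open>y\<close>: the
  choice \<open>t = 1\<close> shows that its value at \<open>- y\<close> is at most
  \<open>- p y\<close>. It serves both as the descent step of the Hahn-Banach argument and as its
  starting point in the separation of a vector from 0.\<close>

definition dip :: "('a :: real_vector \<Rightarrow> real) \<Rightarrow> 'a \<Rightarrow> 'a \<Rightarrow> real" where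
  "dip p y x = (INF t\<in>{0..}. p (x + t *\<^sub>R y) - t * p y)"

lemma dip_le:
  assumes "sublinear p" "t \<ge> 0"
  shows "dip p y x \<le> p (x + t *\<^sub>R y) - t * p y"
  unfolding dip_def
proof (rule cINF_lower)
  show "bdd_below ((\<lambda>t. p (x + t *\<^sub>R y) - t * p y) ` {0..})"
  proof (rule bdd_belowI2)
    show "- p (- x) \<le> p (x + t *\<^sub>R y) - t * p y" if "t \<in> {0..}" for t
      using sublinearD(1)[OF assms(1), of "x + t *\<^sub>R y" "- x"] sublinearD(2)[OF assms(1), of t y] that
      by simp
  qed
qed (use assms in auto)

lemma dip_greatest:
  assumes "\<And>t. t \<ge> 0 \<Longrightarrow> b \<le> p (x + t *\<^sub>R y) - t * p y"
  shows "b \<le> dip p y x"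
  unfolding dip_def by (rule cINF_greatest) (use assms in auto)

lemma sublinear_dip:
  assumes p: "sublinear p"
  shows "sublinear (dip p y)"
  unfolding sublinear_def
proof (intro conjI allI impI)
  fix x x'
  have "dip p y (x + x') - (p (x' + s *\<^sub>R y) - s * p y) \<le> p (x + t *\<^sub>R y) - t * p y"
    if "s \<ge> 0" "t \<ge> 0" for s t
    using dip_le[OF p, of "t + s" y "x + x'"] sublinearD(1)[OF p, of "x + t *\<^sub>R y" "x' + s *\<^sub>R y"] that
    by (simp add: algebra_simps)
  then have "dip p y (x + x') - (p (x' + s *\<^sub>R y) - s * p y) \<le> dip p y x" if "s \<ge> 0" for s
    using that by (intro dip_greatest) auto
  then have "dip p y (x + x') - dip p y x \<le> dip p y x'"
    by (intro dip_greatest) (smt (verit))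
  then show "dip p y (x + x') \<le> dip p y x + dip p y x'" by simp
next
  fix t :: real and x
  assume t: "t \<ge> 0"
  have le: "dip p y (t *\<^sub>R x) \<le> t * (p (x + s *\<^sub>R y) - s * p y)" if "s \<ge> 0" for s
  proof -
    have "p (t *\<^sub>R x + (t * s) *\<^sub>R y) = t * p (x + s *\<^sub>R y)"
      using sublinearD(2)[OF p t, of "x + s *\<^sub>R y"] by (simp add: scaleR_add_right)
    then show ?thesis
      using dip_le[OF p, of "t * s" y "t *\<^sub>R x"] t that by (simp add: algebra_simps)
  qed
  show "dip p y (t *\<^sub>R x) \<le> t * dip p y x"
  proof (cases "t = 0")
    case True
    then show ?thesis using le[of 0] by simp
  next
    case False
    then have "dip p y (t *\<^sub>R x) / t \<le> dip p y x"
      using t le by (intro dip_greatest) (simp add: field_simps)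
    then show ?thesis using False t by (simp add: field_simps)
  qed
qed

text \<open>A pointwise minimal sublinear functional \<open>p\<close> coincides with every \<open>dip p y\<close>, which forces
  \<open>p (- y) = - p y\<close>; thus it is linear.\<close>

lemma sublinear_dominates_linear:
  assumes q: "sublinear (q :: 'a :: real_vector \<Rightarrow> real)"
  obtains p where "linear p" "\<And>x. p x \<le> q x"
proof -
  define A where "A = {p. sublinear p \<and> p \<le> q}"
  \<comment> \<open>The order is reversed, so that Zorn's lemma yields a minimal functional.\<close>
  define P where "P = (\<lambda>p p' :: 'a \<Rightarrow> real. p' \<le> p)"
  have "partial_order_on A (relation_of P A)"
    unfolding P_def by (rule partial_order_on_relation_ofI) auto
  moreover have "\<exists>u\<in>A. \<forall>p\<in>C. P p u" if C: "C \<in> Chains (relation_of P A)" for C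
  proof (cases "C = {}")
    case True
    then show ?thesis using q by (auto simp: A_def)
  next
    case False
    have CA: "C \<subseteq> A" using C by (rule Chains_relation_of)
    have tot: "p \<le> p' \<or> p' \<le> p" if "p \<in> C" "p' \<in> C" for p p'
      using C that by (auto simp: Chains_def relation_of_def P_def)
    have bdd: "bdd_below ((\<lambda>p. p x) ` C)" for x
    proof (rule bdd_belowI2)
      fix p assume "p \<in> C"
      then have "sublinear p" "p (- x) \<le> q (- x)" using CA by (auto simp: A_def le_fun_def)
      then show "- q (- x) \<le> p x" using sublinearD(3)[of p x] by simp
    qed
    define u where "u x = (INF p\<in>C. p x)" for x
    have u_le: "u x \<le> p x" if "p \<in> C" for p x
      unfolding u_def by (rule cINF_lower[OF bdd that])
    have u_gr: "b \<le> u x" if "\<And>p. p \<in> C \<Longrightarrow> b \<le> p x" for b x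
      unfolding u_def by (rule cINF_greatest[OF False that])
    have sub: "sublinear p" if "p \<in> C" for p using that CA by (auto simp: A_def)
    have "sublinear u"
      unfolding sublinear_def
    proof (intro conjI allI impI)
      fix x y
      \<comment> \<open>Of two members of a chain, the smaller one is subadditive and lies below
        both, so it controls the mixed sum \<open>p x + p' y\<close>.\<close>
      have "u (x + y) \<le> p x + p' y" if "p \<in> C" "p' \<in> C" for p p'
        using tot[OF that] u_le[OF that(1), of "x + y"] u_le[OF that(2), of "x + y"]
          sublinearD(1)[OF sub[OF that(1)], of x y] sublinearD(1)[OF sub[OF that(2)], of x y]
        unfolding le_fun_def by (smt (verit))
      then have "u (x + y) - p' y \<le> u x" if "p' \<in> C" for p'
        using that by (intro u_gr) (smt (verit))
      then have "u (x + y) - u x \<le> u y"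
        by (intro u_gr) (smt (verit))
      then show "u (x + y) \<le> u x + u y" by simp
    next
      fix t :: real and x
      assume t: "t \<ge> 0"
      have le: "u (t *\<^sub>R x) \<le> t * p x" if "p \<in> C" for p
        using u_le[OF that, of "t *\<^sub>R x"] sublinearD(2)[OF sub[OF that] t] by simp
      show "u (t *\<^sub>R x) \<le> t * u x"
      proof (cases "t = 0")
        case True
        then show ?thesis using le False by auto
      next
        case nz: False
        then have "u (t *\<^sub>R x) / t \<le> u x"
          using t le by (intro u_gr) (simp add: field_simps)
        then show ?thesis using nz t by (simp add: field_simps)
      qed
    qed
    moreover have "u \<le> q"
    proof -
      obtain p where p: "p \<in> C" using False by auto
      have "u x \<le> q x" for x
        using u_le[OF p, of x] p CA by (auto simp: A_def le_fun_def intro: order_trans)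
      then show ?thesis by (simp add: le_fun_def)
    qed
    ultimately show ?thesis
      using u_le by (intro bexI[of _ u]) (auto simp: A_def P_def le_fun_def)
  qed
  ultimately have "\<exists>p\<in>A. \<forall>p'\<in>A. P p p' \<longrightarrow> p' = p"
    by (rule predicate_Zorn)
  then obtain p where "p \<in> A" and min: "\<And>p'. p' \<in> A \<Longrightarrow> p' \<le> p \<Longrightarrow> p' = p"
    unfolding P_def by blast
  then have p: "sublinear p" "p \<le> q" by (auto simp: A_def)
  have neg: "p (- y) = - p y" for y
  proof -
    have "dip p y \<le> p"
      using dip_le[OF p(1), of 0 y] by (simp add: le_fun_def)
    then have "dip p y = p"
      using sublinear_dip[OF p(1)] p(2) by (intro min) (auto simp: A_def)
    moreover have "dip p y (- y) \<le> p 0 - p y"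
      using dip_le[OF p(1), of 1 y "- y"] by simp
    moreover have "p 0 = 0" using sublinearD(2)[OF p(1), of 0 0] by simp
    ultimately show ?thesis using sublinearD(3)[OF p(1), of y] by simp
  qed
  have "linear p"
  proof (rule linearI)
    show add: "p (x + y) = p x + p y" for x y
      using sublinearD(1)[OF p(1), of x y] sublinearD(1)[OF p(1), of "- x" "- y"] neg[of "x + y"]
        neg[of x] neg[of y] by simp
    show "p (t *\<^sub>R x) = t *\<^sub>R p x" for t x
    proof (cases "t \<ge> 0")
      case True
      then show ?thesis using sublinearD(2)[OF p(1)] by simp
    next
      case False
      then show ?thesis
        using sublinearD(2)[OF p(1), of "- t" x] neg[of "t *\<^sub>R x"] by simp
    qed
  qed
  then show thesis using p(2) that by (auto simp: le_fun_def)
qed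

section \<open>Complex functionals separating points\<close>

definition clinear_functional :: "('b :: complex_normed_vector \<Rightarrow> complex) \<Rightarrow> bool" where
  "clinear_functional l \<longleftrightarrow> bounded_linear l \<and> (\<forall>c x. l (c *\<^sub>C x) = c * l x)"

lemma scaleC_minus_left [simp]: "(- c) *\<^sub>C x = - (c *\<^sub>C (x :: 'b :: complex_normed_vector))"
  using scaleC_add_left[of c "- c" x] scaleR_scaleC[of 0 x] by (simp add: add_eq_0_iff)

text \<open>Starting Hahn-Banach from \<open>dip norm v\<close> rather than from \<open>norm\<close>
  builds the separation in: a linear minorant is at most \<open>- norm v\<close> at
  \<open>- v\<close>.\<close>

lemma separating_functional:
  fixes v :: "'b :: complex_normed_vector"
  assumes "v \<noteq> 0"
  obtains l where "clinear_functional l" "l v \<noteq> 0"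
proof -
  have sn: "sublinear (norm :: 'b \<Rightarrow> real)"
    by (auto simp: sublinear_def norm_triangle_ineq)
  obtain p where p: "linear p" "\<And>x. p x \<le> dip norm v x"
    using sublinear_dominates_linear[OF sublinear_dip[OF sn]] by blast
  have le: "p x \<le> norm x" for x
    using p(2)[of x] dip_le[OF sn, of 0 v x] by simp
  have abs: "\<bar>p x\<bar> \<le> norm x" for x
    using le[of x] le[of "- x"] linear_neg[OF p(1), of x] by simp
  have "p (- v) \<le> - norm v"
    using p(2)[of "- v"] dip_le[OF sn, of 1 v "- v"] by simp
  then have pv: "p v \<noteq> 0"
    using assms linear_neg[OF p(1), of v] by (auto simp flip: zero_less_norm_iff)
  \<comment> \<open>The usual complexification p(x) - i p(ix) of a real functional.\<close>
  define l where "l x = Complex (p x) (- p (\<i> *\<^sub>C x))" for x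
  have add: "l (x + y) = l x + l y" for x y
    by (simp add: l_def scaleC_add_right linear_add[OF p(1)] complex_eq_iff)
  have scR: "p (complex_of_real r *\<^sub>C x) = r * p x" for r x
    using linear_scale[OF p(1), of r x] by (simp add: scaleR_scaleC)
  have lR: "l (complex_of_real r *\<^sub>C x) = of_real r * l x" for r x
  proof -
    have "\<i> *\<^sub>C (complex_of_real r *\<^sub>C x) = complex_of_real r *\<^sub>C (\<i> *\<^sub>C x)"
      by (simp add: scaleC_scaleC mult.commute)
    then show ?thesis by (simp add: l_def scR complex_eq_iff)
  qed
  have li: "l (\<i> *\<^sub>C x) = \<i> * l x" for x
    by (simp add: l_def scaleC_scaleC scaleC_one linear_neg[OF p(1)] complex_eq_iff)
  have lC: "l (c *\<^sub>C x) = c * l x" for c x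
  proof -
    have "c *\<^sub>C x = complex_of_real (Re c) *\<^sub>C x + \<i> *\<^sub>C (complex_of_real (Im c) *\<^sub>C x)"
      by (metis complex_eq scaleC_add_left scaleC_scaleC)
    then show ?thesis
      by (simp add: add lR li complex_eq_iff)
  qed
  have "bounded_linear l"
  proof (rule bounded_linear_intro[where K = 2])
    show "l (r *\<^sub>R x) = r *\<^sub>R l x" for r x
      using lC[of "of_real r" x] by (simp add: scaleR_scaleC scaleR_conv_of_real)
    show "norm (l x) \<le> norm x * 2" for x
      using cmod_le[of "l x"] abs[of x] abs[of "\<i> *\<^sub>C x"]
      by (simp add: l_def norm_scaleC)
  qed (rule add)
  moreover have "l v \<noteq> 0" using pv by (simp add: l_def complex_eq_iff)
  ultimately show thesis using that lC by (auto simp: clinear_functional_def)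
qed

lemma eq_by_functionals:
  fixes v w :: "'b :: complex_normed_vector"
  assumes "\<And>l. clinear_functional l \<Longrightarrow> l v = l w"
  shows "v = w"
proof (rule ccontr)
  assume "v \<noteq> w"
  then obtain l where l: "clinear_functional l" "l (v - w) \<noteq> 0"
    using separating_functional[of "v - w"] by auto
  have "linear l" using l(1) by (simp add: clinear_functional_def bounded_linear.linear)
  then show False using assms[OF l(1)] l(2) linear_diff[of l v w] by simp
qed

text \<open>The complement of each component of \<open>S\<close> is again connected and unbounded,
  so each component is simply connected and carries a primitive. Components are open and disjoint,
  hence these primitives can be put together without any matching.\<close>

lemma holomorphic_primitive_connected_complement:
  assumes S: "open S" "connected (- S)" "\<not> bounded (- S)" and F: "F holomorphic_on S"
  obtains H where "\<And>z. z \<in> S \<Longrightarrow> (H has_field_derivative F z) (at z)"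
proof -
  have "\<exists>h. \<forall>z\<in>C. (h has_field_derivative F z) (at z)" if C: "C \<in> components S" for C
  proof -
    have "open C" "connected C" using C S(1) by (auto intro: open_components in_components_connected)
    have "connected (- C)"
      using component_complement_connected[OF S(2), of C] C by simp
    moreover have "\<not> bounded (- C)"
      using S(3) in_components_subset[OF C] bounded_subset[of "- C" "- S"] by blast
    ultimately have "simply_connected C"
      using simply_connected_eq_unbounded_complement_components[OF \<open>open C\<close>] \<open>connected C\<close>
        components_eq_sing_iff[of "- C"] by (cases "- C = {}") auto
    then show ?thesis
      using simply_connected_eq_global_primitive[OF \<open>open C\<close>]
        holomorphic_on_subset[OF F in_components_subset[OF C]] by blast
  qed
  then obtain h where h: "\<And>C z. C \<in> components S \<Longrightarrow> z \<in> C \<Longrightarrow> (h C has_field_derivative F z) (at z)"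
    by metis
  define H where "H z = h (connected_component_set S z) z" for z
  have "(H has_field_derivative F z) (at z)" if "z \<in> S" for z
  proof -
    let ?C = "connected_component_set S z"
    have C: "?C \<in> components S" "z \<in> ?C" using that by (auto simp: components_def)
    have "open ?C" using S(1) C by (auto intro: open_components)
    show ?thesis
    proof (rule DERIV_cong_ev[THEN iffD1, rotated 3])
      show "(h ?C has_field_derivative F z) (at z)" using h C by blast
      have "eventually (\<lambda>x. x \<in> ?C) (nhds z)"
        using \<open>open ?C\<close> C(2) eventually_nhds_in_open by blast
      then show "\<forall>\<^sub>F x in nhds z. h ?C x = H x"
      proof (rule eventually_mono)
        fix x assume "x \<in> ?C"
        then have "connected_component_set S x = ?C" by (simp add: connected_component_eq)
        then show "h ?C x = H x" by (simp add: H_def)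
      qed
    qed auto
  qed
  then show thesis by (rule that)
qed

section \<open>Vector-valued integrals\<close>

text \<open>The increments of the tail integral of \<open>G\<close> are dominated by those of the
  tail integral of \<open>g\<close>, so it has a limit at the singular end. Its continuous extension
  is a primitive up to sign, and the fundamental theorem gives integrability without any
  measurability argument in the Banach space.\<close>

lemma integrable_dominated_half_open:
  fixes G :: "real \<Rightarrow> 'b :: banach"
  assumes ab: "a < b" and G: "continuous_on {a<..b} G"
    and le: "\<And>t. t \<in> {a<..b} \<Longrightarrow> norm (G t) \<le> g t" and g: "g integrable_on {a..b}"
  shows "G integrable_on {a..b}"
proof -
  define V where "V t = integral {t..b} G" for t
  define W where "W t = integral {t..b} g" for t
  have Gint: "G integrable_on {s..t}" if "a < s" "t \<le> b" for s t
    by (rule integrable_continuous_real, rule continuous_on_subset[OF G]) (use that in auto)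
  have gint: "g integrable_on {s..t}" if "a \<le> s" "t \<le> b" for s t
    by (rule integrable_subinterval_real[OF g]) (use that in auto)
  have VW0: "norm (V s - V t) \<le> \<bar>W s - W t\<bar>" if "a < s" "s \<le> t" "t \<le> b" for s t
  proof -
    have "V s - V t = integral {s..t} G"
      unfolding V_def using Henstock_Kurzweil_Integration.integral_combine[of s t b G] Gint[of s b] that
      by (simp add: algebra_simps)
    moreover have "W s - W t = integral {s..t} g"
      unfolding W_def using Henstock_Kurzweil_Integration.integral_combine[of s t b g] gint[of s b] that
      by (simp add: algebra_simps)
    moreover have "norm (integral {s..t} G) \<le> integral {s..t} g"
      by (rule integral_norm_bound_integral) (use that Gint gint le in auto)
    ultimately show ?thesis by simp
  qed
  have VW: "norm (V s - V t) \<le> \<bar>W s - W t\<bar>" if "s \<in> {a<..b}" "t \<in> {a<..b}" for s t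
    using VW0[of s t] VW0[of t s] that by (cases "s \<le> t") (auto simp: norm_minus_commute abs_minus_commute)
  have contW: "continuous_on {a..b} W"
    unfolding W_def by (rule indefinite_integral_continuous_1'[OF g])
  define x where "x n = a + (b - a) / real (Suc n)" for n
  have x: "x n \<in> {a<..b}" for n
    using ab by (auto simp: x_def field_simps intro: mult_right_mono)
  have "x \<longlonglongrightarrow> a + (b - a) * 0"
    unfolding x_def divide_inverse by (intro tendsto_intros LIMSEQ_inverse_real_of_nat)
  then have "x \<longlonglongrightarrow> a" by simp
  then have Wx: "(\<lambda>n. W (x n)) \<longlonglongrightarrow> W a"
  proof (rule continuous_on_tendsto_compose[OF contW])
    have "x n \<in> {a..b}" for n using x[of n] by auto
    then show "\<forall>\<^sub>F n in sequentially. x n \<in> {a..b}" by simp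
  qed (use ab in auto)
  have "Cauchy (\<lambda>n. V (x n))"
  proof (rule metric_CauchyI)
    fix e :: real assume "0 < e"
    with LIMSEQ_imp_Cauchy[OF Wx] obtain M where "\<And>m n. m \<ge> M \<Longrightarrow> n \<ge> M \<Longrightarrow> dist (W (x m)) (W (x n)) < e"
      using metric_CauchyD by blast
    then show "\<exists>M. \<forall>m\<ge>M. \<forall>n\<ge>M. dist (V (x m)) (V (x n)) < e"
      by (intro exI[of _ M]) (auto simp: dist_norm intro: le_less_trans[OF VW[OF x x]])
  qed
  then obtain L where L: "(\<lambda>n. V (x n)) \<longlonglongrightarrow> L"
    by (auto simp: Cauchy_convergent_iff convergent_def)
  \<comment> \<open>The tail integral, completed by its limit at the singular end
    \<open>a\<close>.\<close>
  define V' where "V' t = (if t = a then L else V t)" for t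
  have LW: "norm (L - V t) \<le> \<bar>W a - W t\<bar>" if "t \<in> {a<..b}" for t
    by (rule LIMSEQ_le[OF tendsto_norm[OF tendsto_diff[OF L tendsto_const]]
          tendsto_rabs[OF tendsto_diff[OF Wx tendsto_const]]]) (use VW x that in auto)
  have VW': "norm (V' s - V' t) \<le> \<bar>W s - W t\<bar>" if "s \<in> {a..b}" "t \<in> {a..b}" for s t
    using VW[of s t] LW[of s] LW[of t] that ab
    by (auto simp: V'_def norm_minus_commute abs_minus_commute)
  have "continuous_on {a..b} V'"
    unfolding continuous_on_iff
  proof (intro ballI allI impI)
    fix s and e :: real assume s: "s \<in> {a..b}" "0 < e"
    then obtain d where "d > 0" "\<And>t. t \<in> {a..b} \<Longrightarrow> dist t s < d \<Longrightarrow> dist (W t) (W s) < e"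
      using contW unfolding continuous_on_iff by blast
    then show "\<exists>d>0. \<forall>t\<in>{a..b}. dist t s < d \<longrightarrow> dist (V' t) (V' s) < e"
      by (intro exI[of _ d]) (auto simp: dist_norm intro: le_less_trans[OF VW'[OF _ s(1)]])
  qed
  moreover have "(V' has_vector_derivative - G t) (at t)" if t: "t \<in> {a<..<b} - {}" for t
  proof -
    obtain c where c: "a < c" "c < t" using t dense[of a t] by auto
    have "(V has_vector_derivative - G t) (at t within {c..b})"
      unfolding V_def
      by (rule integral_has_vector_derivative'[OF continuous_on_subset[OF G]]) (use c t in auto)
    moreover have "at t within {c..b} = at t"
      by (rule at_within_interior) (use c t in auto)
    ultimately have "(V has_vector_derivative - G t) (at t)" by simp
    then show ?thesis
      by (rule has_vector_derivative_transform_within_open[where S = "{a<..}"])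
        (use t in \<open>auto simp: V'_def\<close>)
  qed
  ultimately have "((\<lambda>t. - G t) has_integral (V' b - V' a)) {a..b}"
    using ab by (intro fundamental_theorem_of_calculus_interior_strong[of "{}"]) auto
  from has_integral_neg[OF this] show ?thesis by (auto simp: integrable_on_def)
qed

lemma integrable_dominated:
  fixes G :: "real \<Rightarrow> 'b :: banach"
  assumes ab: "a < b" and G: "continuous_on {a<..<b} G"
    and le: "\<And>t. t \<in> {a<..<b} \<Longrightarrow> norm (G t) \<le> g t" and g: "g integrable_on {a..b}"
  shows "G integrable_on {a..b}"
proof -
  define c where "c = (a + b) / 2"
  have c: "a < c" "c < b" using ab by (auto simp: c_def)
  have gi: "g integrable_on {s..t}" if "a \<le> s" "t \<le> b" for s t
    by (rule integrable_subinterval_real[OF g]) (use that in auto)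
  have "G integrable_on {a..c}"
    by (rule integrable_dominated_half_open[OF c(1), of _ g])
      (use c le gi in \<open>auto intro: continuous_on_subset[OF G]\<close>)
  moreover have "(\<lambda>t. G (- t)) integrable_on {- b..- c}"
  proof (rule integrable_dominated_half_open[of _ _ _ "\<lambda>t. g (- t)"])
    show "continuous_on {- b<..- c} (\<lambda>t. G (- t))"
      by (rule continuous_on_compose2[OF G]) (use c in \<open>auto intro!: continuous_intros\<close>)
    show "(\<lambda>t. g (- t)) integrable_on {- b..- c}"
      using gi[of c b] c by (simp add: integrable_reflect_real)
  qed (use c le in auto)
  ultimately show ?thesis
    using c by (intro Henstock_Kurzweil_Integration.integrable_combine[of a c b])
      (auto simp: integrable_reflect_real)
qed

lemma integrable_dominated_half_line:
  fixes G :: "real \<Rightarrow> 'b :: banach"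
  assumes G: "continuous_on {0<..} G"
    and le: "\<And>t. t > 0 \<Longrightarrow> norm (G t) \<le> g t" and g: "g integrable_on {0<..}"
  shows "G integrable_on {0<..}"
proof (rule integrable_on_all_intervals_integrable_bound[where g = g])
  fix a b :: real
  let ?G = "\<lambda>t. if t \<in> {0<..} then G t else 0"
  define c d where "c = min a (-1)" and "d = max b 1"
  have "(\<lambda>t. if t \<in> {0<..} then g t else 0) integrable_on {0..d}"
    using integrable_altD(1)[OF g, of 0 d] by simp
  then have "G integrable_on {0..d}"
    by (rule integrable_dominated[rotated 3])
      (use le in \<open>auto simp: d_def intro: continuous_on_subset[OF G]\<close>)
  then have "?G integrable_on {0..d}"
    by (rule integrable_spike_finite[of "{0}", rotated 2]) auto
  moreover have "?G integrable_on {c..0}"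
    by (rule integrable_eq[OF integrable_0]) auto
  ultimately have "?G integrable_on {c..d}"
    by (intro Henstock_Kurzweil_Integration.integrable_combine[of c 0 d]) (auto simp: c_def d_def)
  then show "?G integrable_on cbox a b"
    by (rule integrable_on_subcbox[of _ "{c..d}"]) (auto simp: c_def d_def)
qed (use le g in auto)

text \<open>Minkowski's inequality for a weighted Euclidean norm over an interval of length 1. With
  \<open>b\<close> the vector of integrals and \<open>Q\<close> its weighted square norm, the
  weighted inner product of \<open>b\<close> and \<open>u\<close> integrates to \<open>Q\<close>,
  and by 2bu <= b^2 + u^2 it is at most \<open>(Q + B) / 2\<close> pointwise. Thus only the
  functions \<open>u i\<close> themselves are integrated, not their squares.\<close>

lemma integral_square_sum_le:
  fixes u :: "'i \<Rightarrow> real \<Rightarrow> real"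
  assumes "finite I" and p: "\<And>i. i \<in> I \<Longrightarrow> p i \<ge> 0"
    and u: "\<And>i. i \<in> I \<Longrightarrow> u i integrable_on {0..1}"
    and le: "\<And>t. t \<in> {0..1} \<Longrightarrow> (\<Sum>i\<in>I. p i * (u i t)\<^sup>2) \<le> B"
  shows "(\<Sum>i\<in>I. p i * (integral {0..1} (u i))\<^sup>2) \<le> B"
proof -
  define b where "b i = integral {0..1} (u i)" for i
  define Q where "Q = (\<Sum>i\<in>I. p i * (b i)\<^sup>2)"
  have "((\<lambda>t. \<Sum>i\<in>I. p i * b i * u i t) has_integral (\<Sum>i\<in>I. p i * b i * b i)) {0..1}"
    unfolding b_def using \<open>finite I\<close> u
    by (intro has_integral_sum has_integral_mult_right) (auto simp: has_integral_integral)
  then have "((\<lambda>t. \<Sum>i\<in>I. p i * b i * u i t) has_integral Q) {0..1}"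
    by (simp add: Q_def power2_eq_square mult.assoc)
  moreover have "((\<lambda>t. (Q + B) / 2) has_integral (Q + B) / 2) {0..1::real}"
    using has_integral_const_real[of "(Q + B) / 2" 0 1] by simp
  moreover have "(\<Sum>i\<in>I. p i * b i * u i t) \<le> (Q + B) / 2" if "t \<in> {0..1}" for t
  proof -
    have "2 * (p i * b i * u i t) \<le> p i * (b i)\<^sup>2 + p i * (u i t)\<^sup>2" if "i \<in> I" for i
      using mult_nonneg_nonneg[OF p[OF that] zero_le_power2[of "b i - u i t"]]
      by (simp add: power2_eq_square algebra_simps)
    then have "2 * (\<Sum>i\<in>I. p i * b i * u i t) \<le> Q + (\<Sum>i\<in>I. p i * (u i t)\<^sup>2)"
      unfolding Q_def sum_distrib_left sum.distrib[symmetric] by (rule sum_mono)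
    then show ?thesis using le[OF that] by simp
  qed
  ultimately have "Q \<le> (Q + B) / 2" by (rule has_integral_le)
  then show ?thesis by (simp add: Q_def b_def)
qed

section \<open>Resolvents\<close>

lemma scaleC_diff_right: "c *\<^sub>C (x - y) = c *\<^sub>C x - c *\<^sub>C (y :: 'b :: complex_normed_vector)"
  by (rule linear_diff[OF bounded_linear.linear[OF bounded_linear_scaleC]])

lemma scaleC_minus_right: "c *\<^sub>C (- x) = - (c *\<^sub>C (x :: 'b :: complex_normed_vector))"
  by (rule linear_neg[OF bounded_linear.linear[OF bounded_linear_scaleC]])

lemma is_resolvent_unique:
  assumes "is_resolvent D A z R" "is_resolvent D A z R'"
  shows "R = R'"
proof (rule blinfun_eqI)
  fix y
  have "R' y \<in> D" "z *\<^sub>C R' y - A (R' y) = y" using assms(2) by (auto simp: is_resolvent_def)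
  then show "R y = R' y" using assms(1) unfolding is_resolvent_def by metis
qed

lemma resolvent_eqI: "is_resolvent D A z R \<Longrightarrow> resolvent D A z = R"
  unfolding resolvent_def using is_resolvent_unique by blast

lemma is_resolvent_resolvent:
  assumes "z \<notin> spectrum D A"
  shows "is_resolvent D A z (resolvent D A z)"
  using assms resolvent_eqI by (auto simp: spectrum_def)

lemma is_resolvent_scaleC:
  assumes A: "complex_linear_on UNIV A" and R: "is_resolvent UNIV A z R"
  shows "R (c *\<^sub>C y) = c *\<^sub>C R y"
proof -
  have "z *\<^sub>C (c *\<^sub>C R y) - A (c *\<^sub>C R y) = c *\<^sub>C (z *\<^sub>C R y - A (R y))"
    using A by (simp add: complex_linear_on_def scaleC_scaleC mult.commute scaleC_diff_right)
  also have "\<dots> = c *\<^sub>C y" using R by (simp add: is_resolvent_def)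
  finally show ?thesis using R by (metis UNIV_I is_resolvent_def)
qed

lemma is_resolvent_diff:
  assumes A: "complex_linear_on UNIV A" and R: "is_resolvent UNIV A z R" "is_resolvent UNIV A w R'"
  shows "R - R' = (w - z) *\<^sub>C (R o\<^sub>L R')"
proof (rule blinfun_eqI)
  fix y
  have "z *\<^sub>C R' y - A (R' y) = (z - w) *\<^sub>C R' y + (w *\<^sub>C R' y - A (R' y))"
    by (simp flip: scaleC_add_left)
  then have "z *\<^sub>C R' y - A (R' y) = (z - w) *\<^sub>C R' y + y"
    using R(2) by (simp add: is_resolvent_def)
  then have "R' y = R ((z - w) *\<^sub>C R' y + y)"
    using R(1) by (metis UNIV_I is_resolvent_def)
  also have "\<dots> = (z - w) *\<^sub>C R (R' y) + R y"
    by (simp add: blinfun.add_right is_resolvent_scaleC[OF A R(1)])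
  finally have "R y - R' y = (- (z - w)) *\<^sub>C R (R' y)"
    by (simp only: scaleC_minus_left) (simp add: algebra_simps)
  then show "blinfun_apply (R - R') y = blinfun_apply ((w - z) *\<^sub>C (R o\<^sub>L R')) y"
    by (simp add: blinfun.diff_left scaleC_blinfun.rep_eq)
qed

text \<open>The resolvent identity bounds the difference by the product of both norms. Near
  \<open>w\<close> half of the norm at \<open>z\<close> is absorbed, which first bounds the
  resolvent locally; no Neumann series enters.\<close>

lemma continuous_on_resolvent:
  assumes A: "complex_linear_on UNIV A" and S: "S \<inter> spectrum UNIV A = {}"
  shows "continuous_on S (resolvent UNIV A)"
  unfolding continuous_on_def
proof
  fix w assume w: "w \<in> S"
  let ?R = "resolvent UNIV A"
  have res: "is_resolvent UNIV A z (?R z)" if "z \<in> S" for z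
    using S that by (auto intro: is_resolvent_resolvent)
  have le: "norm (?R z - ?R w) \<le> cmod (w - z) * (norm (?R z) * norm (?R w))" if "z \<in> S" for z
    using is_resolvent_diff[OF A res[OF that] res[OF w]] norm_blinfun_compose[of "?R z" "?R w"]
    by (simp add: norm_scaleC mult_left_mono)
  \<comment> \<open>Chosen so that \<open>cmod (w - z) * ?M < 1\<close> forces
    \<open>cmod (w - z) * norm (?R w) \<le> 1 / 2\<close>, the absorption condition; the added 1
    keeps it positive.\<close>
  let ?M = "2 * (norm (?R w) + 1)"
  have le2: "norm (?R z - ?R w) \<le> cmod (w - z) * (?M * ?M)" if "z \<in> S" "cmod (w - z) * ?M < 1" for z
  proof -
    have "2 * (cmod (w - z) * norm (?R w)) + 2 * cmod (w - z) < 1"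
      using that(2) by (simp add: algebra_simps)
    then have "cmod (w - z) * norm (?R w) \<le> 1 / 2"
      using norm_ge_zero[of "w - z"] by linarith
    then have "norm (?R z) * (cmod (w - z) * norm (?R w)) \<le> norm (?R z) * (1 / 2)"
      by (rule mult_left_mono) simp
    moreover have "norm (?R z) \<le> norm (?R w) + norm (?R z - ?R w)"
      using norm_triangle_ineq[of "?R w" "?R z - ?R w"] by simp
    ultimately have "norm (?R z) \<le> 2 * norm (?R w)" using le[OF that(1)] by (simp add: mult_ac)
    then have "norm (?R z) * norm (?R w) \<le> ?M * ?M" by (intro mult_mono) auto
    then show ?thesis using le[OF that(1)] by (meson mult_left_mono norm_ge_zero order_trans)
  qed
  have "((\<lambda>z. cmod (w - z) * ?M) \<longlongrightarrow> cmod (w - w) * ?M) (at w within S)"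
    by (intro tendsto_intros)
  then have "eventually (\<lambda>z. cmod (w - z) * ?M < 1) (at w within S)"
    by (rule order_tendstoD) simp
  moreover have "eventually (\<lambda>z. z \<in> S) (at w within S)"
    by (simp add: eventually_at_filter)
  ultimately have "eventually (\<lambda>z. norm (?R z - ?R w) \<le> cmod (w - z) * (?M * ?M)) (at w within S)"
    by eventually_elim (rule le2)
  moreover have "((\<lambda>z. cmod (w - z) * (?M * ?M)) \<longlongrightarrow> cmod (w - w) * (?M * ?M)) (at w within S)"
    by (intro tendsto_intros)
  then have "((\<lambda>z. cmod (w - z) * (?M * ?M)) \<longlongrightarrow> 0) (at w within S)"
    by (simp only: diff_self norm_zero mult_zero_left)
  ultimately have "((\<lambda>z. ?R z - ?R w) \<longlongrightarrow> 0) (at w within S)"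
    by (rule Lim_null_comparison)
  then show "(?R \<longlongrightarrow> ?R w) (at w within S)" by (simp add: LIM_zero_iff)
qed

lemma clinear_functional_simps:
  assumes "clinear_functional l"
  shows "l (x + y) = l x + l y" "l (x - y) = l x - l y" "l (c *\<^sub>C x) = c * l x" "l (- x) = - l x"
  using assms by (auto simp: clinear_functional_def linear_add linear_diff linear_neg
      dest: bounded_linear.linear)

text \<open>By the resolvent identity the difference quotient at \<open>w\<close> is minus
  \<open>l\<close> of the product of the two resolvents, and continuity of the resolvent gives its
  limit.\<close>

lemma holomorphic_functional_resolvent:
  assumes A: "complex_linear_on UNIV A" and S: "S \<inter> spectrum UNIV A = {}" "open S"
    and l: "clinear_functional l"
  shows "(\<lambda>z. l (resolvent UNIV A z)) holomorphic_on S"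
  unfolding holomorphic_on_open[OF S(2)]
proof
  fix w assume w: "w \<in> S"
  let ?R = "resolvent UNIV A"
  have res: "is_resolvent UNIV A z (?R z)" if "z \<in> S" for z
    using S that by (auto intro: is_resolvent_resolvent)
  have "(?R \<longlongrightarrow> ?R w) (at w)"
    using continuous_on_resolvent[OF A S(1)] w S(2)
    by (simp add: continuous_on_eq_continuous_at isCont_def)
  then have "((\<lambda>z. - l (?R z o\<^sub>L ?R w)) \<longlongrightarrow> - l (?R w o\<^sub>L ?R w)) (at w)"
    using l unfolding clinear_functional_def
    by (intro tendsto_intros bounded_linear.tendsto[of l]) 
       (auto intro!: bounded_bilinear.tendsto[OF bounded_bilinear_blinfun_compose])
  moreover have "eventually (\<lambda>z. z \<in> S \<and> z \<noteq> w) (at w)"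
    using w S(2) by (auto simp: eventually_at_filter eventually_nhds intro: exI[of _ S])
  then have "eventually (\<lambda>z. - l (?R z o\<^sub>L ?R w) = (l (?R z) - l (?R w)) / (z - w)) (at w)"
  proof (rule eventually_mono)
    fix z assume z: "z \<in> S \<and> z \<noteq> w"
    then have "l (?R z) - l (?R w) = (w - z) * l (?R z o\<^sub>L ?R w)"
      using is_resolvent_diff[OF A res res, of z w] w clinear_functional_simps[OF l] by metis
    then show "- l (?R z o\<^sub>L ?R w) = (l (?R z) - l (?R w)) / (z - w)"
      using z by (simp add: field_simps)
  qed
  ultimately show "\<exists>f'. ((\<lambda>z. l (?R z)) has_field_derivative f') (at w)"
    unfolding has_field_derivative_iff by (intro exI, rule Lim_transform_eventually)
qed

lemma is_resolvent_id_minus: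
  fixes T :: "'a :: complex_banach \<Rightarrow>\<^sub>L 'a"
  shows "is_resolvent UNIV (blinfun_apply (id_blinfun - T)) z R \<longleftrightarrow>
    is_resolvent UNIV (blinfun_apply T) (1 - z) (- R)"
proof -
  have *: "(1 - z) *\<^sub>C x = x - z *\<^sub>C x" for x :: 'a
    using scaleC_add_left[of 1 "- z" x] by (simp add: scaleC_one)
  have "(1 - z) *\<^sub>C (- R) y - T ((- R) y) = z *\<^sub>C R y - (id_blinfun - T) (R y)"
    "(- R) ((1 - z) *\<^sub>C y - T y) = R (z *\<^sub>C y - (id_blinfun - T) y)" for y
    by (simp_all add: * blinfun.diff_left blinfun.diff_right blinfun.minus_left blinfun.minus_right
        scaleC_minus_right)
  then show ?thesis by (simp add: is_resolvent_def)
qed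

section \<open>Rademacher sums\<close>

abbreviation signs :: "nat \<Rightarrow> (nat \<Rightarrow> real) set" where
  "signs N \<equiv> PiE {1..N} (\<lambda>_. {1, -1})"

lemma finite_signs: "finite (signs N)"
  by (rule finite_PiE) auto

lemma Rad_Omega_cylinder:
  assumes s: "s \<in> signs N"
  defines "E \<equiv> {\<omega> \<in> space Rad_Omega. \<forall>k\<in>{1..N}. \<omega> (int k) = s k}"
  shows "E \<in> sets Rad_Omega" "measure Rad_Omega E = 1 / 2 ^ N"
proof -
  let ?M = "\<lambda>_ :: int. uniform_count_measure {1, -1 :: real}"
  interpret product_prob_space ?M UNIV
    by (rule product_prob_spaceI, rule prob_space_uniform_count_measure) auto
  let ?J = "int ` {1..N}"
  let ?X = "\<lambda>i. {s (nat i)}"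
  have sk: "s k \<in> {1, -1}" if "k \<in> {1..N}" for k using PiE_mem[OF s that] by simp
  have emb: "E = emb UNIV ?J (PiE ?J ?X)"
    by (auto simp: E_def Rad_Omega_def prod_emb_def space_PiM PiE_iff restrict_def extensional_def)
  have X: "?X i \<in> sets (?M i)" if "i \<in> ?J" for i
    using sk[of "nat i"] that by (auto simp: sets_uniform_count_measure)
  show "E \<in> sets Rad_Omega"
    unfolding emb Rad_Omega_def by (rule sets_PiM_I) (use X in auto)
  have "measure (?M i) (?X i) = 1 / 2" if "i \<in> ?J" for i
    using sk[of "nat i"] that by (subst measure_uniform_count_measure) auto
  then have "(\<Prod>i\<in>?J. measure (?M i) (?X i)) = (\<Prod>i\<in>?J. 1 / 2)"
    by (rule prod.cong[OF refl])
  moreover have "measure Rad_Omega E = (\<Prod>i\<in>?J. measure (?M i) (?X i))"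
    unfolding emb Rad_Omega_def by (rule measure_PiM_emb) (use X in auto)
  ultimately have "measure Rad_Omega E = (\<Prod>i\<in>?J. 1 / 2)"
    by simp
  also have "\<dots> = 1 / 2 ^ N" by (simp add: card_image power_one_over)
  finally show "measure Rad_Omega E = 1 / 2 ^ N" .
qed

lemma L2_Rad_norm_nonneg: "L2_Rad_norm F \<ge> 0"
  by (simp add: L2_Rad_norm_def)

text \<open>The sum depends on the coordinates 1 to N only, so it is constant on cylinder sets of
  mass 2^(-N). From here on the Rademacher norm is a finite average over sign patterns.\<close>

lemma L2_Rad_norm_rademacher_sum:
  fixes x :: "nat \<Rightarrow> 'b :: real_normed_vector"
  shows "(L2_Rad_norm (rademacher_sum N x))\<^sup>2 =
    (\<Sum>s\<in>signs N. 1 / 2 ^ N * (norm (\<Sum>k=1..N. s k *\<^sub>R x k))\<^sup>2)"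
proof -
  interpret prob_space Rad_Omega
    unfolding Rad_Omega_def by (rule prob_space_PiM, rule prob_space_uniform_count_measure) auto
  define E where "E s = {\<omega> \<in> space Rad_Omega. \<forall>k\<in>{1..N}. \<omega> (int k) = s k}" for s :: "nat \<Rightarrow> real"
  let ?c = "\<lambda>s. (norm (\<Sum>k=1..N. s k *\<^sub>R x k))\<^sup>2"
  have E: "E s \<in> sets Rad_Omega" "measure Rad_Omega (E s) = 1 / 2 ^ N" if "s \<in> signs N" for s
    using Rad_Omega_cylinder[OF that] by (auto simp: E_def)
  have eq: "(norm (rademacher_sum N x \<omega>))\<^sup>2 = (\<Sum>s\<in>signs N. indicator (E s) \<omega> * ?c s)"
    if \<omega>: "\<omega> \<in> space Rad_Omega" for \<omega>
  proof -
    define s0 where "s0 = restrict (\<lambda>k. \<omega> (int k)) {1..N}"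
    have mem: "\<omega> i \<in> {1, -1}" for i
      using \<omega> by (auto simp: Rad_Omega_def space_PiM PiE_iff space_uniform_count_measure)
    then have s0: "s0 \<in> signs N" by (auto simp: s0_def)
    have "indicator (E s) \<omega> * ?c s = (if s = s0 then ?c s0 else 0)" if "s \<in> signs N" for s
    proof -
      have "\<omega> \<in> E s \<longleftrightarrow> s = s0"
      proof
        assume "\<omega> \<in> E s"
        then have "s k = s0 k" if "k \<in> {1..N}" for k using that by (auto simp: E_def s0_def)
        then show "s = s0" using that s0 by (rule PiE_ext[rotated 2])
      qed (use \<omega> in \<open>auto simp: E_def s0_def\<close>)
      then show ?thesis by (auto simp: indicator_def)
    qed
    then have "(\<Sum>s\<in>signs N. indicator (E s) \<omega> * ?c s) = ?c s0"
      using s0 finite_signs by (simp add: sum.delta)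
    also have "(\<Sum>k=1..N. s0 k *\<^sub>R x k) = rademacher_sum N x \<omega>"
      unfolding rademacher_sum_def rademacher_def by (rule sum.cong) (auto simp: s0_def)
    finally show ?thesis by simp
  qed
  have "(L2_Rad_norm (rademacher_sum N x))\<^sup>2 = (LINT \<omega>|Rad_Omega. (norm (rademacher_sum N x \<omega>))\<^sup>2)"
    by (simp add: L2_Rad_norm_def)
  also have "\<dots> = (LINT \<omega>|Rad_Omega. (\<Sum>s\<in>signs N. indicator (E s) \<omega> * ?c s))"
    by (rule Bochner_Integration.integral_cong[OF refl eq])
  also have "\<dots> = (\<Sum>s\<in>signs N. (LINT \<omega>|Rad_Omega. indicator (E s) \<omega> * ?c s))"
    by (rule Bochner_Integration.integral_sum)
      (use E in \<open>auto intro!: integrable_mult_left integrable_real_indicator simp: emeasure_eq_measure\<close>)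
  also have "\<dots> = (\<Sum>s\<in>signs N. 1 / 2 ^ N * ?c s)"
    by (rule sum.cong) (use E in auto)
  finally show ?thesis .
qed

text \<open>Orthogonality of the Rademacher functions: flipping the \<open>j\<close>-th sign is an
  involution of the patterns that negates the summand when \<open>j\<close> and \<open>k\<close>
  differ.\<close>

lemma sum_signs_mult:
  assumes "j \<in> {1..N}" "k \<in> {1..N}"
  shows "(\<Sum>s\<in>signs N. s j * s k) = (if j = k then 2 ^ N else 0)"
proof (cases "j = k")
  case True
  have "s j * s k = 1" if "s \<in> signs N" for s
    using PiE_mem[OF that assms(1)] True by auto
  then show ?thesis using True by (simp add: card_PiE)
next
  case False
  have upd: "s(j := - s j) \<in> signs N" if "s \<in> signs N" for s :: "nat \<Rightarrow> real"
    using that assms by (auto simp: PiE_iff extensional_def)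
  have "(\<Sum>s\<in>signs N. s j * s k) = (\<Sum>s\<in>signs N. - (s j * s k))"
    by (rule sum.reindex_bij_witness[of _ "\<lambda>s. s(j := - s j)" "\<lambda>s. s(j := - s j)"])
      (use upd False in auto)
  then show ?thesis using False by (simp add: sum_negf)
qed

text \<open>For scalars the square function is exactly a Rademacher mean. This lets a bound on the
  square sum of coefficients be spent on the sums with fixed signs, on average.\<close>

lemma signs_mean_square:
  fixes a :: "nat \<Rightarrow> complex"
  shows "(\<Sum>s\<in>signs N. 1 / 2 ^ N * (cmod (\<Sum>k=1..N. s k *\<^sub>R a k))\<^sup>2) = (\<Sum>k=1..N. (cmod (a k))\<^sup>2)"
proof -
  have "complex_of_real (\<Sum>s\<in>signs N. 1 / 2 ^ N * (cmod (\<Sum>k=1..N. s k *\<^sub>R a k))\<^sup>2)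
    = (\<Sum>s\<in>signs N. 1 / 2 ^ N * ((\<Sum>j=1..N. s j *\<^sub>R a j) * cnj (\<Sum>k=1..N. s k *\<^sub>R a k)))"
    by (simp only: of_real_sum of_real_mult complex_norm_square) simp
  also have "\<dots> = (\<Sum>s\<in>signs N. \<Sum>j=1..N. \<Sum>k=1..N. of_real (s j * s k) * (a j * cnj (a k) / 2 ^ N))"
    by (simp only: cnj_sum sum_product, simp only: sum_distrib_left, intro sum.cong refl)
      (simp add: scaleR_conv_of_real mult_ac)
  also have "\<dots> = (\<Sum>j=1..N. \<Sum>k=1..N. \<Sum>s\<in>signs N. of_real (s j * s k) * (a j * cnj (a k) / 2 ^ N))"
    by (subst sum.swap) (intro sum.cong refl sum.swap)
  also have "\<dots> = (\<Sum>j=1..N. \<Sum>k=1..N. of_real (\<Sum>s\<in>signs N. s j * s k) * (a j * cnj (a k) / 2 ^ N))"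
    by (simp only: of_real_sum sum_distrib_right)
  also have "\<dots> = (\<Sum>j=1..N. \<Sum>k=1..N. if j = k then a j * cnj (a j) else 0)"
    by (intro sum.cong refl) (subst sum_signs_mult, auto)
  also have "\<dots> = complex_of_real (\<Sum>k=1..N. (cmod (a k))\<^sup>2)"
    by (simp add: complex_norm_square del: of_real_power)
  finally show ?thesis by (simp only: of_real_eq_iff)
qed

text \<open>The elementary (a + b)^2 <= 2 a^2 + 2 b^2 for every sign pattern stands in for the
  triangle inequality of the Rademacher norm; the lost constant is harmless.\<close>

lemma L2_Rad_norm_add_le:
  fixes x y :: "nat \<Rightarrow> 'b :: real_normed_vector"
  assumes "\<And>k. k \<in> {1..N} \<Longrightarrow> z k = x k + y k"
  shows "(L2_Rad_norm (rademacher_sum N z))\<^sup>2 \<le>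
    2 * (L2_Rad_norm (rademacher_sum N x))\<^sup>2 + 2 * (L2_Rad_norm (rademacher_sum N y))\<^sup>2"
proof -
  have "1 / 2 ^ N * (norm (\<Sum>k=1..N. s k *\<^sub>R z k))\<^sup>2 \<le>
     2 * (1 / 2 ^ N * (norm (\<Sum>k=1..N. s k *\<^sub>R x k))\<^sup>2) + 2 * (1 / 2 ^ N * (norm (\<Sum>k=1..N. s k *\<^sub>R y k))\<^sup>2)"
    for s :: "nat \<Rightarrow> real"
  proof -
    let ?x = "\<Sum>k=1..N. s k *\<^sub>R x k" and ?y = "\<Sum>k=1..N. s k *\<^sub>R y k"
    have "(\<Sum>k=1..N. s k *\<^sub>R z k) = ?x + ?y"
      using assms by (simp add: scaleR_add_right sum.distrib)
    then have "(norm (\<Sum>k=1..N. s k *\<^sub>R z k))\<^sup>2 \<le> (norm ?x + norm ?y)\<^sup>2"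
      by (simp add: power_mono norm_triangle_ineq)
    also have "\<dots> \<le> 2 * (norm ?x)\<^sup>2 + 2 * (norm ?y)\<^sup>2"
      using sum_squares_bound[of "norm ?x" "norm ?y"] by (simp add: power2_sum)
    finally show ?thesis by (simp add: field_simps)
  qed
  then show ?thesis
    unfolding L2_Rad_norm_rademacher_sum sum_distrib_left sum.distrib[symmetric] by (rule sum_mono)
qed

section \<open>Contour integrals at a vertex\<close>

text \<open>At the corners 1/2 and 3/4 it takes the left-hand derivative, a choice that no integral
  sees.\<close>

definition petal_deriv :: "real \<Rightarrow> real \<Rightarrow> complex" where
  "petal_deriv \<beta> t = (if t \<le> 1/2 then of_real (2 * cos \<beta>) * cis (- \<beta>)
     else if t \<le> 3/4 then - of_real (sin \<beta> * (4 * (pi + 2 * \<beta>))) *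
       (\<i> * cis ((pi / 2 - \<beta>) + (4 * t - 2) * (pi + 2 * \<beta>)))
     else - of_real (4 * cos \<beta>) * cis \<beta>)"

lemma petal_first: "t \<in> {0..1/2} \<Longrightarrow> petal \<beta> t = of_real (2 * cos \<beta> * t) * cis (- \<beta>)"
  by (simp add: petal_def mult_ac)

lemma petal_middle:
  assumes "t \<in> {1/2..3/4}"
  shows "petal \<beta> t = 1 - of_real (sin \<beta>) * cis ((pi / 2 - \<beta>) + (4 * t - 2) * (pi + 2 * \<beta>))"
proof (cases "t = 1/2")
  case True
  show ?thesis unfolding True using one_minus_tangent_point(1)[of \<beta>] by (simp add: petal_def)
next
  case False
  then show ?thesis using assms by (simp add: petal_def)
qed

lemma petal_last:
  assumes "t \<in> {3/4..1}"
  shows "petal \<beta> t = of_real (- 4 * cos \<beta> * t + 4 * cos \<beta>) * cis \<beta>"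
proof (cases "t = 3/4")
  case True
  have "(pi / 2 - \<beta>) + (pi + 2 * \<beta>) = 3 * pi / 2 + \<beta>" by (simp add: field_simps)
  then show ?thesis unfolding True using one_minus_tangent_point(2)[of \<beta>] by (simp add: petal_def)
next
  case False
  then show ?thesis using assms by (simp add: petal_def algebra_simps)
qed

lemma continuous_on_petal: "continuous_on {0..1} (petal \<beta>)"
proof -
  have "continuous_on {0..1/2} (petal \<beta>)"
    by (rule continuous_on_eq[where f = "\<lambda>t. of_real (2 * cos \<beta> * t) * cis (- \<beta>)"])
      (auto intro!: continuous_intros simp: petal_first)
  moreover have "continuous_on {1/2..3/4} (petal \<beta>)"
    by (rule continuous_on_eq[where f = "\<lambda>t. 1 - of_real (sin \<beta>) * cis ((pi / 2 - \<beta>) + (4 * t - 2) * (pi + 2 * \<beta>))"])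
      (auto intro!: continuous_intros simp: petal_middle)
  moreover have "continuous_on {3/4..1} (petal \<beta>)"
    by (rule continuous_on_eq[where f = "\<lambda>t. of_real (- 4 * cos \<beta> * t + 4 * cos \<beta>) * cis \<beta>"])
      (auto intro!: continuous_intros simp: petal_last)
  ultimately have "continuous_on ({0..1/2} \<union> {1/2..3/4} \<union> {3/4..1}) (petal \<beta>)"
    by (intro continuous_on_closed_Un) auto
  moreover have "{0..1/2} \<union> {1/2..3/4} \<union> {3/4..1} = {0..1::real}" by auto
  ultimately show ?thesis by simp
qed

lemma petal_has_vector_derivative:
  assumes t: "t \<in> {0<..<1} - {1/2, 3/4}"
  shows "(petal \<beta> has_vector_derivative petal_deriv \<beta> t) (at t)"
proof -
  consider "t \<in> {0<..<1/2}" | "t \<in> {1/2<..<3/4}" | "t \<in> {3/4<..<1}" using t by force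
  then show ?thesis
  proof cases
    case 1
    have "((\<lambda>t. of_real (2 * cos \<beta> * t) * cis (- \<beta>)) has_vector_derivative petal_deriv \<beta> t) (at t)"
      using 1 unfolding has_vector_derivative_def
      by (auto intro!: derivative_eq_intros simp: petal_deriv_def scaleR_conv_of_real)
    then show ?thesis
      by (rule has_vector_derivative_transform_within_open[of _ _ _ "{0<..<1/2}"])
        (use 1 in \<open>auto simp: petal_first\<close>)
  next
    case 2
    have "((\<lambda>t. 1 - of_real (sin \<beta>) * cis ((pi / 2 - \<beta>) + (4 * t - 2) * (pi + 2 * \<beta>)))
        has_vector_derivative petal_deriv \<beta> t) (at t)"
      using 2 unfolding has_vector_derivative_def
      by (auto intro!: derivative_eq_intros simp: petal_deriv_def scaleR_conv_of_real algebra_simps)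
    then show ?thesis
      by (rule has_vector_derivative_transform_within_open[of _ _ _ "{1/2<..<3/4}"])
        (use 2 in \<open>auto simp: petal_middle\<close>)
  next
    case 3
    have "((\<lambda>t. of_real (- 4 * cos \<beta> * t + 4 * cos \<beta>) * cis \<beta>) has_vector_derivative petal_deriv \<beta> t) (at t)"
      using 3 unfolding has_vector_derivative_def
      by (auto intro!: derivative_eq_intros simp: petal_deriv_def scaleR_conv_of_real)
    then show ?thesis
      by (rule has_vector_derivative_transform_within_open[of _ _ _ "{3/4<..<1}"])
        (use 3 in \<open>auto simp: petal_last\<close>)
  qed
qed

lemma petal_deriv_bounded: "\<exists>B>0. \<forall>t. cmod (petal_deriv \<beta> t) \<le> B"
proof -
  let ?B = "2 * \<bar>cos \<beta>\<bar> + \<bar>sin \<beta> * (4 * (pi + 2 * \<beta>))\<bar> + 4 * \<bar>cos \<beta>\<bar> + 1"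
  have "cmod (petal_deriv \<beta> t) \<le> ?B" for t
    unfolding petal_deriv_def by (auto simp: norm_mult simp del: of_real_mult)
  moreover have "?B > 0" by linarith
  ultimately show ?thesis by blast
qed

text \<open>On the sides the boundary point is the one where the disc of radius
  \<open>u sin \<beta>\<close> about \<open>u\<close> touches the ray; on the arc the disc with
  parameter 1 serves.\<close>

lemma petal_mem_scaled_discs:
  assumes \<beta>: "0 < \<beta>" "\<beta> < pi / 2" and t: "t \<in> {0<..<1}"
  shows "petal \<beta> t \<in> scaled_discs \<beta> - {0}"
proof -
  have c: "cos \<beta> > 0" "sin \<beta> > 0" "sin \<beta> < 1" "cos \<beta> \<le> 1"
    using \<beta> by (auto simp: cos_pos_acute sin_gt_zero2 sin_less_one_acute)
  have ray: "of_real (u * cos \<beta>) * cis a \<in> scaled_discs \<beta> - {0}" if "0 < u" "u \<le> 1" "\<bar>a\<bar> = \<beta>" for u a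
  proof -
    have ca: "cos a = cos \<beta>" using that(3) by (auto simp: abs_if split: if_splits)
    have "(cmod (of_real (u * cos \<beta>) * cis a - of_real u))\<^sup>2 = u\<^sup>2 * ((cos \<beta> * cos a - 1)\<^sup>2 + (cos \<beta> * sin a)\<^sup>2)"
      unfolding cmod_power2 by (simp add: power2_eq_square algebra_simps)
    also have "(cos \<beta> * cos a - 1)\<^sup>2 + (cos \<beta> * sin a)\<^sup>2 = (cos \<beta>)\<^sup>2 * ((cos a)\<^sup>2 + (sin a)\<^sup>2) - 2 * cos \<beta> * cos a + 1"
      unfolding power2_eq_square by algebra
    also have "\<dots> = (sin \<beta>)\<^sup>2"
      unfolding sin_cos_squared_add2 ca sin_squared_eq by (simp add: power2_eq_square)
    finally have "(cmod (of_real (u * cos \<beta>) * cis a - of_real u))\<^sup>2 = (u * sin \<beta>)\<^sup>2"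
      by (simp only: power_mult_distrib)
    then have "cmod (of_real (u * cos \<beta>) * cis a - of_real u) = u * sin \<beta>"
      by (rule power2_eq_imp_eq) (use that(1) c(2) in simp_all)
    then have "of_real (u * cos \<beta>) * cis a \<in> scaled_discs \<beta>"
      using that(1,2) unfolding scaled_discs_def by (intro CollectI bexI[of _ u]) simp_all
    moreover have "of_real (u * cos \<beta>) * cis a \<noteq> 0" using that(1) c(1) by simp
    ultimately show ?thesis by blast
  qed
  consider "t \<in> {0<..1/2}" | "t \<in> {1/2..3/4}" | "t \<in> {3/4..<1}" using t by force
  then show ?thesis
  proof cases
    case 1
    then show ?thesis using ray[of "2 * t" "- \<beta>"] \<beta> by (simp add: petal_first mult_ac)
  next
    case 2
    define p where "p = petal \<beta> t"
    have "p - 1 = - (of_real (sin \<beta>) * cis ((pi / 2 - \<beta>) + (4 * t - 2) * (pi + 2 * \<beta>)))"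
      using 2 by (simp add: p_def petal_middle)
    then have "cmod (p - 1) = sin \<beta>" using c by (simp only: norm_minus_cancel norm_mult) simp
    moreover have "p \<noteq> 0" using c calculation by auto
    ultimately show ?thesis by (auto simp: p_def scaled_discs_def intro!: bexI[of _ 1])
  next
    case 3
    have "- 4 * cos \<beta> * t + 4 * cos \<beta> = (4 * (1 - t)) * cos \<beta>" by (simp add: algebra_simps)
    then show ?thesis using 3 ray[of "4 * (1 - t)" \<beta>] \<beta> by (simp add: petal_last)
  qed
qed

text \<open>On the arc, the distance to \<open>u \<in> [0, 1]\<close> is at least \<open>u sin \<beta>\<close>: the angle from \<open>1\<close> is at
  most \<open>\<pi>/2 + \<beta>\<close>.\<close>

lemma petal_not_mem_scaled_discs:
  assumes \<alpha>: "0 < \<alpha>" "\<alpha> < \<beta>" "\<beta> < pi / 2" and t: "t \<in> {0<..<1}"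
  shows "petal \<beta> t \<notin> scaled_discs \<alpha>"
proof -
  have \<beta>: "0 < \<beta>" using \<alpha> by simp
  have c: "cos \<beta> > 0" "sin \<beta> > 0" "sin \<beta> < 1"
    using \<beta> \<alpha> by (auto simp: cos_pos_acute sin_gt_zero2 sin_less_one_acute)
  have ray: "of_real r * cis a \<notin> scaled_discs \<alpha>" if "0 < r" "\<bar>a\<bar> = \<beta>" for r a
    using cis_not_mem_closed_sector[of \<alpha> a r] scaled_discs_subset_closed_sector[of \<alpha>] \<alpha> that by auto
  consider "t \<in> {0<..1/2}" | "t \<in> {1/2..3/4}" | "t \<in> {3/4..<1}" using t by force
  then show ?thesis
  proof cases
    case 1
    then show ?thesis using ray[of "2 * cos \<beta> * t" "- \<beta>"] \<beta> c by (simp add: petal_first)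
  next
    case 2
    define x where "x = (4 * t - 2) * (pi + 2 * \<beta>)"
    define \<psi> where "\<psi> = (pi / 2 - \<beta>) + x"
    have x: "0 \<le> x" "x \<le> 1 * (pi + 2 * \<beta>)"
      unfolding x_def using 2 \<beta> pi_gt_zero by (intro mult_nonneg_nonneg mult_right_mono; simp)+
    have cos_le: "cos \<psi> \<le> sin \<beta>"
    proof -
      have "cos (pi / 2 - \<beta>) = sin \<beta>" by (simp add: cos_diff)
      moreover have "cos \<psi> \<le> cos (pi / 2 - \<beta>)"
      proof (cases "\<psi> \<le> pi")
        case True
        then show ?thesis using x \<alpha> \<beta> by (intro cos_monotone_0_pi_le) (auto simp: \<psi>_def)
      next
        case False
        have "cos \<psi> = cos (2 * pi - \<psi>)" by simp
        also have "\<dots> \<le> cos (pi / 2 - \<beta>)"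
          using False x \<alpha> \<beta> by (intro cos_monotone_0_pi_le) (auto simp: \<psi>_def)
        finally show ?thesis .
      qed
      ultimately show ?thesis by simp
    qed
    have p: "petal \<beta> t = 1 - of_real (sin \<beta>) * cis \<psi>"
      using 2 by (simp add: petal_middle \<psi>_def x_def)
    have "cmod (petal \<beta> t - of_real u) > u * sin \<alpha>" if u: "u \<in> {0..1}" for u
    proof (cases "u = 0")
      case True
      have "petal \<beta> t \<noteq> 0" using petal_mem_scaled_discs[of \<beta> t] \<alpha> \<beta> t by auto
      then show ?thesis using True by simp
    next
      case False
      let ?s = "sin \<beta>"
      have "(cmod (petal \<beta> t - of_real u))\<^sup>2 = (1 - u - ?s * cos \<psi>)\<^sup>2 + (?s * sin \<psi>)\<^sup>2"
        by (simp add: p cmod_power2 algebra_simps)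
      also have "\<dots> = (1 - u)\<^sup>2 - 2 * ((1 - u) * ?s * cos \<psi>) + ?s\<^sup>2 * ((sin \<psi>)\<^sup>2 + (cos \<psi>)\<^sup>2)"
        unfolding power2_eq_square by algebra
      also have "\<dots> = (1 - u)\<^sup>2 - 2 * ((1 - u) * ?s * cos \<psi>) + ?s\<^sup>2" by simp
      also have "\<dots> \<ge> (1 - u)\<^sup>2 - 2 * ((1 - u) * ?s * ?s) + ?s\<^sup>2"
        using cos_le u c by (auto intro!: mult_left_mono)
      finally have "(1 - u)\<^sup>2 - 2 * ((1 - u) * ?s * ?s) + ?s\<^sup>2 \<le> (cmod (petal \<beta> t - of_real u))\<^sup>2" .
      \<comment> \<open>The worst case is \<open>cos \<psi> = sin \<beta>\<close>, attained at the
        tangent points; even there the excess over the square of \<open>u sin \<beta>\<close> is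
        nonnegative.\<close>
      moreover have "(1 - u)\<^sup>2 - 2 * ((1 - u) * ?s * ?s) + ?s\<^sup>2 - (u * ?s)\<^sup>2 = (1 - u)\<^sup>2 * (1 - ?s\<^sup>2)"
        by (simp add: power2_eq_square algebra_simps)
      moreover have "(1 - u)\<^sup>2 * (1 - ?s\<^sup>2) \<ge> 0"
        using c by (intro mult_nonneg_nonneg) (auto simp: power_le_one)
      ultimately have "(u * ?s)\<^sup>2 \<le> (cmod (petal \<beta> t - of_real u))\<^sup>2" by linarith
      then have "u * ?s \<le> cmod (petal \<beta> t - of_real u)" by (rule power2_le_imp_le) simp
      moreover have "u * sin \<alpha> < u * ?s" using sin_strict_mono[of \<alpha> \<beta>] \<alpha> False u by simp
      ultimately show ?thesis by linarith
    qed
    then show ?thesis by (force simp: scaled_discs_def not_le)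
  next
    case 3
    then show ?thesis using ray[of "- 4 * cos \<beta> * t + 4 * cos \<beta>" \<beta>] \<beta> c by (simp add: petal_last)
  qed
qed

section \<open>Primitives along rays and arcs\<close>

lemma primitive_along_ray:
  assumes "(H has_field_derivative f (of_real t * cis a)) (at (of_real t * cis a))"
  shows "((\<lambda>t. H (of_real t * cis a)) has_vector_derivative cis a * f (of_real t * cis a)) (at t)"
proof -
  have "((\<lambda>t. of_real t * cis a) has_vector_derivative cis a) (at t)"
    unfolding has_vector_derivative_def by (auto intro!: derivative_eq_intros simp: scaleR_conv_of_real)
  from field_vector_diff_chain_at[OF this assms] show ?thesis by (simp add: o_def)
qed

lemma primitive_along_arc:
  assumes a: "a1 \<le> a2" and "r > 0"
    and H: "\<And>a. a \<in> {a1..a2} \<Longrightarrow> (H has_field_derivative f (of_real r * cis a)) (at (of_real r * cis a))"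
    and le: "\<And>a. a \<in> {a1..a2} \<Longrightarrow> cmod (f (of_real r * cis a)) \<le> B"
  shows "cmod (H (of_real r * cis a2) - H (of_real r * cis a1)) \<le> B * r * (a2 - a1)"
proof (cases "a1 = a2")
  case False
  define h where "h a = H (of_real r * cis a)" for a
  have d: "(h has_vector_derivative (of_real r * (\<i> * cis a)) * f (of_real r * cis a)) (at a)"
    if "a \<in> {a1..a2}" for a
  proof -
    have "((\<lambda>a. of_real r * cis a) has_vector_derivative of_real r * (\<i> * cis a)) (at a)"
      unfolding has_vector_derivative_def by (auto intro!: derivative_eq_intros simp: scaleR_conv_of_real)
    from field_vector_diff_chain_at[OF this H[OF that]] show ?thesis by (simp add: o_def h_def[abs_def])
  qed
  have "\<exists>x\<in>{a1<..<a2}. norm (h a2 - h a1) \<le>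
      norm ((a2 - a1) *\<^sub>R ((of_real r * (\<i> * cis x)) * f (of_real r * cis x)))"
  proof (rule mvt_general)
    show "continuous_on {a1..a2} h"
      by (rule continuous_at_imp_continuous_on) (use d has_vector_derivative_continuous in blast)
    show "(h has_derivative (\<lambda>y. y *\<^sub>R ((of_real r * (\<i> * cis x)) * f (of_real r * cis x)))) (at x)"
      if "a1 < x" "x < a2" for x
      using d[of x] that by (simp add: has_vector_derivative_def)
  qed (use a False in auto)
  then obtain x where x: "x \<in> {a1<..<a2}"
    and "norm (h a2 - h a1) \<le> norm ((a2 - a1) *\<^sub>R ((of_real r * (\<i> * cis x)) * f (of_real r * cis x)))"
    by blast
  then have "norm (h a2 - h a1) \<le> (a2 - a1) * r * cmod (f (of_real r * cis x))"
    using a \<open>r > 0\<close> by (simp add: norm_mult)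
  also have "\<dots> \<le> (a2 - a1) * r * B"
    using le[of x] x a \<open>r > 0\<close> by (intro mult_left_mono) auto
  finally show ?thesis by (simp add: h_def mult_ac)
qed simp

lemma bounded_bilinear_scaleC:
  "bounded_bilinear ((*\<^sub>C) :: complex \<Rightarrow> 'b :: complex_normed_vector \<Rightarrow> 'b)"
proof
  show "\<exists>K. \<forall>a (b :: 'b). norm (a *\<^sub>C b) \<le> norm a * norm b * K"
    by (auto simp: norm_scaleC intro: exI[of _ 1])
qed (simp_all add: scaleC_add_left scaleC_add_right scaleR_scaleC scaleC_scaleC mult.commute
  scaleR_conv_of_real)

text \<open>An operator function with an integrable singularity at the vertex, regular near it
  between the angles \<omega> and \<theta> on both sides of the axis. The constant in
  \<open>bound\<close> depends on the angle because the definitions of the types give bounds only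
  for angles strictly above the type. The assumptions on the complement of \<open>S\<close> provide
  primitives.\<close>

locale cone_fun =
  fixes \<Psi> :: "complex \<Rightarrow> 'a :: complex_banach" and S :: "complex set" and \<omega> \<theta> \<delta> s :: real
  assumes angles: "0 < \<omega>" "\<omega> < \<theta>" "\<theta> < pi / 2" and \<delta>: "0 < \<delta>" and s: "0 < s"
    and S: "open S" "connected (- S)" "\<not> bounded (- S)"
    and cone: "\<And>z. z \<in> sector \<theta> - closed_sector \<omega> \<Longrightarrow> cmod z < \<delta> \<Longrightarrow> z \<in> S"
    and cont: "continuous_on S \<Psi>"
    and hol: "\<And>l. clinear_functional l \<Longrightarrow> (\<lambda>z. l (\<Psi> z)) holomorphic_on S"
    and bound: "\<And>\<nu>. \<omega> < \<nu> \<Longrightarrow> \<nu> < \<theta> \<Longrightarrow>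
      \<exists>C. \<forall>z\<in>sector \<theta> - closed_sector \<nu>. cmod z < \<delta> \<longrightarrow> norm (\<Psi> z) \<le> C * cmod z powr (s - 1)"
begin

lemma cis_mem_cone:
  assumes "\<omega> \<le> \<nu>" "\<nu> < \<bar>a\<bar>" "\<bar>a\<bar> < \<theta>" "t > 0"
  shows "of_real t * cis a \<in> sector \<theta> - closed_sector \<nu>"
  using cis_mem_sector[of \<theta> a t] cis_not_mem_closed_sector[of \<nu> a t] assms angles by auto

lemma arc_bound:
  assumes "\<omega> < \<nu>" "\<nu> < \<theta>"
  obtains C where "C \<ge> 0"
    "\<And>a t. \<nu> \<le> \<bar>a\<bar> \<Longrightarrow> \<bar>a\<bar> < \<theta> \<Longrightarrow> 0 < t \<Longrightarrow> t < \<delta> \<Longrightarrow>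
      of_real t * cis a \<in> S \<and> norm (\<Psi> (of_real t * cis a)) \<le> C * t powr (s - 1)"
proof -
  \<comment> \<open>\<open>bound\<close> speaks of points outside the closed cone, which contains
    the ray at its own angle; a smaller angle lets the ray at \<nu> be included.\<close>
  define \<nu>' where "\<nu>' = (\<omega> + \<nu>) / 2"
  have \<nu>': "\<omega> < \<nu>'" "\<nu>' < \<nu>" "\<nu>' < \<theta>" using assms by (auto simp: \<nu>'_def)
  obtain C where C: "\<And>z. z \<in> sector \<theta> - closed_sector \<nu>' \<Longrightarrow> cmod z < \<delta> \<Longrightarrow> norm (\<Psi> z) \<le> C * cmod z powr (s - 1)"
    using bound[OF \<nu>'(1,3)] by blast
  have "of_real t * cis a \<in> S \<and> norm (\<Psi> (of_real t * cis a)) \<le> \<bar>C\<bar> * t powr (s - 1)"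
    if "\<nu> \<le> \<bar>a\<bar>" "\<bar>a\<bar> < \<theta>" "0 < t" "t < \<delta>" for a t
  proof
    have m: "of_real t * cis a \<in> sector \<theta> - closed_sector \<nu>'"
      using cis_mem_cone[of \<nu>' a t] \<nu>' that by simp
    have n: "cmod (of_real t * cis a) = t" using that by (simp add: norm_mult)
    show "of_real t * cis a \<in> S"
      using cone[of "of_real t * cis a"] cis_mem_cone[of \<omega> a t] n \<nu>' that by simp
    have "norm (\<Psi> (of_real t * cis a)) \<le> C * t powr (s - 1)"
      using C[OF m] n that by simp
    also have "\<dots> \<le> \<bar>C\<bar> * t powr (s - 1)" by (intro mult_right_mono) auto
    finally show "norm (\<Psi> (of_real t * cis a)) \<le> \<bar>C\<bar> * t powr (s - 1)" .
  qed
  then show thesis using that[of "\<bar>C\<bar>"] by auto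
qed

lemma continuous_on_ray:
  assumes "\<And>t. t \<in> X \<Longrightarrow> of_real t * cis a \<in> S"
  shows "continuous_on X (\<lambda>t :: real. \<Psi> (of_real t * cis a))"
  by (rule continuous_on_compose2[OF cont]) (use assms in \<open>auto intro!: continuous_intros\<close>)

lemma ray_integrable:
  assumes a: "\<omega> < \<bar>a\<bar>" "\<bar>a\<bar> < \<theta>" and r: "0 < r" and mem: "\<And>t. t \<in> {0<..r} \<Longrightarrow> of_real t * cis a \<in> S"
  shows "(\<lambda>t. \<Psi> (of_real t * cis a)) integrable_on {0..r}"
proof -
  obtain C where C: "\<And>t. 0 < t \<Longrightarrow> t < \<delta> \<Longrightarrow> norm (\<Psi> (of_real t * cis a)) \<le> C * t powr (s - 1)"
    using arc_bound[OF a] by (metis order_refl a(2))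
  define r0 where "r0 = min r (\<delta> / 2)"
  have r0: "0 < r0" "r0 \<le> r" "r0 < \<delta>" using r \<delta> by (auto simp: r0_def)
  have "(\<lambda>t. \<Psi> (of_real t * cis a)) integrable_on {0..r0}"
  proof (rule integrable_dominated_half_open[where g = "\<lambda>t. C * t powr (s - 1)"])
    show "(\<lambda>t. C * t powr (s - 1)) integrable_on {0..r0}"
      using r0 s by (intro integrable_on_mult_right integrable_on_powr_from_0) auto
  qed (use r0 C mem in \<open>auto intro: continuous_on_ray\<close>)
  moreover have "(\<lambda>t. \<Psi> (of_real t * cis a)) integrable_on {r0..r}"
    by (intro integrable_continuous_real continuous_on_ray mem) (use r0 in auto)
  ultimately show ?thesis
    using r0 by (intro Henstock_Kurzweil_Integration.integrable_combine[of 0 r0 r]) auto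
qed

text \<open>The sides are singular at the vertex and reduce to rays by affine substitutions; on the
  arc, away from the vertex, continuity suffices.\<close>

lemma petal_integrable:
  assumes \<beta>: "\<omega> < \<beta>" "\<beta> < \<theta>" and mem: "\<And>t. t \<in> {0<..<1} \<Longrightarrow> petal \<beta> t \<in> S"
  shows "(\<lambda>t. petal_deriv \<beta> t *\<^sub>C \<Psi> (petal \<beta> t)) integrable_on {0..1}"
proof -
  have c: "cos \<beta> > 0" using \<beta> angles by (auto simp: cos_pos_acute)
  have cmult: "(\<lambda>t. k *\<^sub>C f t) integrable_on X" if "f integrable_on X" for k and f :: "real \<Rightarrow> 'a" and X
    using integrable_linear[OF that bounded_linear_scaleC] by (simp add: o_def)
  let ?G = "\<lambda>t. petal_deriv \<beta> t *\<^sub>C \<Psi> (petal \<beta> t)"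
  have 1: "?G integrable_on {0..1/2}"
  proof -
    have "of_real u * cis (- \<beta>) \<in> S" if "u \<in> {0<..cos \<beta>}" for u
    proof -
      have u: "u / (2 * cos \<beta>) \<in> {0<..1/2}" using that c by (auto simp: field_simps)
      then have "petal \<beta> (u / (2 * cos \<beta>)) = of_real u * cis (- \<beta>)"
        using c by (simp add: petal_first)
      then show ?thesis using mem[of "u / (2 * cos \<beta>)"] u by simp
    qed
    then have "(\<lambda>u. \<Psi> (of_real u * cis (- \<beta>))) integrable_on cbox 0 (cos \<beta>)"
      using ray_integrable[of "- \<beta>" "cos \<beta>"] \<beta> angles c by simp
    from integrable_affinity[OF this, of "2 * cos \<beta>" 0]
    have "(\<lambda>t. \<Psi> (of_real (2 * cos \<beta> * t) * cis (- \<beta>))) integrable_on {0..1/2}"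
      using c by (simp add: image_affinity_atLeastAtMost_div[where c = 0, simplified] flip: of_real_mult)
    from cmult[OF this, of "of_real (2 * cos \<beta>) * cis (- \<beta>)"] show ?thesis
      by (rule integrable_eq) (simp add: petal_first petal_deriv_def)
  qed
  have 2: "?G integrable_on {1/2..3/4}"
  proof -
    let ?d = "\<lambda>t. - of_real (sin \<beta> * (4 * (pi + 2 * \<beta>))) *
       (\<i> * cis ((pi / 2 - \<beta>) + (4 * t - 2) * (pi + 2 * \<beta>)))"
    have "continuous_on {1/2..3/4} (\<lambda>t. \<Psi> (petal \<beta> t))"
      by (rule continuous_on_compose2[OF cont continuous_on_subset[OF continuous_on_petal]])
        (use mem in auto)
    moreover have "continuous_on {1/2..3/4} ?d" by (intro continuous_intros)
    ultimately have "continuous_on {1/2..3/4} (\<lambda>t. ?d t *\<^sub>C \<Psi> (petal \<beta> t))"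
      using bounded_bilinear.continuous_on[OF bounded_bilinear_scaleC] by blast
    then have "(\<lambda>t. ?d t *\<^sub>C \<Psi> (petal \<beta> t)) integrable_on {1/2..3/4}"
      by (rule integrable_continuous_real)
    then show ?thesis
      by (rule integrable_spike_finite[of "{1/2}", rotated 2]) (auto simp: petal_deriv_def)
  qed
  have 3: "?G integrable_on {3/4..1}"
  proof -
    have "of_real u * cis \<beta> \<in> S" if "u \<in> {0<..cos \<beta>}" for u
    proof -
      have u: "1 - u / (4 * cos \<beta>) \<in> {3/4..<1}" using that c by (auto simp: field_simps)
      then have "petal \<beta> (1 - u / (4 * cos \<beta>)) = of_real u * cis \<beta>"
        using c by (simp add: petal_last algebra_simps)
      then show ?thesis using mem[of "1 - u / (4 * cos \<beta>)"] u by simp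
    qed
    then have "(\<lambda>u. \<Psi> (of_real u * cis \<beta>)) integrable_on cbox 0 (cos \<beta>)"
      using ray_integrable[of "\<beta>" "cos \<beta>"] \<beta> angles c by simp
    from integrable_affinity[OF this, of "- 4 * cos \<beta>" "4 * cos \<beta>"]
    have "(\<lambda>t. \<Psi> (of_real (- 4 * cos \<beta> * t + 4 * cos \<beta>) * cis \<beta>)) integrable_on {3/4..1}"
    proof -
      have "(\<lambda>x. (1 / (- 4 * cos \<beta>)) *\<^sub>R x + - ((1 / (- 4 * cos \<beta>)) *\<^sub>R (4 * cos \<beta>))) ` cbox 0 (cos \<beta>) = {3/4..1}"
        using c image_affinity_atLeastAtMost[of "- 1 / (4 * cos \<beta>)" 1 0 "cos \<beta>"] by (simp add: field_simps)
      then show ?thesis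
        using integrable_affinity[OF \<open>(\<lambda>u. \<Psi> (of_real u * cis \<beta>)) integrable_on cbox 0 (cos \<beta>)\<close>, of "- 4 * cos \<beta>" "4 * cos \<beta>"] c
        by simp
    qed
    from cmult[OF this, of "- of_real (4 * cos \<beta>) * cis \<beta>"] show ?thesis
      by (rule integrable_spike_finite[of "{3/4}", rotated 2]) (auto simp: petal_deriv_def petal_last)
  qed
  from 1 2 have "?G integrable_on {0..3/4}"
    by (rule Henstock_Kurzweil_Integration.integrable_combine[rotated 2]) auto
  from this 3 show ?thesis
    by (rule Henstock_Kurzweil_Integration.integrable_combine[rotated 2]) auto
qed

context
  fixes l H
  assumes l: "clinear_functional l" and H: "\<And>z. z \<in> S \<Longrightarrow> (H has_field_derivative l (\<Psi> z)) (at z)"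
begin

lemma functional_bound:
  obtains K where "K > 0" "\<And>v. cmod (l v) \<le> norm v * K"
proof -
  have "\<exists>K>0. \<forall>v. cmod (l v) \<le> norm v * K"
    using l by (intro bounded_linear.pos_bounded) (simp add: clinear_functional_def)
  then show thesis using that by blast
qed

lemma functional_ray:
  assumes "(\<lambda>t. \<Psi> (of_real t * cis a)) integrable_on X"
  shows "((\<lambda>t. cis a * l (\<Psi> (of_real t * cis a))) has_integral
    l (integral X (\<lambda>t. cis a *\<^sub>C \<Psi> (of_real t * cis a)))) X"
proof -
  have "(\<lambda>t. cis a *\<^sub>C \<Psi> (of_real t * cis a)) integrable_on X"
    using integrable_linear[OF assms bounded_linear_scaleC] by (simp add: o_def)
  then have "((l \<circ> (\<lambda>t. cis a *\<^sub>C \<Psi> (of_real t * cis a))) has_integral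
      l (integral X (\<lambda>t. cis a *\<^sub>C \<Psi> (of_real t * cis a)))) X"
    using l by (intro has_integral_linear) (auto simp: has_integral_integral clinear_functional_def)
  then show ?thesis by (simp add: o_def clinear_functional_simps[OF l])
qed

text \<open>The primitive at distance \<open>t\<close> is its value at a fixed point minus an
  integral from \<open>t\<close>, and integrability up to the vertex makes the latter continuous
  down to \<open>t = 0\<close>.\<close>

lemma ray_vertex_limit:
  assumes a: "\<omega> < \<bar>a\<bar>" "\<bar>a\<bar> < \<theta>"
  shows "\<exists>L. ((\<lambda>t. H (of_real t * cis a)) \<longlongrightarrow> L) (at_right 0)"
proof -
  define r where "r = \<delta> / 2"
  have r: "0 < r" "r < \<delta>" using \<delta> by (auto simp: r_def)
  have mem: "of_real t * cis a \<in> S" if "t \<in> {0<..r}" for t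
    using cone[OF cis_mem_cone[of \<omega> a t]] a r that by (simp add: norm_mult)
  define \<phi> where "\<phi> t = cis a * l (\<Psi> (of_real t * cis a))" for t
  have int: "\<phi> integrable_on {0..r}"
    using functional_ray[OF ray_integrable[OF a r(1) mem]] by (auto simp: \<phi>_def[abs_def] integrable_on_def)
  have "integral {t..r} \<phi> = H (of_real r * cis a) - H (of_real t * cis a)" if "t \<in> {0<..r}" for t
  proof (rule integral_unique, rule fundamental_theorem_of_calculus)
    show "((\<lambda>t. H (of_real t * cis a)) has_vector_derivative \<phi> x) (at x within {t..r})"
      if "x \<in> {t..r}" for x
      unfolding \<phi>_def
      by (rule has_vector_derivative_at_within[OF primitive_along_ray[of H "\<lambda>z. l (\<Psi> z)"]])
         (use H mem that \<open>t \<in> {0<..r}\<close> in auto)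
  qed (use that in auto)
  then have eq: "H (of_real r * cis a) - integral {t..r} \<phi> = H (of_real t * cis a)" if "t \<in> {0<..r}" for t
    using that by simp
  have "continuous_on {0..r} (\<lambda>t. integral {t..r} \<phi>)"
    by (rule indefinite_integral_continuous_1'[OF int])
  then have "((\<lambda>t. integral {t..r} \<phi>) \<longlongrightarrow> integral {0..r} \<phi>) (at 0 within {0..r})"
    using r by (simp add: continuous_on_def)
  then have "((\<lambda>t. H (of_real r * cis a) - integral {t..r} \<phi>) \<longlongrightarrow> H (of_real r * cis a) - integral {0..r} \<phi>) (at_right 0)"
    using at_within_Icc_at_right[OF r(1)] by (intro tendsto_intros) simp
  moreover have "eventually (\<lambda>t. H (of_real r * cis a) - integral {t..r} \<phi> = H (of_real t * cis a)) (at_right 0)"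
    using eq r(1) by (auto simp: eventually_at_right_field intro!: exI[of _ r])
  ultimately have "((\<lambda>t. H (of_real t * cis a)) \<longlongrightarrow> H (of_real r * cis a) - integral {0..r} \<phi>) (at_right 0)"
    by (rule Lim_transform_eventually)
  then show ?thesis by blast
qed

text \<open>An arc of radius \<open>t\<close> has length O(t) and carries an integrand of size
  O(t^(s-1)), so the primitive varies by O(t^s) along it.\<close>

lemma vertex_limit_angle:
  assumes "\<omega> < \<nu>" "\<nu> < \<theta>" and a: "a1 \<le> a2" "\<And>a. a \<in> {a1..a2} \<Longrightarrow> \<nu> \<le> \<bar>a\<bar> \<and> \<bar>a\<bar> < \<theta>"
  shows "((\<lambda>t. H (of_real t * cis a2) - H (of_real t * cis a1)) \<longlongrightarrow> 0) (at_right 0)"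
proof -
  obtain C where "C \<ge> 0" and C: "\<And>a t. \<nu> \<le> \<bar>a\<bar> \<Longrightarrow> \<bar>a\<bar> < \<theta> \<Longrightarrow> 0 < t \<Longrightarrow> t < \<delta> \<Longrightarrow>
      of_real t * cis a \<in> S \<and> norm (\<Psi> (of_real t * cis a)) \<le> C * t powr (s - 1)"
    using arc_bound[OF assms(1,2)] by blast
  obtain K where K: "K > 0" "\<And>v. cmod (l v) \<le> norm v * K" using functional_bound by blast
  have "cmod (H (of_real t * cis a2) - H (of_real t * cis a1)) \<le> (C * K * (a2 - a1)) * t powr s"
    if t: "0 < t" "t < \<delta>" for t
  proof -
    have "cmod (H (of_real t * cis a2) - H (of_real t * cis a1)) \<le> (C * t powr (s - 1) * K) * t * (a2 - a1)"
    proof (rule primitive_along_arc[of _ _ _ _ "\<lambda>z. l (\<Psi> z)"])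
      fix b assume b: "b \<in> {a1..a2}"
      show "(H has_field_derivative l (\<Psi> (of_real t * cis b))) (at (of_real t * cis b))"
        using C a(2)[OF b] t by (intro H) auto
      have "cmod (l (\<Psi> (of_real t * cis b))) \<le> norm (\<Psi> (of_real t * cis b)) * K" by (rule K)
      also have "\<dots> \<le> C * t powr (s - 1) * K"
        using C a(2)[OF b] t K(1) by (intro mult_right_mono) auto
      finally show "cmod (l (\<Psi> (of_real t * cis b))) \<le> C * t powr (s - 1) * K" .
    qed (use a t in auto)
    also have "\<dots> = (C * K * (a2 - a1)) * (t powr (s - 1) * t powr 1)" using t by (simp add: mult_ac)
    also have "t powr (s - 1) * t powr 1 = t powr s" by (subst powr_add[symmetric]) simp
    finally show ?thesis .
  qed
  then have "eventually (\<lambda>t. norm (H (of_real t * cis a2) - H (of_real t * cis a1)) \<le> (C * K * (a2 - a1)) * t powr s) (at_right 0)"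
    using \<delta> by (auto simp: eventually_at_right_field intro!: exI[of _ \<delta>])
  moreover have "((\<lambda>t. (C * K * (a2 - a1)) * t powr s) \<longlongrightarrow> (C * K * (a2 - a1)) * 0) (at_right 0)"
    using s by (intro tendsto_mult tendsto_const) (auto intro!: tendsto_eq_intros tendsto_zero_powrI eventually_at_right_less simp: eventually_at_right_field)
  ultimately show ?thesis using Lim_null_comparison by fastforce
qed

text \<open>The limit depends on the side of the axis, not on the angle. The values for the two
  signs may differ: an arc joining the sides would cross \<open>closed_sector \<omega>\<close>,
  where \<open>S\<close> need not reach.\<close>

lemma vertex_limits:
  obtains L where "\<And>\<sigma> \<nu>. \<sigma> \<in> {1, -1} \<Longrightarrow> \<omega> < \<nu> \<Longrightarrow> \<nu> < \<theta> \<Longrightarrow>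
    ((\<lambda>t. H (of_real t * cis (\<sigma> * \<nu>))) \<longlongrightarrow> L \<sigma>) (at_right 0)"
proof -
  have "\<exists>L. \<forall>\<nu>. \<omega> < \<nu> \<longrightarrow> \<nu> < \<theta> \<longrightarrow> ((\<lambda>t. H (of_real t * cis (\<sigma> * \<nu>))) \<longlongrightarrow> L) (at_right 0)"
    if \<sigma>: "\<sigma> \<in> {1, -1 :: real}" for \<sigma>
  proof -
    define \<nu>0 where "\<nu>0 = (\<omega> + \<theta>) / 2"
    have \<nu>0: "\<omega> < \<nu>0" "\<nu>0 < \<theta>" using angles by (auto simp: \<nu>0_def)
    have "\<omega> < \<bar>\<sigma> * \<nu>0\<bar>" "\<bar>\<sigma> * \<nu>0\<bar> < \<theta>" using \<sigma> \<nu>0 angles by auto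
    then obtain L where L: "((\<lambda>t. H (of_real t * cis (\<sigma> * \<nu>0))) \<longlongrightarrow> L) (at_right 0)"
      using ray_vertex_limit by blast
    have "((\<lambda>t. H (of_real t * cis (\<sigma> * \<nu>))) \<longlongrightarrow> L) (at_right 0)" if \<nu>: "\<omega> < \<nu>" "\<nu> < \<theta>" for \<nu>
    proof -
      define b1 b2 where "b1 = min (\<sigma> * \<nu>0) (\<sigma> * \<nu>)" and "b2 = max (\<sigma> * \<nu>0) (\<sigma> * \<nu>)"
      have "((\<lambda>t. H (of_real t * cis b2) - H (of_real t * cis b1)) \<longlongrightarrow> 0) (at_right 0)"
        by (rule vertex_limit_angle[of "min \<nu> \<nu>0"])
          (use \<sigma> \<nu> \<nu>0 angles in \<open>auto simp: b1_def b2_def min_def max_def split: if_splits\<close>)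
      then have "((\<lambda>t. H (of_real t * cis (\<sigma> * \<nu>)) - H (of_real t * cis (\<sigma> * \<nu>0))) \<longlongrightarrow> 0) (at_right 0)"
      proof (cases "\<sigma> * \<nu>0 \<le> \<sigma> * \<nu>")
        case False
        assume "((\<lambda>t. H (of_real t * cis b2) - H (of_real t * cis b1)) \<longlongrightarrow> 0) (at_right 0)"
        from tendsto_minus[OF this] show ?thesis using False by (simp add: b1_def b2_def)
      qed (simp add: b1_def b2_def)
      from tendsto_add[OF this L] show ?thesis by simp
    qed
    then show ?thesis by blast
  qed
  then have "\<exists>L. \<forall>\<sigma>\<in>{1, -1}. \<forall>\<nu>. \<omega> < \<nu> \<longrightarrow> \<nu> < \<theta> \<longrightarrow> ((\<lambda>t. H (of_real t * cis (\<sigma> * \<nu>))) \<longlongrightarrow> L \<sigma>) (at_right 0)"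
    by (intro bchoice ballI)
  then show thesis using that by blast
qed

text \<open>The petal leaves the vertex along the lower ray and returns along the upper one, so its
  integral is the jump of the primitive between the two sides.\<close>

lemma petal_integral:
  assumes \<beta>: "\<omega> < \<beta>" "\<beta> < \<theta>" and mem: "\<And>t. t \<in> {0<..<1} \<Longrightarrow> petal \<beta> t \<in> S"
    and Lm: "((\<lambda>t. H (of_real t * cis (- \<beta>))) \<longlongrightarrow> Lm) (at_right 0)"
    and Lp: "((\<lambda>t. H (of_real t * cis \<beta>)) \<longlongrightarrow> Lp) (at_right 0)"
  shows "l (integral {0..1} (\<lambda>t. petal_deriv \<beta> t *\<^sub>C \<Psi> (petal \<beta> t))) = Lp - Lm"
proof -
  have c: "cos \<beta> > 0" using \<beta> angles by (auto simp: cos_pos_acute)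
  \<comment> \<open>The primitive along the petal, completed by its one-sided limits: both ends of
    the path are the vertex, where \<open>H\<close> itself need not be continuous.\<close>
  define h where "h t = (if t \<le> 0 then Lm else if t \<ge> 1 then Lp else H (petal \<beta> t))" for t
  have Hc: "isCont H z" if "z \<in> S" for z using H[OF that] by (rule DERIV_isCont)
  have lim0: "(h \<longlongrightarrow> Lm) (at_right 0)"
  proof -
    have "filterlim (\<lambda>t. 2 * cos \<beta> * t) (at_right 0) (at_right 0)"
      using c by (auto simp: filterlim_at eventually_at_right_field intro!: tendsto_eq_intros exI[of _ 1])
    from filterlim_compose[OF Lm this]
    have "((\<lambda>t. H (of_real (2 * cos \<beta> * t) * cis (- \<beta>))) \<longlongrightarrow> Lm) (at_right 0)" .
    moreover have "eventually (\<lambda>t. H (of_real (2 * cos \<beta> * t) * cis (- \<beta>)) = h t) (at_right 0)"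
      unfolding eventually_at_right_field by (auto simp: h_def petal_first intro!: exI[of _ "1/2"])
    ultimately show ?thesis by (rule Lim_transform_eventually)
  qed
  have lim1: "(h \<longlongrightarrow> Lp) (at_left 1)"
  proof -
    have "filterlim (\<lambda>t. - 4 * cos \<beta> * t + 4 * cos \<beta>) (at_right 0) (at_left 1)"
      using c by (auto simp: filterlim_at eventually_at_left_field intro!: tendsto_eq_intros exI[of _ 0])
    from filterlim_compose[OF Lp this]
    have "((\<lambda>t. H (of_real (- 4 * cos \<beta> * t + 4 * cos \<beta>) * cis \<beta>)) \<longlongrightarrow> Lp) (at_left 1)" .
    moreover have "eventually (\<lambda>t. H (of_real (- 4 * cos \<beta> * t + 4 * cos \<beta>) * cis \<beta>) = h t) (at_left 1)"
      unfolding eventually_at_left_field by (auto simp: h_def petal_last intro!: exI[of _ "3/4"])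
    ultimately show ?thesis by (rule Lim_transform_eventually)
  qed
  have inner: "isCont h t" if "t \<in> {0<..<1}" for t
  proof -
    have "isCont (petal \<beta>) t"
      using continuous_on_interior[OF continuous_on_petal, of t] that by simp
    then have "isCont (\<lambda>t. H (petal \<beta> t)) t"
      by (rule isCont_o2[where g = H]) (rule Hc[OF mem[OF that]])
    moreover have "eventually (\<lambda>t. t \<in> {0<..<1}) (nhds t)"
      using that by (intro eventually_nhds_in_open) auto
    then have "eventually (\<lambda>t. H (petal \<beta> t) = h t) (nhds t)"
      by (rule eventually_mono) (simp add: h_def)
    ultimately show ?thesis using isCont_cong[of "\<lambda>t. H (petal \<beta> t)" h t] by simp
  qed
  have "continuous_on {0..1} h"
    unfolding continuous_on_def
  proof
    fix t :: real assume "t \<in> {0..1}"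
    then consider "t = 0" | "t = 1" | "t \<in> {0<..<1}" by force
    then show "(h \<longlongrightarrow> h t) (at t within {0..1})"
    proof cases
      case 1
      then show ?thesis using lim0 by (simp add: at_within_Icc_at_right h_def)
    next
      case 2
      then show ?thesis using lim1 by (simp add: at_within_Icc_at_left h_def)
    next
      case 3
      then show ?thesis using inner[of t] by (simp add: isCont_def at_within_Icc_at)
    qed
  qed
  moreover have "(h has_vector_derivative petal_deriv \<beta> t * l (\<Psi> (petal \<beta> t))) (at t)"
    if t: "t \<in> {0<..<1} - {1/2, 3/4}" for t
  proof -
    have "((H \<circ> petal \<beta>) has_vector_derivative petal_deriv \<beta> t * l (\<Psi> (petal \<beta> t))) (at t)"
      using field_vector_diff_chain_at[OF petal_has_vector_derivative[OF t] H] mem t by blast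
    then show ?thesis
      by (rule has_vector_derivative_transform_within_open[of _ _ _ "{0<..<1}"])
        (use t in \<open>auto simp: h_def\<close>)
  qed
  ultimately have "((\<lambda>t. petal_deriv \<beta> t * l (\<Psi> (petal \<beta> t))) has_integral h 1 - h 0) {0..1}"
    by (intro fundamental_theorem_of_calculus_interior_strong[of "{1/2, 3/4}"]) auto
  moreover have "((l \<circ> (\<lambda>t. petal_deriv \<beta> t *\<^sub>C \<Psi> (petal \<beta> t))) has_integral
      l (integral {0..1} (\<lambda>t. petal_deriv \<beta> t *\<^sub>C \<Psi> (petal \<beta> t)))) {0..1}"
    using l petal_integrable[OF \<beta> mem]
    by (intro has_integral_linear) (auto simp: has_integral_integral clinear_functional_def)
  ultimately show ?thesis
    by (simp add: o_def clinear_functional_simps[OF l] h_def has_integral_unique)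
qed

end

lemma primitive_exists:
  assumes "clinear_functional l"
  obtains H where "\<And>z. z \<in> S \<Longrightarrow> (H has_field_derivative l (\<Psi> z)) (at z)"
  using holomorphic_primitive_connected_complement[OF S hol[OF assms]] by blast

lemma petal_integral_eq:
  assumes "\<omega> < \<beta>" "\<beta> < \<theta>" "\<And>t. t \<in> {0<..<1} \<Longrightarrow> petal \<beta> t \<in> S"
    and "\<omega> < \<beta>'" "\<beta>' < \<theta>" "\<And>t. t \<in> {0<..<1} \<Longrightarrow> petal \<beta>' t \<in> S"
  shows "integral {0..1} (\<lambda>t. petal_deriv \<beta> t *\<^sub>C \<Psi> (petal \<beta> t)) =
    integral {0..1} (\<lambda>t. petal_deriv \<beta>' t *\<^sub>C \<Psi> (petal \<beta>' t))"
proof (rule eq_by_functionals)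
  fix l :: "'a \<Rightarrow> complex" assume l: "clinear_functional l"
  obtain H where H: "\<And>z. z \<in> S \<Longrightarrow> (H has_field_derivative l (\<Psi> z)) (at z)"
    using primitive_exists[OF l] by blast
  obtain L where L: "\<And>\<sigma> \<nu>. \<sigma> \<in> {1, -1} \<Longrightarrow> \<omega> < \<nu> \<Longrightarrow> \<nu> < \<theta> \<Longrightarrow>
      ((\<lambda>t. H (of_real t * cis (\<sigma> * \<nu>))) \<longlongrightarrow> L \<sigma>) (at_right 0)"
    using vertex_limits[OF l H] by blast
  have "l (integral {0..1} (\<lambda>t. petal_deriv b t *\<^sub>C \<Psi> (petal b t))) = L 1 - L (- 1)"
    if "\<omega> < b" "b < \<theta>" "\<And>t. t \<in> {0<..<1} \<Longrightarrow> petal b t \<in> S" for b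
    by (rule petal_integral[OF l H that]) (use L[of 1 b] L[of "- 1" b] that in auto)
  then show "l (integral {0..1} (\<lambda>t. petal_deriv \<beta> t *\<^sub>C \<Psi> (petal \<beta> t))) =
      l (integral {0..1} (\<lambda>t. petal_deriv \<beta>' t *\<^sub>C \<Psi> (petal \<beta>' t)))"
    using assms by simp
qed

end

text \<open>From radius 2 on, beyond all \<open>scaled_discs\<close>, the whole sector including its
  axis lies in \<open>S\<close>. Any \<delta> above 2 makes the bound at the vertex reach the radius
  where the bound at infinity takes over. The exponent -1 - s comes from decay -s of the function
  and -1 of the resolvent.\<close>

locale cone_fun_inf = cone_fun +
  assumes \<delta>3: "\<delta> = 3"
    and cone_inf: "\<And>z. z \<in> sector \<theta> - closed_sector \<omega> \<Longrightarrow> z \<in> S" "\<And>z. z \<in> sector \<theta> \<Longrightarrow> cmod z \<ge> 2 \<Longrightarrow> z \<in> S"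
    and bound_inf: "\<exists>C. \<forall>z\<in>sector \<theta>. cmod z \<ge> 2 \<longrightarrow> norm (\<Psi> z) \<le> C * cmod z powr (- 1 - s)"
begin

lemma ray_integrable_inf:
  assumes a: "\<omega> < \<bar>a\<bar>" "\<bar>a\<bar> < \<theta>"
  shows "(\<lambda>t. \<Psi> (of_real t * cis a)) integrable_on {0<..}"
proof -
  obtain C where C: "\<And>t. 0 < t \<Longrightarrow> t < \<delta> \<Longrightarrow> norm (\<Psi> (of_real t * cis a)) \<le> C * t powr (s - 1)"
    using arc_bound[OF a] by (metis order_refl a(2))
  obtain C' where C': "\<And>z. z \<in> sector \<theta> \<Longrightarrow> cmod z \<ge> 2 \<Longrightarrow> norm (\<Psi> z) \<le> C' * cmod z powr (- 1 - s)"
    using bound_inf by blast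
  have mem: "of_real t * cis a \<in> sector \<theta> - closed_sector \<omega>" if "t > 0" for t
    using cis_mem_cone[of \<omega> a t] that a by simp
  define g where "g t = (if t \<le> 2 then C * t powr (s - 1) else C' * t powr (- 1 - s))" for t
  have "(\<lambda>t. C * t powr (s - 1)) integrable_on {0<..2}"
    using s by (intro integrable_on_mult_right integrable_on_powr_from_0') auto
  then have "g integrable_on {0<..2}"
    by (rule integrable_eq) (auto simp: g_def)
  moreover have "(\<lambda>t. C' * t powr (- 1 - s)) integrable_on {2..}"
    using has_integral_powr_to_inf[of "- 1 - s" 2] s
    by (intro integrable_on_mult_right) (auto simp: integrable_on_def)
  then have "g integrable_on {2..}"
    by (rule integrable_spike_finite[of "{2}", rotated 2]) (auto simp: g_def)
  moreover have "{0<..2} \<inter> {2..} = {2 :: real}" by auto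
  then have "negligible ({0<..2} \<inter> {2 :: real..})" by simp
  ultimately have "g integrable_on {0<..2} \<union> {2..}"
    by (intro integrable_Un)
  moreover have "{0<..2} \<union> {2..} = {0 :: real<..}" by auto
  ultimately have g: "g integrable_on {0<..}" by simp
  show ?thesis
  proof (rule integrable_dominated_half_line[OF _ _ g])
    show "continuous_on {0<..} (\<lambda>t. \<Psi> (of_real t * cis a))"
      by (rule continuous_on_ray) (use mem cone_inf in auto)
    show "norm (\<Psi> (of_real t * cis a)) \<le> g t" if "t > 0" for t
      using C[of t] C'[of "of_real t * cis a"] mem[OF that] that
      by (auto simp: g_def \<delta>3 norm_mult)
  qed
qed

context
  fixes l H
  assumes l: "clinear_functional l" and H: "\<And>z. z \<in> S \<Longrightarrow> (H has_field_derivative l (\<Psi> z)) (at z)"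
begin

lemma ray_limit_inf:
  assumes a: "\<omega> < \<bar>a\<bar>" "\<bar>a\<bar> < \<theta>" and L: "((\<lambda>t. H (of_real t * cis a)) \<longlongrightarrow> L) (at_right 0)"
  shows "((\<lambda>r. H (of_real r * cis a)) \<longlongrightarrow> L + l (ray_integral (cis a) \<Psi>)) at_top"
proof -
  define \<phi> where "\<phi> t = cis a * l (\<Psi> (of_real t * cis a))" for t
  define I where "I = l (ray_integral (cis a) \<Psi>)"
  have mem: "of_real t * cis a \<in> S" if "t > 0" for t
    using cis_mem_cone[of \<omega> a t] that a cone_inf by simp
  have "(\<phi> has_integral I) {0<..}"
    using functional_ray[OF l H ray_integrable_inf[OF a]]
    by (simp add: \<phi>_def[abs_def] I_def ray_integral_def)
  then have ex: "\<exists>B>0. \<forall>c d. ball 0 B \<subseteq> cbox c d \<longrightarrow>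
      norm (integral (cbox c d) (\<lambda>x. if x \<in> {0<..} then \<phi> x else 0) - I) < e" if "e > 0" for e
    using that unfolding has_integral_alt'[of \<phi> I] by blast
  have fin: "integral {0..r} \<phi> = H (of_real r * cis a) - L" if r: "r > 0" for r
  proof (rule integral_unique)
    define h where "h t = (if t \<le> 0 then L else H (of_real t * cis a))" for t
    have d: "((\<lambda>t. H (of_real t * cis a)) has_vector_derivative \<phi> t) (at t)" if "t > 0" for t
      unfolding \<phi>_def using primitive_along_ray[of H "\<lambda>z. l (\<Psi> z)"] H mem that by blast
    have dh: "(h has_vector_derivative \<phi> t) (at t)" if "t > 0" for t
      by (rule has_vector_derivative_transform_within_open[OF d[OF that], of "{0<..}"])
        (use that in \<open>auto simp: h_def\<close>)
    have "eventually (\<lambda>t. H (of_real t * cis a) = h t) (at_right 0)"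
      unfolding eventually_at_right_field by (auto simp: h_def intro!: exI[of _ 1])
    then have lim: "(h \<longlongrightarrow> h 0) (at_right 0)"
      using Lim_transform_eventually[OF L] by (simp add: h_def)
    have "continuous_on {0..r} h"
      unfolding continuous_on_def
    proof
      fix t assume "t \<in> {0..r}"
      show "(h \<longlongrightarrow> h t) (at t within {0..r})"
      proof (cases "t = 0")
        case True
        then show ?thesis using lim r by (simp add: at_within_Icc_at_right)
      next
        case False
        then have "t > 0" using \<open>t \<in> {0..r}\<close> by simp
        then have "isCont h t" using dh has_vector_derivative_continuous by blast
        then show ?thesis
          unfolding isCont_def by (rule tendsto_within_subset) simp
      qed
    qed
    then have "(\<phi> has_integral h r - h 0) {0..r}"
      using dh r by (intro fundamental_theorem_of_calculus_interior_strong[of "{}"]) auto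
    then show "(\<phi> has_integral H (of_real r * cis a) - L) {0..r}" using r by (simp add: h_def)
  qed
  have "((\<lambda>r. integral {0..r} \<phi>) \<longlongrightarrow> I) at_top"
  proof (rule tendstoI)
    fix e :: real assume "e > 0"
    then obtain B where B: "B > 0" "\<And>c d. ball 0 B \<subseteq> cbox c d \<Longrightarrow>
        norm (integral (cbox c d) (\<lambda>x. if x \<in> {0<..} then \<phi> x else 0) - I) < e"
      using ex by blast
    have "dist (integral {0..r} \<phi>) I < e" if r: "r \<ge> B" for r
    proof -
      have "integral (cbox (- r) r) (\<lambda>x. if x \<in> {0<..} then \<phi> x else 0) = integral ({0<..} \<inter> {- r..r}) \<phi>"
        by (simp only: cbox_interval integral_restrict_Int)
      also have "{0<..} \<inter> {- r..r} = {0<..r}" using r B(1) by auto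
      also have "integral {0<..r} \<phi> = integral {0..r} \<phi>"
        by (rule integral_spike_set) (auto intro: negligible_subset[of "{0}"])
      moreover have "ball 0 B \<subseteq> cbox (- r) r" using r by (auto simp: dist_real_def)
      ultimately show ?thesis using B(2) by (metis dist_norm)
    qed
    then show "eventually (\<lambda>r. dist (integral {0..r} \<phi>) I < e) at_top"
      by (auto simp: eventually_at_top_linorder)
  qed
  then have "((\<lambda>r. integral {0..r} \<phi> + L) \<longlongrightarrow> I + L) at_top"
    by (intro tendsto_intros)
  moreover have "eventually (\<lambda>r. integral {0..r} \<phi> + L = H (of_real r * cis a)) at_top"
    unfolding eventually_at_top_linorder using fin by (auto intro!: exI[of _ 1])
  ultimately have "((\<lambda>r. H (of_real r * cis a)) \<longlongrightarrow> I + L) at_top"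
    by (rule Lim_transform_eventually)
  then show ?thesis by (simp add: I_def add.commute)
qed

text \<open>Length O(r) against an integrand O(r^(-1-s)). In contrast to the vertex, these arcs may
  cross the axis, which identifies the limits at infinity from above and from below.\<close>

lemma angle_limit_inf:
  assumes a: "a1 \<le> a2" "- \<theta> < a1" "a2 < \<theta>"
  shows "((\<lambda>r. H (of_real r * cis a2) - H (of_real r * cis a1)) \<longlongrightarrow> 0) at_top"
proof -
  obtain C where C: "\<And>z. z \<in> sector \<theta> \<Longrightarrow> cmod z \<ge> 2 \<Longrightarrow> norm (\<Psi> z) \<le> C * cmod z powr (- 1 - s)"
    using bound_inf by blast
  obtain K where K: "K > 0" "\<And>v. cmod (l v) \<le> norm v * K"
    using functional_bound[OF l H] by blast
  have "cmod (H (of_real t * cis a2) - H (of_real t * cis a1)) \<le> (C * K * (a2 - a1)) * t powr (- s)"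
    if t: "t \<ge> 2" for t
  proof -
    have "cmod (H (of_real t * cis a2) - H (of_real t * cis a1)) \<le> (C * t powr (- 1 - s) * K) * t * (a2 - a1)"
    proof (rule primitive_along_arc[of _ _ _ _ "\<lambda>z. l (\<Psi> z)"])
      fix b assume b: "b \<in> {a1..a2}"
      have m: "of_real t * cis b \<in> sector \<theta>"
        using cis_mem_sector[of \<theta> b t] angles a b t by auto
      have n: "cmod (of_real t * cis b) = t" using t by (simp add: norm_mult)
      show "(H has_field_derivative l (\<Psi> (of_real t * cis b))) (at (of_real t * cis b))"
        by (rule H, rule cone_inf(2)[OF m]) (use n t in simp)
      have "cmod (l (\<Psi> (of_real t * cis b))) \<le> norm (\<Psi> (of_real t * cis b)) * K" by (rule K)
      also have "\<dots> \<le> C * t powr (- 1 - s) * K"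
        using C[OF m] n t K(1) by (intro mult_right_mono) auto
      finally show "cmod (l (\<Psi> (of_real t * cis b))) \<le> C * t powr (- 1 - s) * K" .
    qed (use a t in auto)
    also have "\<dots> = (C * K * (a2 - a1)) * (t powr (- 1 - s) * t powr 1)" using t by (simp add: mult_ac)
    also have "t powr (- 1 - s) * t powr 1 = t powr (- s)" by (subst powr_add[symmetric]) simp
    finally show ?thesis .
  qed
  then have "eventually (\<lambda>t. norm (H (of_real t * cis a2) - H (of_real t * cis a1)) \<le> (C * K * (a2 - a1)) * t powr (- s)) at_top"
    by (auto simp: eventually_at_top_linorder intro!: exI[of _ 2])
  moreover have "((\<lambda>t. (C * K * (a2 - a1)) * t powr (- s)) \<longlongrightarrow> (C * K * (a2 - a1)) * 0) at_top"
    using s by (intro tendsto_mult tendsto_const tendsto_neg_powr) (auto simp: filterlim_ident)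
  ultimately show ?thesis using Lim_null_comparison by fastforce
qed

end

text \<open>Each ray integral is the increment of the primitive from the vertex to infinity; the
  contributions at infinity cancel and the jump at the vertex remains.\<close>

lemma ray_difference:
  assumes l: "clinear_functional l" and H: "\<And>z. z \<in> S \<Longrightarrow> (H has_field_derivative l (\<Psi> z)) (at z)"
    and \<nu>: "\<omega> < \<nu>" "\<nu> < \<theta>"
    and Lm: "((\<lambda>t. H (of_real t * cis (- \<nu>))) \<longlongrightarrow> Lm) (at_right 0)"
    and Lp: "((\<lambda>t. H (of_real t * cis \<nu>)) \<longlongrightarrow> Lp) (at_right 0)"
  shows "l (ray_integral (cis (- \<nu>)) \<Psi> - ray_integral (cis \<nu>) \<Psi>) = Lp - Lm"
proof -
  have *: "\<omega> < \<bar>\<nu>\<bar>" "\<bar>\<nu>\<bar> < \<theta>" "\<omega> < \<bar>- \<nu>\<bar>" "\<bar>- \<nu>\<bar> < \<theta>" using \<nu> angles by auto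
  from tendsto_diff[OF ray_limit_inf[OF l H *(1,2) Lp] ray_limit_inf[OF l H *(3,4) Lm]]
  have "((\<lambda>r. H (of_real r * cis \<nu>) - H (of_real r * cis (- \<nu>))) \<longlongrightarrow>
     Lp + l (ray_integral (cis \<nu>) \<Psi>) - (Lm + l (ray_integral (cis (- \<nu>)) \<Psi>))) at_top" by blast
  moreover have "((\<lambda>r. H (of_real r * cis \<nu>) - H (of_real r * cis (- \<nu>))) \<longlongrightarrow> 0) at_top"
    by (rule angle_limit_inf[OF l H]) (use \<nu> angles in auto)
  ultimately have "Lp + l (ray_integral (cis \<nu>) \<Psi>) - (Lm + l (ray_integral (cis (- \<nu>)) \<Psi>)) = 0"
    using tendsto_unique[OF trivial_limit_at_top_linorder] by blast
  then show ?thesis by (simp add: clinear_functional_simps[OF l] algebra_simps)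
qed

lemma ray_difference_eq:
  assumes "\<omega> < \<nu>" "\<nu> < \<theta>" "\<omega> < \<nu>'" "\<nu>' < \<theta>"
  shows "ray_integral (cis (- \<nu>)) \<Psi> - ray_integral (cis \<nu>) \<Psi> =
    ray_integral (cis (- \<nu>')) \<Psi> - ray_integral (cis \<nu>') \<Psi>"
proof (rule eq_by_functionals)
  fix l :: "'a \<Rightarrow> complex" assume l: "clinear_functional l"
  obtain H where H: "\<And>z. z \<in> S \<Longrightarrow> (H has_field_derivative l (\<Psi> z)) (at z)"
    using primitive_exists[OF l] by blast
  obtain L where L: "\<And>\<sigma> \<nu>. \<sigma> \<in> {1, -1} \<Longrightarrow> \<omega> < \<nu> \<Longrightarrow> \<nu> < \<theta> \<Longrightarrow>
      ((\<lambda>t. H (of_real t * cis (\<sigma> * \<nu>))) \<longlongrightarrow> L \<sigma>) (at_right 0)"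
    using vertex_limits[OF l H] by blast
  have "l (ray_integral (cis (- b)) \<Psi> - ray_integral (cis b) \<Psi>) = L 1 - L (- 1)"
    if "\<omega> < b" "b < \<theta>" for b
    by (rule ray_difference[OF l H that]) (use L[of 1 b] L[of "- 1" b] that in auto)
  then show "l (ray_integral (cis (- \<nu>)) \<Psi> - ray_integral (cis \<nu>) \<Psi>) =
    l (ray_integral (cis (- \<nu>')) \<Psi> - ray_integral (cis \<nu>') \<Psi>)"
    using assms by simp
qed

lemma ray_difference_eq_petal_integral:
  assumes \<nu>: "\<omega> < \<nu>" "\<nu> < \<theta>" and mem: "\<And>t. t \<in> {0<..<1} \<Longrightarrow> petal \<nu> t \<in> S"
  shows "ray_integral (cis (- \<nu>)) \<Psi> - ray_integral (cis \<nu>) \<Psi> =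
    integral {0..1} (\<lambda>t. petal_deriv \<nu> t *\<^sub>C \<Psi> (petal \<nu> t))"
proof (rule eq_by_functionals)
  fix l :: "'a \<Rightarrow> complex" assume l: "clinear_functional l"
  obtain H where H: "\<And>z. z \<in> S \<Longrightarrow> (H has_field_derivative l (\<Psi> z)) (at z)"
    using primitive_exists[OF l] by blast
  obtain L where L: "\<And>\<sigma> \<nu>. \<sigma> \<in> {1, -1} \<Longrightarrow> \<omega> < \<nu> \<Longrightarrow> \<nu> < \<theta> \<Longrightarrow>
      ((\<lambda>t. H (of_real t * cis (\<sigma> * \<nu>))) \<longlongrightarrow> L \<sigma>) (at_right 0)"
    using vertex_limits[OF l H] by blast
  have "((\<lambda>t. H (of_real t * cis (- \<nu>))) \<longlongrightarrow> L (- 1)) (at_right 0)"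
    "((\<lambda>t. H (of_real t * cis \<nu>)) \<longlongrightarrow> L 1) (at_right 0)"
    using L[of 1 \<nu>] L[of "- 1" \<nu>] \<nu> by auto
  then show "l (ray_integral (cis (- \<nu>)) \<Psi> - ray_integral (cis \<nu>) \<Psi>) =
    l (integral {0..1} (\<lambda>t. petal_deriv \<nu> t *\<^sub>C \<Psi> (petal \<nu> t)))"
    using ray_difference[OF l H \<nu>] petal_integral[OF l H \<nu> mem] by simp
qed

end

section \<open>From the Stolz domain to the sector\<close>

lemma sum_square_add_le:
  fixes a b :: "'i \<Rightarrow> complex"
  shows "(\<Sum>k\<in>I. (cmod (a k + b k))\<^sup>2) \<le> 2 * (\<Sum>k\<in>I. (cmod (a k))\<^sup>2) + 2 * (\<Sum>k\<in>I. (cmod (b k))\<^sup>2)"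
proof -
  have "(cmod (a k + b k))\<^sup>2 \<le> 2 * (cmod (a k))\<^sup>2 + 2 * (cmod (b k))\<^sup>2" for k
  proof -
    have "(cmod (a k + b k))\<^sup>2 \<le> (cmod (a k) + cmod (b k))\<^sup>2"
      by (intro power_mono norm_triangle_ineq) simp
    also have "\<dots> \<le> 2 * (cmod (a k))\<^sup>2 + 2 * (cmod (b k))\<^sup>2"
      using sum_squares_bound[of "cmod (a k)" "cmod (b k)"] by (simp add: power2_sum)
    finally show ?thesis .
  qed
  then show ?thesis unfolding sum_distrib_left sum.distrib[symmetric] by (rule sum_mono)
qed

text \<open>With one kernel \<open>\<kappa>\<close> for all indices, the modulus goes inside the
  integral and Minkowski's inequality moves the square sum inside as well. This transfers square
  function bounds to Cauchy integrals.\<close>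

lemma linepath_square_sum_le:
  fixes f :: "'i \<Rightarrow> complex \<Rightarrow> complex"
  assumes "finite I" and f: "\<And>k. k \<in> I \<Longrightarrow> continuous_on (closed_segment p q) (f k)"
    and \<kappa>: "continuous_on (closed_segment p q) \<kappa>"
    and \<kappa>_le: "\<And>z. z \<in> closed_segment p q \<Longrightarrow> cmod (\<kappa> z) \<le> B"
    and M: "\<And>z. z \<in> closed_segment p q \<Longrightarrow> (\<Sum>k\<in>I. (cmod (f k z))\<^sup>2) \<le> M\<^sup>2"
  shows "(\<Sum>k\<in>I. (cmod (contour_integral (linepath p q) (\<lambda>z. f k z * \<kappa> z)))\<^sup>2) \<le> (B * M * cmod (q - p))\<^sup>2"
proof -
  define u where "u k t = cmod (f k (linepath p q t)) * cmod (\<kappa> (linepath p q t)) * cmod (q - p)" for k t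
  have lp: "linepath p q t \<in> closed_segment p q" if "t \<in> {0..1}" for t
    using that linepath_in_path by blast
  have c1: "continuous_on {0..1} (\<lambda>t. f k (linepath p q t))" if "k \<in> I" for k
    by (rule continuous_on_compose2[OF f[OF that]]) (use lp in \<open>auto intro!: continuous_intros\<close>)
  have c2: "continuous_on {0..1} (\<lambda>t. \<kappa> (linepath p q t))"
    by (rule continuous_on_compose2[OF \<kappa>]) (use lp in \<open>auto intro!: continuous_intros\<close>)
  have u: "u k integrable_on {0..1}" if "k \<in> I" for k
    unfolding u_def[abs_def] by (intro integrable_continuous_real continuous_intros c1 c2 that)
  have "(\<Sum>k\<in>I. 1 * (integral {0..1} (u k))\<^sup>2) \<le> (B * M * cmod (q - p))\<^sup>2"
  proof (rule integral_square_sum_le[OF \<open>finite I\<close> _ u])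
    fix t :: real assume t: "t \<in> {0..1}"
    let ?z = "linepath p q t"
    have "(\<Sum>k\<in>I. 1 * (u k t)\<^sup>2) = (\<Sum>k\<in>I. (cmod (f k ?z))\<^sup>2) * ((cmod (\<kappa> ?z))\<^sup>2 * (cmod (q - p))\<^sup>2)"
      by (simp add: u_def power_mult_distrib sum_distrib_right mult.assoc)
    also have "\<dots> \<le> M\<^sup>2 * (B\<^sup>2 * (cmod (q - p))\<^sup>2)"
      using M[OF lp[OF t]] \<kappa>_le[OF lp[OF t]]
      by (intro mult_mono mult_nonneg_nonneg power_mono) auto
    finally show "(\<Sum>k\<in>I. 1 * (u k t)\<^sup>2) \<le> (B * M * cmod (q - p))\<^sup>2"
      by (simp add: power_mult_distrib mult_ac)
  qed simp_all
  moreover have "cmod (contour_integral (linepath p q) (\<lambda>z. f k z * \<kappa> z)) \<le> integral {0..1} (u k)"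
    if "k \<in> I" for k
    unfolding contour_integral_integral
  proof (rule integral_norm_bound_integral[OF _ u[OF that]])
    show "(\<lambda>x. f k (linepath p q x) * \<kappa> (linepath p q x) * vector_derivative (linepath p q) (at x)) integrable_on {0..1}"
      unfolding vector_derivative_linepath_at
      by (intro integrable_continuous_real continuous_intros c1 c2 that)
  qed (simp add: u_def norm_mult)
  then have "(\<Sum>k\<in>I. (cmod (contour_integral (linepath p q) (\<lambda>z. f k z * \<kappa> z)))\<^sup>2) \<le> (\<Sum>k\<in>I. 1 * (integral {0..1} (u k))\<^sup>2)"
    by (intro sum_mono) (simp add: power_mono)
  ultimately show ?thesis by linarith
qed

lemma holomorphic_cauchy_linepath:
  assumes "continuous_on (closed_segment p q) f" "open U" "U \<inter> closed_segment p q = {}"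
  shows "(\<lambda>w. contour_integral (linepath p q) (\<lambda>z. f z / (z - w))) holomorphic_on U"
  unfolding holomorphic_on_open[OF assms(2)]
proof
  fix w assume w: "w \<in> U"
  have "((\<lambda>w. contour_integral (linepath p q) (\<lambda>z. f z / (z - w))) has_field_derivative
      of_nat 1 * contour_integral (linepath p q) (\<lambda>u. f u / (u - w) ^ Suc 1)) (at w)"
  proof (rule Cauchy_next_derivative(2)[where B = "cmod (q - p)" and S = UNIV])
    fix v assume v: "v \<in> UNIV - path_image (linepath p q)"
    have "continuous_on (closed_segment p q) (\<lambda>z. f z / (z - v))"
      using v by (intro continuous_intros assms) auto
    then show "((\<lambda>u. f u / (u - v) ^ 1) has_contour_integral
        contour_integral (linepath p q) (\<lambda>z. f z / (z - v))) (linepath p q)"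
      by (simp add: contour_integrable_continuous_linepath has_contour_integral_integral)
  qed (use assms w in auto)
  then show "\<exists>f'. ((\<lambda>w. contour_integral (linepath p q) (\<lambda>z. f z / (z - w))) has_field_derivative f') (at w)"
    by blast
qed

text \<open>The functions live on the petal of angle \<gamma>, the Cauchy triangle has half-aperture
  \<beta> at the vertex, and the transferred functions live on the sector of angle \<theta>. The gap
  below \<gamma> keeps the triangle inside the domain; the gap above \<theta> keeps the sector away
  from the sides of the triangle.\<close>

locale decomposition =
  fixes \<theta> \<beta> \<gamma> :: real
  assumes angles: "0 < \<theta>" "\<theta> < \<beta>" "\<beta> < \<gamma>" "\<gamma> < pi / 2"
begin

text \<open>The height of the triangle. Since the moduli in question are at most
  \<open>a / cos \<beta>\<close> on the triangle and \<open>a / cos \<theta>\<close> on the part of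
  the sector to the left of its far side, this product keeps both within radius
  \<open>cos \<gamma>\<close>, where sector and petal of angle \<gamma> coincide.\<close>

definition "a = cos \<beta> * cos \<theta> * cos \<gamma> / 2"
definition "Bm = Complex a (- (a * tan \<beta>))"
definition "Bp = Complex a (a * tan \<beta>)"

lemma trig: "cos \<beta> > 0" "cos \<theta> > 0" "cos \<gamma> > 0" "tan \<theta> > 0" "tan \<theta> < tan \<beta>" "tan \<beta> < tan \<gamma>" "tan \<beta> > 0"
  using angles by (auto simp: cos_pos_acute tan_gt_zero intro: tan_strict_mono)

lemma a_pos: "a > 0" and a_less: "a < 1" and a_cos: "a / cos \<beta> < cos \<gamma>" "a / cos \<theta> < cos \<gamma>"
proof -
  show "a > 0" using trig by (simp add: a_def)
  have c: "cos \<beta> \<le> 1" "cos \<theta> \<le> 1" "cos \<gamma> \<le> 1" by auto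
  have "cos \<theta> * cos \<gamma> < 2 * cos \<gamma>" "cos \<beta> * cos \<gamma> < 2 * cos \<gamma>"
    by (rule mult_strict_right_mono; use trig c in linarith)+
  then show "a / cos \<beta> < cos \<gamma>" "a / cos \<theta> < cos \<gamma>"
    using trig by (simp_all add: a_def)
  have "cos \<beta> * cos \<theta> * cos \<gamma> \<le> 1"
    using trig c by (intro mult_le_one mult_nonneg_nonneg) auto
  then show "a < 1" by (simp add: a_def)
qed

definition T :: "complex set" where "T = {z. 0 \<le> Re z \<and> Re z \<le> a \<and> \<bar>Im z\<bar> \<le> tan \<beta> * Re z}"

lemma norm_le_Re:
  assumes "0 < \<nu>" "\<nu> < pi / 2" "Re z \<ge> 0" "\<bar>Im z\<bar> \<le> tan \<nu> * Re z"
  shows "cmod z \<le> Re z / cos \<nu>"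
proof (rule power2_le_imp_le)
  have c: "cos \<nu> > 0" using assms by (simp add: cos_pos_acute)
  have "(Im z)\<^sup>2 \<le> (tan \<nu> * Re z)\<^sup>2" using power_mono[OF assms(4), of 2] by simp
  then have "(cmod z)\<^sup>2 \<le> (Re z)\<^sup>2 * (1 + (tan \<nu>)\<^sup>2)" by (simp add: cmod_power2 power_mult_distrib algebra_simps)
  also have "1 + (tan \<nu>)\<^sup>2 = inverse ((cos \<nu>)\<^sup>2)" using c tan_sec[of \<nu>] by (simp add: power_inverse)
  finally show "(cmod z)\<^sup>2 \<le> (Re z / cos \<nu>)\<^sup>2"
    by (simp add: divide_inverse power_mult_distrib power_inverse)
  show "0 \<le> Re z / cos \<nu>" using c assms by simp
qed

lemma T_subset: "T - {0} \<subseteq> stolz_delta \<gamma>"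
proof
  fix z assume z: "z \<in> T - {0}"
  have "Re z \<noteq> 0"
  proof
    assume "Re z = 0"
    then show False using z by (auto simp: T_def complex_eq_iff)
  qed
  then have re: "Re z > 0" using z by (auto simp: T_def)
  have "cmod z \<le> Re z / cos \<beta>" using z angles by (intro norm_le_Re) (auto simp: T_def)
  also have "\<dots> \<le> a / cos \<beta>" using z trig by (intro divide_right_mono) (auto simp: T_def)
  also have "\<dots> < cos \<gamma>" by (rule a_cos)
  finally have less: "cmod z < cos \<gamma>" .
  have "\<bar>Im z\<bar> \<le> tan \<beta> * Re z" using z by (simp add: T_def)
  also have "\<dots> < tan \<gamma> * Re z" by (rule mult_strict_right_mono[OF trig(6) re])
  finally have "z \<in> sector \<gamma>" using re angles by (simp add: sector_iff)
  then show "z \<in> stolz_delta \<gamma>" using angles less by (intro sector_near_zero) auto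
qed

lemma T_norm_le: "z \<in> T \<Longrightarrow> cmod z \<le> 1"
proof -
  assume z: "z \<in> T"
  have "cmod z \<le> Re z / cos \<beta>" using z angles by (intro norm_le_Re) (auto simp: T_def)
  also have "\<dots> \<le> a / cos \<beta>" using z trig by (intro divide_right_mono) (auto simp: T_def)
  also have "\<dots> \<le> 1" using a_cos(1) cos_le_one[of \<gamma>] by linarith
  finally show ?thesis .
qed

lemma convex_T: "convex T"
proof -
  have "T = {z. inner 1 z \<ge> 0} \<inter> {z. inner 1 z \<le> a} \<inter> {z. inner (Complex (tan \<beta>) 1) z \<ge> 0} \<inter> {z. inner (Complex (tan \<beta>) (- 1)) z \<ge> 0}"
    by (auto simp: T_def inner_complex_def)
  also have "convex \<dots>"
    by (intro convex_Int convex_halfspace_ge convex_halfspace_le)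
  finally show ?thesis .
qed

lemma corners_mem: "0 \<in> T" "Bm \<in> T" "Bp \<in> T"
  using a_pos trig by (auto simp: T_def Bm_def Bp_def)

lemma hull_eq: "convex hull {0, Bm, Bp} = T"
proof
  show "convex hull {0, Bm, Bp} \<subseteq> T"
    by (rule hull_minimal) (use corners_mem convex_T in auto)
  show "T \<subseteq> convex hull {0, Bm, Bp}"
  proof
    fix z assume z: "z \<in> T"
    \<comment> \<open>Barycentric coordinates: \<open>p\<close> is the total weight of the two far
      corners and \<open>q\<close> the difference of their weights.\<close>
    define p where "p = Re z / a"
    define q where "q = Im z / (a * tan \<beta>)"
    have q: "\<bar>q\<bar> \<le> p" using z a_pos trig by (simp add: q_def p_def T_def abs_divide abs_mult field_simps)
    have p: "0 \<le> p" "p \<le> 1" using z a_pos by (auto simp: p_def T_def)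
    have "z = (1 - p) *\<^sub>R 0 + ((p - q) / 2) *\<^sub>R Bm + ((p + q) / 2) *\<^sub>R Bp"
      using a_pos trig by (simp add: complex_eq_iff Bm_def Bp_def p_def q_def field_simps)
    then show "z \<in> convex hull {0, Bm, Bp}"
      unfolding convex_hull_3 using p q
      by (intro CollectI exI[of _ "1 - p"] exI[of _ "(p - q) / 2"] exI[of _ "(p + q) / 2"]) (auto simp: field_simps)
  qed
qed

lemma interior_T:
  assumes "0 < Re w" "Re w < a" "\<bar>Im w\<bar> < tan \<beta> * Re w"
  shows "w \<in> interior T"
proof -
  let ?U = "{w. 0 < Re w} \<inter> {w. Re w < a} \<inter> {w. \<bar>Im w\<bar> < tan \<beta> * Re w}"
  have "open ?U" by (intro open_Int open_Collect_less continuous_intros)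
  moreover have "?U \<subseteq> T" by (auto simp: T_def)
  ultimately have "?U \<subseteq> interior T" by (rule interior_maximal[rotated])
  then show ?thesis using assms by auto
qed

lemma interior_T_subset: "interior T \<subseteq> stolz_delta \<gamma>"
proof -
  have "0 \<notin> interior T"
  proof
    assume "0 \<in> interior T"
    then obtain e where e: "e > 0" "ball 0 e \<subseteq> T" using mem_interior by blast
    then have "- complex_of_real (e / 2) \<in> T" by (auto simp: subset_iff)
    then show False using e by (simp add: T_def)
  qed
  then show ?thesis using T_subset interior_subset by blast
qed

lemma segments: "closed_segment 0 Bm \<subseteq> T" "closed_segment Bp 0 \<subseteq> T" "closed_segment Bm Bp \<subseteq> T"
  using corners_mem convex_T by (simp_all add: closed_segment_subset)

lemma segment_far: "z \<in> closed_segment Bm Bp \<Longrightarrow> Re z = a"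
  by (auto simp: in_segment Bm_def Bp_def left_diff_distrib)

lemma segment_lower: "z \<in> closed_segment 0 Bm \<Longrightarrow> Im z + tan \<beta> * Re z = 0"
  by (auto simp: in_segment Bm_def)

lemma segment_upper: "z \<in> closed_segment Bp 0 \<Longrightarrow> Im z - tan \<beta> * Re z = 0"
  by (auto simp: in_segment Bp_def)

text \<open>The constant in the distance of \<open>w\<close> from the sides: the form that vanishes
  on a side has modulus at least \<open>(tan \<beta> - tan \<theta>) * Re w\<close> at
  \<open>w\<close> and Lipschitz constant at most \<open>1 + tan \<beta>\<close>.\<close>

definition "\<eta> = (tan \<beta> - tan \<theta>) / (1 + tan \<beta>)"

lemma \<eta>_pos: "\<eta> > 0"
  using trig by (simp add: \<eta>_def)

text \<open>The linear forms \<open>Im z \<plusminus> tan \<beta> Re z\<close> vanish on the sides through the vertex.\<close>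

lemma side_distance:
  assumes w: "w \<in> sector \<theta>" and z: "z \<in> closed_segment 0 Bm \<union> closed_segment Bp 0"
  shows "cmod (z - w) \<ge> \<eta> * Re w"
proof -
  have w': "Re w > 0" "\<bar>Im w\<bar> < tan \<theta> * Re w" using w angles by (auto simp: sector_iff)
  have "(tan \<beta> - tan \<theta>) * Re w \<le> \<bar>Im (z - w)\<bar> + tan \<beta> * \<bar>Re (z - w)\<bar>"
  proof -
    have *: "tan \<beta> * \<bar>Re (z - w)\<bar> = \<bar>tan \<beta> * Re z - tan \<beta> * Re w\<bar>"
      using trig by (simp add: abs_mult right_diff_distrib[symmetric])
    show ?thesis
      using z segment_lower[of z] segment_upper[of z] w' unfolding * by (auto simp: algebra_simps)
  qed
  also have "\<dots> \<le> cmod (z - w) + tan \<beta> * cmod (z - w)"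
    using abs_Im_le_cmod[of "z - w"] abs_Re_le_cmod[of "z - w"] trig by (intro add_mono mult_left_mono) auto
  finally have "(tan \<beta> - tan \<theta>) * Re w \<le> (1 + tan \<beta>) * cmod (z - w)" by (simp add: algebra_simps)
  then show ?thesis using trig by (simp add: \<eta>_def field_simps)
qed

lemma sector_disjoint: "sector \<theta> \<inter> closed_segment 0 Bm = {}" "sector \<theta> \<inter> closed_segment Bp 0 = {}"
proof -
  have "w \<notin> closed_segment 0 Bm \<union> closed_segment Bp 0" if "w \<in> sector \<theta>" for w
  proof
    assume "w \<in> closed_segment 0 Bm \<union> closed_segment Bp 0"
    from side_distance[OF that this] have "\<eta> * Re w \<le> 0" by simp
    moreover have "Re w > 0" using that angles by (auto simp: sector_iff)
    ultimately show False using mult_pos_pos[OF \<eta>_pos, of "Re w"] by linarith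
  qed
  then show "sector \<theta> \<inter> closed_segment 0 Bm = {}" "sector \<theta> \<inter> closed_segment Bp 0 = {}" by blast+
qed

text \<open>The vertex is not in the open petal, so \<open>f\<close> says nothing there; the value 0
  makes a function vanishing at the vertex continuous on the closed triangle.\<close>

definition ext :: "(complex \<Rightarrow> complex) \<Rightarrow> complex \<Rightarrow> complex" where
  "ext f z = (if z = 0 then 0 else f z)"

text \<open>
  The Cauchy integral of \<open>f\<close> over the two sides at the vertex is defined on the whole sector.  The
  last term, the value at \<open>0\<close> of the integral over the far side times \<open>1 / (1 + w)\<close>, makes it
  vanish at the vertex without spoiling the decay at infinity.
\<close>

definition transfer :: "(complex \<Rightarrow> complex) \<Rightarrow> complex \<Rightarrow> complex" where
  "transfer f w = (contour_integral (linepath 0 Bm) (\<lambda>z. ext f z / (z - w))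
     + contour_integral (linepath Bp 0) (\<lambda>z. ext f z / (z - w))
     + contour_integral (linepath Bm Bp) (\<lambda>z. ext f z / z) / (1 + w)) / (2 * pi * \<i>)"

definition vanishing :: "(complex \<Rightarrow> complex) \<Rightarrow> bool" where
  "vanishing f \<longleftrightarrow> f holomorphic_on stolz_delta \<gamma> \<and>
     (\<exists>c>0. \<exists>s>0. \<forall>z\<in>stolz_delta \<gamma>. cmod (f z) \<le> c * cmod z powr s)"

lemma zero_notin_stolz_delta: "0 \<notin> stolz_delta \<gamma>"
proof
  assume "0 \<in> stolz_delta \<gamma>"
  then obtain t where "t \<in> {0<..1}" "cmod (0 - of_real t) < t * sin \<gamma>"
    using angles stolz_delta_iff[of \<gamma> 0] by auto
  then have "t * 1 < t * sin \<gamma>" "t > 0" by auto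
  then show False using sin_le_one[of \<gamma>] mult_left_mono[of "sin \<gamma>" 1 t] by linarith
qed

lemma continuous_on_ext:
  assumes "vanishing f"
  shows "continuous_on T (ext f)"
  unfolding continuous_on_def
proof
  obtain c s where hol: "f holomorphic_on stolz_delta \<gamma>" and c: "c > 0" "s > 0"
    and le: "\<And>z. z \<in> stolz_delta \<gamma> \<Longrightarrow> cmod (f z) \<le> c * cmod z powr s"
    using assms by (auto simp: vanishing_def)
  fix x assume x: "x \<in> T"
  show "(ext f \<longlongrightarrow> ext f x) (at x within T)"
  proof (cases "x = 0")
    case True
    have "((\<lambda>z. cmod z powr s) \<longlongrightarrow> 0) (at x within T)"
      unfolding True
      by (rule tendsto_zero_powrI[OF tendsto_norm_zero[OF tendsto_ident_at] tendsto_const]) (use c in auto)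
    then have "((\<lambda>z. c * cmod z powr s) \<longlongrightarrow> c * 0) (at x within T)"
      by (intro tendsto_intros)
    moreover have "eventually (\<lambda>z. norm (ext f z) \<le> c * cmod z powr s) (at x within T)"
      unfolding eventually_at_filter using le T_subset by (auto simp: ext_def intro!: always_eventually)
    ultimately have "(ext f \<longlongrightarrow> 0) (at x within T)"
      by (intro Lim_null_comparison[of "ext f"]) auto
    then show ?thesis by (simp add: True ext_def)
  next
    case False
    have "x \<in> stolz_delta \<gamma> - {0}" using T_subset x False by auto
    moreover have "open (stolz_delta \<gamma> - {0})" by (simp add: open_stolz_delta open_delete)
    ultimately have ev: "eventually (\<lambda>z. z \<in> stolz_delta \<gamma> - {0}) (nhds x)"
      using eventually_nhds_in_open by blast
    have "isCont f x"
      using holomorphic_on_imp_continuous_on[OF hol] open_stolz_delta \<open>x \<in> stolz_delta \<gamma> - {0}\<close>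
      by (auto simp: continuous_on_eq_continuous_at)
    moreover have "eventually (\<lambda>z. f z = ext f z) (nhds x)"
      using ev by (rule eventually_mono) (auto simp: ext_def)
    ultimately have "isCont (ext f) x" using isCont_cong by blast
    then show ?thesis unfolding isCont_def by (rule tendsto_within_subset) simp
  qed
qed

lemma holomorphic_transfer:
  assumes "vanishing f"
  shows "transfer f holomorphic_on sector \<theta>"
proof -
  have o: "open (sector \<theta>)" using angles by (simp add: open_sector)
  have "1 + w \<noteq> 0" if "w \<in> sector \<theta>" for w
  proof
    assume "1 + w = 0"
    then have "Re (1 + w) = 0" by simp
    then show False using that angles by (simp add: sector_iff)
  qed
  then show ?thesis
    unfolding transfer_def[abs_def] using segments sector_disjoint
    by (intro holomorphic_intros holomorphic_cauchy_linepath o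
        continuous_on_subset[OF continuous_on_ext[OF assms]]) auto
qed

text \<open>By the Cauchy formula on the triangle, only the contribution of the far side is left.\<close>

lemma transfer_diff:
  assumes f: "vanishing f" and w: "w \<in> sector \<theta>" "Re w < a"
  shows "f w - transfer f w =
    contour_integral (linepath Bm Bp) (\<lambda>z. ext f z * (w * (z + 1) / (z * (1 + w) * (z - w)))) / (2 * pi * \<i>)"
proof -
  have w': "Re w > 0" "\<bar>Im w\<bar> < tan \<theta> * Re w" using w(1) angles by (auto simp: sector_iff)
  then have "\<bar>Im w\<bar> < tan \<beta> * Re w" using mult_strict_right_mono[OF trig(5) w'(1)] by linarith
  then have int: "w \<in> interior T" using w' w(2) by (intro interior_T) auto
  have ce: "continuous_on T (ext f)" by (rule continuous_on_ext[OF f])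
  let ?g = "linepath 0 Bm +++ linepath Bm Bp +++ linepath Bp 0"
  have w_far: "w \<notin> closed_segment Bm Bp" using segment_far[of w] w(2) by auto
  have w_notin: "w \<notin> closed_segment 0 Bm" "w \<notin> closed_segment Bp 0"
    using sector_disjoint w(1) by auto
  have img: "path_image ?g = closed_segment 0 Bm \<union> (closed_segment Bm Bp \<union> closed_segment Bp 0)"
    by (simp add: path_image_join)
  have "w \<in> interior (convex hull {0, Bm, Bp})" using int by (simp add: hull_eq)
  from winding_number_triangle[OF this]
  have "winding_number ?g w = (if 0 < Im ((Bm - 0) * cnj (Bm - w)) then 1 else -1)" .
  \<comment> \<open>The sign that decides the orientation is that of the linear form vanishing on
    the lower side. It is positive at \<open>w\<close>, so the triangle is traversed
    counterclockwise.\<close>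
  moreover have "Im ((Bm - 0) * cnj (Bm - w)) = a * (Im w + tan \<beta> * Re w)"
    by (simp add: Bm_def algebra_simps)
  moreover have "a * (Im w + tan \<beta> * Re w) > 0"
    using \<open>\<bar>Im w\<bar> < tan \<beta> * Re w\<close> a_pos by (intro mult_pos_pos) auto
  ultimately have wn: "winding_number ?g w = 1" by simp
  have "((\<lambda>z. ext f z / (z - w)) has_contour_integral (2 * pi * \<i> * winding_number ?g w * ext f w)) ?g"
  proof (rule Cauchy_integral_formula_weak[OF convex_T, of "{}"])
    show "ext f field_differentiable at x" if "x \<in> interior T - {}" for x
    proof -
      have x: "x \<in> stolz_delta \<gamma>" using that interior_T_subset by auto
      obtain f' where "(f has_field_derivative f') (at x)"
        using f x open_stolz_delta holomorphic_on_imp_differentiable_at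
        unfolding vanishing_def field_differentiable_def by blast
      moreover have "x \<noteq> 0" using x zero_notin_stolz_delta by auto
      ultimately show ?thesis
        using has_field_derivative_transform_within_open[of f f' x "- {0}" "ext f"]
        by (auto simp: ext_def field_differentiable_def)
    qed
    show "path_image ?g \<subseteq> T - {w}"
      unfolding img using segments w_far w_notin by auto
  qed (use ce int in \<open>auto intro!: valid_path_join\<close>)
  moreover have "w \<noteq> 0" using w' by auto
  ultimately have tot: "((\<lambda>z. ext f z / (z - w)) has_contour_integral (2 * pi * \<i> * f w)) ?g"
    by (simp add: wn ext_def)
  have seg: "(\<lambda>z. ext f z / (z - w)) contour_integrable_on (linepath p q)"
    if "closed_segment p q \<subseteq> T" "w \<notin> closed_segment p q" for p q
    by (rule contour_integrable_continuous_linepath)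
      (use that in \<open>auto intro!: continuous_intros continuous_on_subset[OF ce]\<close>)
  have z0: "z \<noteq> 0 \<and> z \<noteq> w" if "z \<in> closed_segment Bm Bp" for z
    using segment_far[OF that] a_pos w(2) by auto
  have seg2: "(\<lambda>z. ext f z / z) contour_integrable_on (linepath Bm Bp)"
    by (rule contour_integrable_continuous_linepath)
      (use segments z0 in \<open>auto intro!: continuous_intros continuous_on_subset[OF ce]\<close>)
  let ?I = "\<lambda>p q. contour_integral (linepath p q) (\<lambda>z. ext f z / (z - w))"
  have "2 * pi * \<i> * f w = ?I 0 Bm + (?I Bm Bp + ?I Bp 0)"
    using tot seg[OF segments(1) w_notin(1)] seg[OF segments(2) w_notin(2)] seg[OF segments(3) w_far]
    by (subst contour_integral_unique[OF tot, symmetric]) (simp add: valid_path_join)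
  then have fw: "f w * (2 * pi * \<i>) = ?I 0 Bm + (?I Bm Bp + ?I Bp 0)"
    by (simp only: mult.commute)
  have tw: "transfer f w * (2 * pi * \<i>) =
      ?I 0 Bm + ?I Bp 0 + contour_integral (linepath Bm Bp) (\<lambda>z. ext f z / z) / (1 + w)"
    unfolding transfer_def by simp
  have "f w * (2 * pi * \<i>) - transfer f w * (2 * pi * \<i>) =
     ?I Bm Bp - contour_integral (linepath Bm Bp) (\<lambda>z. ext f z / z) / (1 + w)"
    unfolding fw tw by simp
  also have "\<dots> = contour_integral (linepath Bm Bp) (\<lambda>z. ext f z / (z - w) - ext f z / z / (1 + w))"
    unfolding contour_integral_div[OF seg2, symmetric]
    by (rule contour_integral_diff[symmetric]) (intro seg segments w_far contour_integrable_div seg2)+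
  also have "\<dots> = contour_integral (linepath Bm Bp) (\<lambda>z. ext f z * (w * (z + 1) / (z * (1 + w) * (z - w))))"
  proof (rule contour_integral_cong[OF refl])
    fix z assume "z \<in> path_image (linepath Bm Bp)"
    then have z: "z \<noteq> 0" "z - w \<noteq> 0" using z0[of z] by auto
    have w1: "1 + w \<noteq> 0" using w'(1) by (auto simp: complex_eq_iff)
    \<comment> \<open>The correction term cancels the kernel at \<open>w = 0\<close> and leaves a
      factor \<open>w\<close>; this is where the O(|w|) estimate comes from.\<close>
    have "1 / (z - w) - 1 / z / (1 + w) = w * (z + 1) / (z * (1 + w) * (z - w))"
      using z w1 by (simp add: divide_simps) (simp add: algebra_simps)
    then show "ext f z / (z - w) - ext f z / z / (1 + w) = ext f z * (w * (z + 1) / (z * (1 + w) * (z - w)))"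
      by (metis (no_types, opaque_lifting) divide_inverse inverse_eq_divide mult.assoc right_diff_distrib)
  qed
  finally show ?thesis
    by (simp add: field_simps)
qed

lemma M_ext:
  assumes M: "\<And>z. z \<in> stolz_delta \<gamma> \<Longrightarrow> (\<Sum>k\<in>I. (cmod (f k z))\<^sup>2) \<le> M\<^sup>2" and z: "z \<in> T"
  shows "(\<Sum>k\<in>I. (cmod (ext (f k) z))\<^sup>2) \<le> M\<^sup>2"
  using M[of z] T_subset z by (cases "z = 0") (auto simp: ext_def)

text \<open>On the far side |z| >= a, |z - w| >= a / 2, |1 + w| >= 1 and |z + 1| <= 2 bound the
  kernel by 4 |w| / a^2, to be multiplied by the length of that side; the added 1 ensures
  positivity.\<close>

definition "K1 = 4 / a\<^sup>2 * cmod (Bp - Bm) + 1"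

text \<open>Only the far side contributes, and the restriction on \<open>Re w\<close> keeps
  \<open>w\<close> at distance at least \<open>a / 2\<close> from it.\<close>

lemma transfer_diff_le:
  assumes "finite I" and f: "\<And>k. k \<in> I \<Longrightarrow> vanishing (f k)"
    and M: "\<And>z. z \<in> stolz_delta \<gamma> \<Longrightarrow> (\<Sum>k\<in>I. (cmod (f k z))\<^sup>2) \<le> M\<^sup>2" "M \<ge> 0"
    and w: "w \<in> sector \<theta>" "Re w < a / 2"
  shows "(\<Sum>k\<in>I. (cmod (f k w - transfer (f k) w))\<^sup>2) \<le> (K1 * M * cmod w)\<^sup>2"
proof -
  have w': "Re w > 0" using w(1) angles by (auto simp: sector_iff)
  let ?\<kappa> = "\<lambda>z. w * (z + 1) / (z * (1 + w) * (z - w))"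
  let ?J = "\<lambda>k. contour_integral (linepath Bm Bp) (\<lambda>z. ext (f k) z * ?\<kappa> z)"
  have w1: "cmod (1 + w) \<ge> 1" using complex_Re_le_cmod[of "1 + w"] w' by simp
  have seg: "Re z = a" "cmod z \<ge> a" "cmod (z - w) \<ge> a / 2" "cmod (z + 1) \<le> 2" "z \<noteq> 0" "z \<noteq> w"
    if z: "z \<in> closed_segment Bm Bp" for z
  proof -
    show r: "Re z = a" by (rule segment_far[OF z])
    show "cmod z \<ge> a" "cmod (z - w) \<ge> a / 2"
      using complex_Re_le_cmod[of z] complex_Re_le_cmod[of "z - w"] r w(2) by auto
    show "cmod (z + 1) \<le> 2"
      using norm_triangle_ineq[of z 1] T_norm_le[of z] segments z by auto
    show "z \<noteq> 0" "z \<noteq> w" using r a_pos w(2) by auto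
  qed
  have nz: "1 + w \<noteq> 0" using w1 by auto
  have "(\<Sum>k\<in>I. (cmod (?J k))\<^sup>2) \<le> ((4 / a\<^sup>2 * cmod w) * M * cmod (Bp - Bm))\<^sup>2"
  proof (rule linepath_square_sum_le[OF \<open>finite I\<close>])
    show "continuous_on (closed_segment Bm Bp) (ext (f k))" if "k \<in> I" for k
      using continuous_on_subset[OF continuous_on_ext[OF f[OF that]]] segments by auto
    show "continuous_on (closed_segment Bm Bp) ?\<kappa>"
      using seg nz by (intro continuous_intros) auto
    show "cmod (?\<kappa> z) \<le> 4 / a\<^sup>2 * cmod w" if z: "z \<in> closed_segment Bm Bp" for z
    proof -
      have "a * 1 * (a / 2) \<le> cmod z * cmod (1 + w) * cmod (z - w)"
        using seg[OF z] w1 a_pos by (intro mult_mono mult_nonneg_nonneg) auto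
      moreover have "cmod w * cmod (z + 1) \<le> cmod w * 2" using seg[OF z] by (intro mult_left_mono) auto
      ultimately have "cmod (?\<kappa> z) \<le> cmod w * 2 / (a * 1 * (a / 2))"
        unfolding norm_divide norm_mult using a_pos by (intro frac_le) auto
      also have "\<dots> = 4 / a\<^sup>2 * cmod w" by (simp add: power2_eq_square)
      finally show ?thesis .
    qed
    show "(\<Sum>k\<in>I. (cmod (ext (f k) z))\<^sup>2) \<le> M\<^sup>2" if "z \<in> closed_segment Bm Bp" for z
      using M_ext[where f = f, OF M(1)] segments that by blast
  qed
  also have "\<dots> \<le> (K1 * M * cmod w)\<^sup>2"
  proof (rule power_mono)
    have "(4 / a\<^sup>2 * cmod w) * M * cmod (Bp - Bm) = (4 / a\<^sup>2 * cmod (Bp - Bm)) * (M * cmod w)"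
      by (simp add: mult_ac)
    also have "\<dots> \<le> K1 * (M * cmod w)"
      unfolding K1_def using M(2) by (intro mult_right_mono) auto
    finally show "(4 / a\<^sup>2 * cmod w) * M * cmod (Bp - Bm) \<le> K1 * M * cmod w" by (simp add: mult_ac)
  qed (use M(2) a_pos in auto)
  finally have le: "(\<Sum>k\<in>I. (cmod (?J k))\<^sup>2) \<le> (K1 * M * cmod w)\<^sup>2" .
  have "(cmod (f k w - transfer (f k) w))\<^sup>2 \<le> (cmod (?J k))\<^sup>2" if "k \<in> I" for k
  proof (rule power_mono)
    have "f k w - transfer (f k) w = ?J k / (2 * pi * \<i>)"
      by (rule transfer_diff[OF f[OF that] w(1)]) (use w(2) a_pos in simp)
    then have "cmod (f k w - transfer (f k) w) = cmod (?J k) / (2 * pi)"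
      by (simp add: norm_divide norm_mult)
    also have "\<dots> \<le> cmod (?J k) / 1"
      using pi_gt3 by (intro divide_left_mono) auto
    finally show "cmod (f k w - transfer (f k) w) \<le> cmod (?J k)" by simp
  qed simp
  then show ?thesis using sum_mono[of I "\<lambda>k. (cmod (f k w - transfer (f k) w))\<^sup>2"] le
    by (meson order_trans)
qed

text \<open>One term per segment of the triangle: its length times the kernel bound, up to the
  factor \<open>1 / Re w\<close>. The factors 2 come from squaring sums.\<close>

definition "K2 = 2 * (cmod Bm + cmod Bp) / \<eta> + 2 * cmod (Bp - Bm) / a + 1"

lemma K_pos: "K1 > 0" "K2 > 0"
  using a_pos \<eta>_pos by (auto simp: K1_def K2_def intro!: add_nonneg_pos add_nonneg_nonneg)

text \<open>On the two sides the kernel is at most \<open>1 / (\<eta> * Re w)\<close>, and the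
  correction term is divided by \<open>1 + w\<close>, whose modulus exceeds \<open>Re w\<close>.
  This gives the decay at infinity.\<close>

lemma transfer_le:
  assumes "finite I" and f: "\<And>k. k \<in> I \<Longrightarrow> vanishing (f k)"
    and M: "\<And>z. z \<in> stolz_delta \<gamma> \<Longrightarrow> (\<Sum>k\<in>I. (cmod (f k z))\<^sup>2) \<le> M\<^sup>2" "M \<ge> 0"
    and w: "w \<in> sector \<theta>"
  shows "(\<Sum>k\<in>I. (cmod (transfer (f k) w))\<^sup>2) \<le> (K2 * M / Re w)\<^sup>2"
proof -
  have w': "Re w > 0" using w(1) angles by (auto simp: sector_iff)
  have ce: "continuous_on X (ext (f k))" if "k \<in> I" "X \<subseteq> T" for k X
    using continuous_on_subset[OF continuous_on_ext[OF f[OF that(1)]] that(2)] .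
  have side: "(\<Sum>k\<in>I. (cmod (contour_integral (linepath p q) (\<lambda>z. ext (f k) z * (1 / (z - w)))))\<^sup>2)
      \<le> ((1 / (\<eta> * Re w)) * M * cmod (q - p))\<^sup>2"
    if sub: "closed_segment p q \<subseteq> closed_segment 0 Bm \<union> closed_segment Bp 0" for p q
  proof (rule linepath_square_sum_le[OF \<open>finite I\<close>])
    have T: "closed_segment p q \<subseteq> T" using sub segments by blast
    show "continuous_on (closed_segment p q) (ext (f k))" if "k \<in> I" for k by (rule ce[OF that T])
    have "z \<noteq> w" if "z \<in> closed_segment p q" for z using sub that sector_disjoint w by blast
    then show "continuous_on (closed_segment p q) (\<lambda>z. 1 / (z - w))" by (intro continuous_intros) auto
    show "cmod (1 / (z - w)) \<le> 1 / (\<eta> * Re w)" if "z \<in> closed_segment p q" for z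
    proof -
      have "\<eta> * Re w \<le> cmod (z - w)" using side_distance[OF w] sub that by blast
      moreover have "0 < \<eta> * Re w" using w' \<eta>_pos by simp
      ultimately show ?thesis unfolding norm_divide norm_one by (intro frac_le) auto
    qed
    show "(\<Sum>k\<in>I. (cmod (ext (f k) z))\<^sup>2) \<le> M\<^sup>2" if "z \<in> closed_segment p q" for z
      using M_ext[where f = f, OF M(1)] T that by blast
  qed
  have far: "(\<Sum>k\<in>I. (cmod (contour_integral (linepath Bm Bp) (\<lambda>z. ext (f k) z * (1 / z))))\<^sup>2)
      \<le> ((1 / a) * M * cmod (Bp - Bm))\<^sup>2"
  proof (rule linepath_square_sum_le[OF \<open>finite I\<close>])
    have nz: "cmod z \<ge> a" if "z \<in> closed_segment Bm Bp" for z
      using complex_Re_le_cmod[of z] segment_far[OF that] by simp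
    show "continuous_on (closed_segment Bm Bp) (ext (f k))" if "k \<in> I" for k by (rule ce[OF that segments(3)])
    have "z \<noteq> 0" if "z \<in> closed_segment Bm Bp" for z using nz[OF that] a_pos by auto
    then show "continuous_on (closed_segment Bm Bp) (\<lambda>z. 1 / z)" by (intro continuous_intros) auto
    show "cmod (1 / z) \<le> 1 / a" if "z \<in> closed_segment Bm Bp" for z
      unfolding norm_divide norm_one using nz[OF that] a_pos by (intro divide_left_mono mult_pos_pos) auto
    show "(\<Sum>k\<in>I. (cmod (ext (f k) z))\<^sup>2) \<le> M\<^sup>2" if "z \<in> closed_segment Bm Bp" for z
      using M_ext[where f = f, OF M(1)] segments that by blast
  qed
  define x where "x = M / Re w"
  have x: "x \<ge> 0" using M(2) w' by (simp add: x_def)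
  let ?A = "\<lambda>k. contour_integral (linepath 0 Bm) (\<lambda>z. ext (f k) z * (1 / (z - w)))"
  let ?B = "\<lambda>k. contour_integral (linepath Bp 0) (\<lambda>z. ext (f k) z * (1 / (z - w)))"
  let ?E = "\<lambda>k. contour_integral (linepath Bm Bp) (\<lambda>z. ext (f k) z * (1 / z)) / (1 + w)"
  have A: "(\<Sum>k\<in>I. (cmod (?A k))\<^sup>2) \<le> (cmod Bm / \<eta> * x)\<^sup>2"
    using side[of 0 Bm] by (simp add: x_def mult_ac)
  have B: "(\<Sum>k\<in>I. (cmod (?B k))\<^sup>2) \<le> (cmod Bp / \<eta> * x)\<^sup>2"
    using side[of Bp 0] by (simp add: x_def mult_ac)
  have E: "(\<Sum>k\<in>I. (cmod (?E k))\<^sup>2) \<le> (cmod (Bp - Bm) / a * x)\<^sup>2"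
  proof -
    have w1: "cmod (1 + w) \<ge> Re w" using complex_Re_le_cmod[of "1 + w"] by simp
    have "(\<Sum>k\<in>I. (cmod (?E k))\<^sup>2) =
       (\<Sum>k\<in>I. (cmod (contour_integral (linepath Bm Bp) (\<lambda>z. ext (f k) z * (1 / z))))\<^sup>2) / (cmod (1 + w))\<^sup>2"
      by (simp add: norm_divide power_divide sum_divide_distrib)
    also have "\<dots> \<le> ((1 / a) * M * cmod (Bp - Bm))\<^sup>2 / (Re w)\<^sup>2"
      using far w1 w' by (intro frac_le power_mono) auto
    also have "\<dots> = (cmod (Bp - Bm) / a * x)\<^sup>2" by (simp add: x_def power_divide power_mult_distrib)
    finally show ?thesis .
  qed
  have "(\<Sum>k\<in>I. (cmod (transfer (f k) w))\<^sup>2) = (\<Sum>k\<in>I. (cmod (?A k + ?B k + ?E k))\<^sup>2) / (2 * pi)\<^sup>2"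
    by (simp add: transfer_def norm_divide norm_mult power_divide sum_divide_distrib)
  also have "\<dots> \<le> (\<Sum>k\<in>I. (cmod (?A k + ?B k + ?E k))\<^sup>2) / 1"
    by (intro divide_left_mono sum_nonneg one_le_power) (use pi_gt3 in simp_all)
  also have "\<dots> \<le> 2 * (\<Sum>k\<in>I. (cmod (?A k + ?B k))\<^sup>2) + 2 * (\<Sum>k\<in>I. (cmod (?E k))\<^sup>2)"
    unfolding div_by_1 by (rule sum_square_add_le)
  also have "\<dots> \<le> 2 * (2 * (cmod Bm / \<eta> * x)\<^sup>2 + 2 * (cmod Bp / \<eta> * x)\<^sup>2) + 2 * (cmod (Bp - Bm) / a * x)\<^sup>2"
    by (intro add_mono mult_left_mono order_trans[OF sum_square_add_le] A B E) auto
  also have "\<dots> \<le> (2 * (cmod Bm / \<eta> * x) + 2 * (cmod Bp / \<eta> * x) + 2 * (cmod (Bp - Bm) / a * x))\<^sup>2"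
  proof -
    have *: "4 * (p\<^sup>2 + q\<^sup>2) + 2 * r\<^sup>2 \<le> (2 * p + 2 * q + 2 * r)\<^sup>2" if "p \<ge> 0" "q \<ge> 0" "r \<ge> 0" for p q r :: real
    proof -
      have "(2 * p + 2 * q + 2 * r)\<^sup>2 = 4 * (p\<^sup>2 + q\<^sup>2) + 2 * r\<^sup>2 + (2 * r\<^sup>2 + 8 * (p * q) + 8 * (p * r) + 8 * (q * r))"
        by (simp add: power2_eq_square algebra_simps)
      moreover have "2 * r\<^sup>2 + 8 * (p * q) + 8 * (p * r) + 8 * (q * r) \<ge> 0" using that by simp
      ultimately show ?thesis by linarith
    qed
    show ?thesis
      using *[of "cmod Bm / \<eta> * x" "cmod Bp / \<eta> * x" "cmod (Bp - Bm) / a * x"] \<eta>_pos a_pos x by simp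
  qed
  also have "\<dots> \<le> (K2 * x)\<^sup>2"
  proof (rule power_mono)
    show "2 * (cmod Bm / \<eta> * x) + 2 * (cmod Bp / \<eta> * x) + 2 * (cmod (Bp - Bm) / a * x) \<le> K2 * x"
      using x by (simp add: K2_def algebra_simps add_divide_distrib)
  qed (use x \<eta>_pos a_pos in auto)
  finally show ?thesis by (simp add: x_def)
qed

end

lemma stolz_delta_subset_sector:
  assumes "0 < \<gamma>" "\<gamma> < pi / 2"
  shows "stolz_delta \<gamma> \<subseteq> sector \<gamma>"
proof
  fix z assume "z \<in> stolz_delta \<gamma>"
  then obtain t where t: "t \<in> {0<..1}" "cmod (z - of_real t) < t * sin \<gamma>"
    using stolz_delta_iff[OF assms] by blast
  \<comment> \<open>The strict inequality leaves room to pass to a smaller angle \<gamma>' with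
    \<open>sin \<gamma>' = v\<close>, for which the result on closed discs applies; the maximum
    keeps \<gamma>' positive.\<close>
  define v where "v = max (cmod (z - of_real t) / t) (sin (\<gamma> / 2))"
  have half: "sin (\<gamma> / 2) < sin \<gamma>" "sin (\<gamma> / 2) > 0"
    using assms by (auto intro: sin_strict_mono simp: sin_gt_zero2)
  have v: "sin (\<gamma> / 2) \<le> v" "v < sin \<gamma>"
    using t half by (auto simp: v_def field_simps)
  define \<gamma>' where "\<gamma>' = arcsin v"
  have v1: "- 1 \<le> v" "v \<le> 1" using v half sin_le_one[of \<gamma>] by linarith+
  have s: "sin \<gamma>' = v" using v1 by (simp add: \<gamma>'_def)
  have "\<gamma>' < \<gamma>"
    using arcsin_less_arcsin[of v "sin \<gamma>"] v v1 assms by (simp add: \<gamma>'_def arcsin_sin)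
  moreover have "arcsin (sin (\<gamma> / 2)) \<le> arcsin v"
    by (rule arcsin_le_arcsin) (use v v1 half in linarith)+
  then have "\<gamma>' > 0" using assms by (simp add: \<gamma>'_def arcsin_sin)
  moreover have "cmod (z - of_real t) \<le> t * sin \<gamma>'"
    using t by (auto simp: s v_def max_def field_simps)
  then have "z \<in> scaled_discs \<gamma>'" using t(1) by (auto simp: scaled_discs_def intro!: bexI[of _ t])
  moreover have "z \<noteq> 0"
  proof
    assume "z = 0"
    then have "t * 1 < t * sin \<gamma>" "t > 0" using t by auto
    then show False using sin_le_one[of \<gamma>] mult_left_mono[of "sin \<gamma>" 1 t] by linarith
  qed
  ultimately show "z \<in> sector \<gamma>"
    using scaled_discs_subset_closed_sector[of \<gamma>'] closed_sector_subset_sector[of \<gamma>' \<gamma>] assms by auto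
qed

text \<open>With the next lemma: the decay profile of \<open>H0_sector\<close> equals the smaller of
  x^s and x^(-s) up to a factor 2, so decay can be checked separately on both sides of 1.\<close>

lemma powr_quotient_ge:
  fixes x s :: real
  assumes "x > 0" "s > 0"
  shows "x \<le> 1 \<Longrightarrow> x powr s \<le> 2 * (x powr s / (1 + x powr (2 * s)))"
    "x \<ge> 1 \<Longrightarrow> x powr (- s) \<le> 2 * (x powr s / (1 + x powr (2 * s)))"
proof -
  have sq: "x powr (2 * s) = x powr s * x powr s" by (simp flip: powr_add)
  have p: "x powr s > 0" using assms by simp
  have q: "1 + x powr s * x powr s > 0" using p by (intro add_pos_pos mult_pos_pos) auto
  show "x powr s \<le> 2 * (x powr s / (1 + x powr (2 * s)))" if "x \<le> 1"
  proof -
    have "x powr s \<le> 1" using assms that by (simp add: powr_le1)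
    then have "x powr s * x powr s \<le> 1" using p by (intro mult_le_one) auto
    then have "x powr s * (1 + x powr s * x powr s) \<le> x powr s * 2"
      using p by (intro mult_left_mono) auto
    then have "x powr s \<le> x powr s * 2 / (1 + x powr s * x powr s)"
      by (simp only: pos_le_divide_eq[OF q])
    then show ?thesis unfolding sq by (simp add: mult.commute)
  qed
  show "x powr (- s) \<le> 2 * (x powr s / (1 + x powr (2 * s)))" if "x \<ge> 1"
  proof -
    have "1 \<le> x powr s" using assms that by (simp add: ge_one_powr_ge_zero)
    then have "1 * 1 \<le> x powr s * x powr s" by (intro mult_mono) auto
    then have "inverse (x powr s) * (1 + x powr s * x powr s) \<le> inverse (x powr s) * (2 * (x powr s * x powr s))"
      using p by (intro mult_left_mono) auto
    also have "\<dots> = x powr s * 2" using p by simp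
    finally have "inverse (x powr s) \<le> x powr s * 2 / (1 + x powr s * x powr s)"
      by (simp only: pos_le_divide_eq[OF q])
    then show ?thesis unfolding sq powr_minus by (simp add: mult.commute)
  qed
qed

lemma powr_quotient_le:
  fixes x s :: real
  assumes "x > 0"
  shows "x powr s / (1 + x powr (2 * s)) \<le> x powr s" "x powr s / (1 + x powr (2 * s)) \<le> x powr (- s)"
proof -
  have sq: "x powr (2 * s) = x powr s * x powr s" by (simp flip: powr_add)
  have p: "x powr s > 0" using assms by simp
  have q: "1 + x powr s * x powr s > 0" using p by (intro add_pos_pos mult_pos_pos) auto
  show "x powr s / (1 + x powr (2 * s)) \<le> x powr s"
    unfolding sq using p q by (simp add: field_simps)
  show "x powr s / (1 + x powr (2 * s)) \<le> x powr (- s)"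
    unfolding sq using p q by (simp add: powr_minus field_simps)
qed

context decomposition
begin

text \<open>\<open>2 * K2 / a\<close> bounds the transfer where \<open>Re w \<ge> a / 2\<close>, and
  \<open>2 + 2 * K1\<close> bounds it closer to the vertex; the sum covers both cases. In
  \<open>K4\<close>, the factor \<open>2 / a\<close> turns a bound away from the vertex into a
  multiple of |w|, and \<open>K1\<close> serves near it.\<close>

definition "K3 = 2 * K2 / a + 2 + 2 * K1"
definition "K4 = (2 + 2 * K3) * (2 / a) + K1"

lemma K34_pos: "K3 > 0" "K4 > 0"
proof -
  show "K3 > 0" using K_pos a_pos by (simp add: K3_def add_pos_pos)
  then show "K4 > 0" using K_pos a_pos by (simp add: K4_def add_pos_pos)
qed

lemma small_mem:
  assumes w: "w \<in> sector \<theta>" "Re w < a / 2"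
  shows "w \<in> stolz_delta \<gamma>" "cmod w \<le> 1"
proof -
  have w': "Re w > 0" "\<bar>Im w\<bar> < tan \<theta> * Re w" using w angles by (auto simp: sector_iff)
  have "cmod w \<le> Re w / cos \<theta>" using w' angles by (intro norm_le_Re) auto
  also have "\<dots> \<le> a / cos \<theta>" using w a_pos trig by (intro divide_right_mono) auto
  also have "\<dots> < cos \<gamma>" by (rule a_cos)
  finally have less: "cmod w < cos \<gamma>" .
  then show "cmod w \<le> 1" using cos_le_one[of \<gamma>] by linarith
  have "w \<in> sector \<gamma>" using w(1) angles by (auto simp: sector_def)
  then show "w \<in> stolz_delta \<gamma>" using less angles by (intro sector_near_zero) auto
qed

text \<open>The Cauchy integral estimate blows up at the vertex, so there the transferred function
  is written as the original one minus the small error.\<close>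

lemma transfer_bounded:
  assumes "finite I" and f: "\<And>k. k \<in> I \<Longrightarrow> vanishing (f k)"
    and M: "\<And>z. z \<in> stolz_delta \<gamma> \<Longrightarrow> (\<Sum>k\<in>I. (cmod (f k z))\<^sup>2) \<le> M\<^sup>2" "M \<ge> 0"
    and w: "w \<in> sector \<theta>"
  shows "(\<Sum>k\<in>I. (cmod (transfer (f k) w))\<^sup>2) \<le> (K3 * M)\<^sup>2"
proof (cases "Re w < a / 2")
  case True
  have "(\<Sum>k\<in>I. (cmod (transfer (f k) w))\<^sup>2) = (\<Sum>k\<in>I. (cmod (f k w + (- (f k w - transfer (f k) w))))\<^sup>2)"
    by simp
  also have "\<dots> \<le> 2 * (\<Sum>k\<in>I. (cmod (f k w))\<^sup>2) + 2 * (\<Sum>k\<in>I. (cmod (- (f k w - transfer (f k) w)))\<^sup>2)"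
    by (rule sum_square_add_le)
  also have "\<dots> \<le> 2 * M\<^sup>2 + 2 * (K1 * M * cmod w)\<^sup>2"
    using M(1)[OF small_mem(1)[OF w True]] transfer_diff_le[OF \<open>finite I\<close> f M w True]
    unfolding norm_minus_cancel by (intro add_mono mult_left_mono) auto
  also have "\<dots> \<le> 2 * M\<^sup>2 + 2 * (K1 * M * 1)\<^sup>2"
    using small_mem(2)[OF w True] K_pos M(2) by (intro add_mono mult_left_mono power_mono) auto
  also have "\<dots> \<le> (2 * M + 2 * K1 * M)\<^sup>2"
    using K_pos M(2) by (simp add: power2_eq_square algebra_simps)
  also have "\<dots> \<le> (K3 * M)\<^sup>2"
    using K_pos M(2) a_pos by (intro power_mono) (auto simp: K3_def algebra_simps)
  finally show ?thesis .
next
  case False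
  have "(\<Sum>k\<in>I. (cmod (transfer (f k) w))\<^sup>2) \<le> (K2 * M / Re w)\<^sup>2"
    by (rule transfer_le[OF \<open>finite I\<close> f M w])
  also have "\<dots> \<le> (K2 * M / (a / 2))\<^sup>2"
    using False K_pos M(2) a_pos by (intro power_mono divide_left_mono) auto
  also have "\<dots> \<le> (K3 * M)\<^sup>2"
    using K_pos M(2) a_pos by (intro power_mono) (auto simp: K3_def algebra_simps)
  finally show ?thesis .
qed

text \<open>The contour runs around the whole petal, so the O(|w|) estimate is needed beyond the
  triangle too. Away from the vertex it says no more than that both functions are bounded.\<close>

lemma transfer_diff_bounded:
  assumes "finite I" and f: "\<And>k. k \<in> I \<Longrightarrow> vanishing (f k)"
    and M: "\<And>z. z \<in> stolz_delta \<gamma> \<Longrightarrow> (\<Sum>k\<in>I. (cmod (f k z))\<^sup>2) \<le> M\<^sup>2" "M \<ge> 0"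
    and w: "w \<in> sector \<theta>" "w \<in> stolz_delta \<gamma>"
  shows "(\<Sum>k\<in>I. (cmod (f k w - transfer (f k) w))\<^sup>2) \<le> (K4 * M * cmod w)\<^sup>2"
proof (cases "Re w < a / 2")
  case True
  have "(\<Sum>k\<in>I. (cmod (f k w - transfer (f k) w))\<^sup>2) \<le> (K1 * M * cmod w)\<^sup>2"
    by (rule transfer_diff_le[OF \<open>finite I\<close> f M w(1) True])
  also have "\<dots> \<le> (K4 * M * cmod w)\<^sup>2"
  proof (rule power_mono)
    have "K1 \<le> K4" using K34_pos a_pos by (simp add: K4_def)
    then show "K1 * M * cmod w \<le> K4 * M * cmod w" using M(2) by (intro mult_right_mono) auto
  qed (use K_pos M(2) in auto)
  finally show ?thesis .
next
  case False
  then have w2: "1 \<le> 2 / a * cmod w"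
    using complex_Re_le_cmod[of w] a_pos by (simp add: field_simps)
  have "(\<Sum>k\<in>I. (cmod (f k w - transfer (f k) w))\<^sup>2) = (\<Sum>k\<in>I. (cmod (f k w + (- transfer (f k) w)))\<^sup>2)"
    by simp
  also have "\<dots> \<le> 2 * (\<Sum>k\<in>I. (cmod (f k w))\<^sup>2) + 2 * (\<Sum>k\<in>I. (cmod (- transfer (f k) w))\<^sup>2)"
    by (rule sum_square_add_le)
  also have "\<dots> \<le> 2 * M\<^sup>2 + 2 * (K3 * M)\<^sup>2"
    using M(1)[OF w(2)] transfer_bounded[OF \<open>finite I\<close> f M w(1)]
    unfolding norm_minus_cancel by (intro add_mono mult_left_mono) auto
  also have "\<dots> \<le> (2 * M + 2 * K3 * M)\<^sup>2"
    using K34_pos M(2) by (simp add: power2_eq_square algebra_simps)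
  also have "\<dots> \<le> (K4 * M * cmod w)\<^sup>2"
  proof (rule power_mono)
    have "2 * M + 2 * K3 * M = ((2 + 2 * K3) * M) * 1" by (simp add: algebra_simps)
    also have "\<dots> \<le> ((2 + 2 * K3) * M) * (2 / a * cmod w)"
      using w2 K34_pos M(2) by (intro mult_left_mono) auto
    also have "\<dots> = ((2 + 2 * K3) * (2 / a)) * (M * cmod w)" by (simp add: mult_ac)
    also have "\<dots> \<le> K4 * (M * cmod w)"
      using K_pos M(2) by (intro mult_right_mono) (auto simp: K4_def)
    finally show "2 * M + 2 * K3 * M \<le> K4 * M * cmod w" by (simp add: mult_ac)
  qed (use K34_pos M(2) in auto)
  finally show ?thesis .
qed

lemma transfer_decay:
  assumes f: "vanishing f" and bdd: "\<And>z. z \<in> stolz_delta \<gamma> \<Longrightarrow> cmod (f z) \<le> M"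
  shows "\<exists>c>0. \<exists>s>0. \<forall>w\<in>sector \<theta>. cmod (transfer f w) \<le> c * (cmod w powr s / (1 + cmod w powr (2 * s)))"
proof -
  obtain c s0 where c: "c > 0" "s0 > 0"
    and le: "\<And>z. z \<in> stolz_delta \<gamma> \<Longrightarrow> cmod (f z) \<le> c * cmod z powr s0"
    using f by (auto simp: vanishing_def)
  \<comment> \<open>The exponent is capped at 1, because the error is only O(|w|) at the vertex and
    the transfer is only O(1 / |w|) at infinity.\<close>
  define s where "s = min s0 1"
  have s: "0 < s" "s \<le> s0" "s \<le> 1" using c by (auto simp: s_def)
  \<comment> \<open>A one-point index set specialises the square sum lemmas to a single
    function.\<close>
  have M: "(\<Sum>k\<in>{()}. (cmod (f z))\<^sup>2) \<le> \<bar>M\<bar>\<^sup>2" if "z \<in> stolz_delta \<gamma>" for z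
    using bdd[OF that] by (simp add: power_mono order_trans[OF _ abs_ge_self])
  have near: "cmod (f w - transfer f w) \<le> K1 * \<bar>M\<bar> * cmod w" if "w \<in> sector \<theta>" "Re w < a / 2" for w
  proof -
    have "(\<Sum>k\<in>{()}. (cmod (f w - transfer f w))\<^sup>2) \<le> (K1 * \<bar>M\<bar> * cmod w)\<^sup>2"
      by (rule transfer_diff_le[where f = "\<lambda>_. f"]) (use f M that in auto)
    then have "(cmod (f w - transfer f w))\<^sup>2 \<le> (K1 * \<bar>M\<bar> * cmod w)\<^sup>2" by simp
    then show ?thesis by (rule power2_le_imp_le) (use K_pos in simp)
  qed
  have mid: "cmod (transfer f w) \<le> K3 * \<bar>M\<bar>" if "w \<in> sector \<theta>" for w
  proof -
    have "(\<Sum>k\<in>{()}. (cmod (transfer f w))\<^sup>2) \<le> (K3 * \<bar>M\<bar>)\<^sup>2"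
      by (rule transfer_bounded[where f = "\<lambda>_. f"]) (use f M that in auto)
    then have "(cmod (transfer f w))\<^sup>2 \<le> (K3 * \<bar>M\<bar>)\<^sup>2" by simp
    then show ?thesis by (rule power2_le_imp_le) (use K34_pos in simp)
  qed
  have far: "cmod (transfer f w) \<le> K2 * \<bar>M\<bar> / Re w" if "w \<in> sector \<theta>" for w
  proof -
    have "(\<Sum>k\<in>{()}. (cmod (transfer f w))\<^sup>2) \<le> (K2 * \<bar>M\<bar> / Re w)\<^sup>2"
      by (rule transfer_le[where f = "\<lambda>_. f"]) (use f M that in auto)
    then have "(cmod (transfer f w))\<^sup>2 \<le> (K2 * \<bar>M\<bar> / Re w)\<^sup>2" by simp
    moreover have "Re w > 0" using that angles by (simp add: sector_iff)
    then have "0 \<le> K2 * \<bar>M\<bar> / Re w" using K_pos(2) by simp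
    ultimately show ?thesis by (rule power2_le_imp_le)
  qed
  define B where "B = c + K1 * \<bar>M\<bar> + K3 * \<bar>M\<bar> * (2 / a) + K2 * \<bar>M\<bar> / cos \<theta>"
  have nn: "K1 * \<bar>M\<bar> \<ge> 0" "K3 * \<bar>M\<bar> * (2 / a) \<ge> 0" "K2 * \<bar>M\<bar> / cos \<theta> \<ge> 0" "K2 * \<bar>M\<bar> \<ge> 0" "K3 * \<bar>M\<bar> \<ge> 0"
    using K_pos K34_pos a_pos trig(2) by simp_all
  have B: "B > 0" unfolding B_def using c nn by linarith
  have "cmod (transfer f w) \<le> (2 * B) * (cmod w powr s / (1 + cmod w powr (2 * s)))" if w: "w \<in> sector \<theta>" for w
  proof -
    have w': "Re w > 0" "\<bar>Im w\<bar> < tan \<theta> * Re w" using w angles by (auto simp: sector_iff)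
    then have wp: "cmod w > 0" by auto
    consider "Re w < a / 2" | "Re w \<ge> a / 2" "cmod w \<le> 1" | "cmod w \<ge> 1" by linarith
    then show ?thesis
    proof cases
      case 1
      have m: "w \<in> stolz_delta \<gamma>" "cmod w \<le> 1" using small_mem[OF w 1] by auto
      have p0: "cmod w powr s0 \<le> cmod w powr s" "cmod w \<le> cmod w powr s"
        using powr_mono'[of s s0 "cmod w"] powr_mono'[of s 1 "cmod w"] s m(2) wp by auto
      have "cmod (transfer f w) \<le> cmod (f w) + cmod (f w - transfer f w)"
        using norm_triangle_ineq4[of "f w" "f w - transfer f w"] by simp
      also have "\<dots> \<le> c * cmod w powr s0 + K1 * \<bar>M\<bar> * cmod w"
        using le[OF m(1)] near[OF w 1] by simp
      also have "\<dots> \<le> c * cmod w powr s + K1 * \<bar>M\<bar> * cmod w powr s"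
        using p0 c nn by (intro add_mono mult_left_mono) auto
      also have "\<dots> = (c + K1 * \<bar>M\<bar>) * cmod w powr s" by (simp add: algebra_simps)
      also have "\<dots> \<le> B * cmod w powr s"
        unfolding B_def using nn by (intro mult_right_mono) auto
      also have "\<dots> \<le> B * (2 * (cmod w powr s / (1 + cmod w powr (2 * s))))"
        using B powr_quotient_ge(1)[OF wp s(1) m(2)] by (intro mult_left_mono) auto
      finally show ?thesis by (simp add: mult_ac)
    next
      case 2
      have "1 \<le> 2 / a * cmod w"
        using 2 complex_Re_le_cmod[of w] a_pos by (simp add: field_simps)
      also have "\<dots> \<le> 2 / a * cmod w powr s"
        using powr_mono'[of s 1 "cmod w"] s 2 wp a_pos by (intro mult_left_mono) auto
      finally have one: "1 \<le> 2 / a * cmod w powr s" .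
      have "cmod (transfer f w) \<le> K3 * \<bar>M\<bar> * 1" using mid[OF w] by simp
      also have "\<dots> \<le> K3 * \<bar>M\<bar> * (2 / a * cmod w powr s)"
        using one nn by (intro mult_left_mono) auto
      also have "\<dots> = (K3 * \<bar>M\<bar> * (2 / a)) * cmod w powr s" by (simp add: mult_ac)
      also have "\<dots> \<le> B * cmod w powr s"
        unfolding B_def using nn c by (intro mult_right_mono) auto
      also have "\<dots> \<le> B * (2 * (cmod w powr s / (1 + cmod w powr (2 * s))))"
        using B powr_quotient_ge(1)[OF wp s(1)] 2 by (intro mult_left_mono) auto
      finally show ?thesis by (simp add: mult_ac)
    next
      case 3
      have "cmod w \<le> Re w / cos \<theta>" using w' angles by (intro norm_le_Re) auto
      then have "1 / Re w \<le> 1 / cos \<theta> / cmod w" using w' trig wp by (simp add: field_simps)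
      also have "1 / cmod w = cmod w powr (- 1)" using wp by (simp add: powr_minus divide_inverse)
      then have "1 / cos \<theta> / cmod w = 1 / cos \<theta> * cmod w powr (- 1)" by simp
      also have "\<dots> \<le> 1 / cos \<theta> * cmod w powr (- s)"
        using 3 s trig by (intro mult_left_mono powr_mono) auto
      finally have r: "1 / Re w \<le> 1 / cos \<theta> * cmod w powr (- s)" .
      have "cmod (transfer f w) \<le> (K2 * \<bar>M\<bar>) * (1 / Re w)" using far[OF w] by simp
      also have "\<dots> \<le> (K2 * \<bar>M\<bar>) * (1 / cos \<theta> * cmod w powr (- s))"
        using r nn by (intro mult_left_mono) auto
      also have "\<dots> = (K2 * \<bar>M\<bar> / cos \<theta>) * cmod w powr (- s)" by simp
      also have "\<dots> \<le> B * cmod w powr (- s)"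
        unfolding B_def using nn c by (intro mult_right_mono) auto
      also have "\<dots> \<le> B * (2 * (cmod w powr s / (1 + cmod w powr (2 * s))))"
        using B powr_quotient_ge(2)[OF wp s(1) 3] by (intro mult_left_mono) auto
      finally show ?thesis by (simp add: mult_ac)
    qed
  qed
  then show ?thesis using B s(1) by (intro exI[of _ "2 * B"] exI[of _ s] conjI) auto
qed

end

section \<open>The functional calculi of an \<open>n\<close>-Ritt operator\<close>

lemma rot_eq_cis: "rot n j = cis (2 * pi * real j / real n)"
  by (simp add: rot_def cis_conv_exp mult_ac)

lemma norm_rot [simp]: "cmod (rot n j) = 1"
  by (simp add: rot_eq_cis)

lemma rot_nonzero [simp]: "rot n j \<noteq> 0"
  by (simp add: rot_eq_cis)

text \<open>The arguments of \<open>z\<close> and \<open>z'\<close> differ by an integer multiple of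
  2 pi / n, namely by the factor \<open>m * int n + (int i - int j)\<close>, and by less than 2 pi /
  n in modulus. So the integer is 0, and |i - j| < n forces \<open>m = 0\<close>.\<close>

lemma rot_mult_inj:
  assumes n: "n > 0" and ij: "i < n" "j < n" and z: "z \<in> sector (pi / n)" "z' \<in> sector (pi / n)"
    and eq: "rot n j * z = rot n i * z'"
  shows "i = j"
proof -
  have polar: "u = of_real (cmod u) * cis (Arg u)" "cmod u > 0" "\<bar>Arg u\<bar> < pi / n" if "u \<in> sector (pi / n)" for u
    using that rcis_cmod_Arg[of u] by (auto simp: sector_def rcis_def)
  define a b where "a = Arg z" and "b = Arg z'"
  have ab: "\<bar>a\<bar> < pi / n" "\<bar>b\<bar> < pi / n" using polar z by (auto simp: a_def b_def)
  have nn: "cmod z = cmod z'" using arg_cong[OF eq, of cmod] by (simp add: norm_mult)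
  have pz: "z = of_real (cmod z) * cis a" "z' = of_real (cmod z) * cis b" "cmod z > 0"
    using polar[OF z(1)] polar[OF z(2)] nn by (simp_all add: a_def b_def)
  have "rot n j * (of_real (cmod z) * cis a) = rot n i * (of_real (cmod z) * cis b)"
    using eq pz by metis
  then have "cis (2 * pi * real j / real n + a) = cis (2 * pi * real i / real n + b)"
    using pz(3) by (simp add: rot_eq_cis cis_mult[symmetric])
  then have "sin (2 * pi * real j / real n + a) = sin (2 * pi * real i / real n + b)"
    "cos (2 * pi * real j / real n + a) = cos (2 * pi * real i / real n + b)"
    by (simp_all add: complex_eq_iff)
  then obtain m :: int where m: "2 * pi * real j / real n + a = 2 * pi * real i / real n + b + 2 * pi * m"
    using sin_cos_eq_iff by blast
  have "\<bar>a - b\<bar> < 2 * pi / n" using ab by linarith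
  moreover have "a - b = (2 * pi / n) * (m * int n + (int i - int j))"
    using m n by (simp add: field_simps)
  ultimately have "\<bar>(2 * pi / n) * (m * int n + (int i - int j))\<bar> < 2 * pi / n * 1" by simp
  then have "(2 * pi / n) * \<bar>real_of_int (m * int n + (int i - int j))\<bar> < (2 * pi / n) * 1"
    by (simp add: abs_mult)
  then have "\<bar>real_of_int (m * int n + (int i - int j))\<bar> < 1"
    using n by (subst (asm) mult_less_cancel_left_pos) auto
  then have z0: "m * int n + (int i - int j) = 0" by linarith
  have "m = 0"
  proof (rule ccontr)
    assume "m \<noteq> 0"
    then have "\<bar>m\<bar> * int n \<ge> 1 * int n" by (intro mult_right_mono) auto
    moreover have "\<bar>m\<bar> * int n = \<bar>int j - int i\<bar>" using z0 by (simp add: abs_mult[symmetric, of m "int n", simplified] algebra_simps)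
    ultimately show False using ij by linarith
  qed
  then show ?thesis using z0 by simp
qed

lemma closure_n_stolz_subset:
  assumes "0 < \<alpha>" "\<alpha> < pi / 2"
  shows "closure (n_stolz n \<alpha>) \<subseteq> {w. \<exists>j<n. (1 - w) / rot n j \<in> scaled_discs \<alpha>}"
proof (rule closure_minimal)
  show "n_stolz n \<alpha> \<subseteq> {w. \<exists>j<n. (1 - w) / rot n j \<in> scaled_discs \<alpha>}"
  proof
    fix w assume "w \<in> n_stolz n \<alpha>"
    then obtain j z where "j < n" "z \<in> stolz_delta \<alpha>" "w = 1 - rot n j * z" by (auto simp: n_stolz_def)
    then have "j < n \<and> (1 - w) / rot n j \<in> scaled_discs \<alpha>" using stolz_delta_subset_scaled_discs[OF assms] by auto
    then show "w \<in> {w. \<exists>j<n. (1 - w) / rot n j \<in> scaled_discs \<alpha>}" by blast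
  qed
  have "{w. \<exists>j<n. (1 - w) / rot n j \<in> scaled_discs \<alpha>} = (\<Union>j<n. (\<lambda>w. (1 - w) / rot n j) -` scaled_discs \<alpha>)" by auto
  also have "closed \<dots>"
    by (intro closed_UN finite_lessThan ballI closed_vimage[OF closed_scaled_discs] continuous_intros) simp
  finally show "closed {w. \<exists>j<n. (1 - w) / rot n j \<in> scaled_discs \<alpha>}" .
qed

lemma closure_n_sector_subset:
  assumes "0 < \<omega>" "\<omega> < pi / 2"
  shows "closure (n_sector n \<omega>) \<subseteq> {w. \<exists>j<n. w / rot n j \<in> closed_sector \<omega>}"
proof (rule closure_minimal)
  show "n_sector n \<omega> \<subseteq> {w. \<exists>j<n. w / rot n j \<in> closed_sector \<omega>}"
  proof
    fix w assume "w \<in> n_sector n \<omega>"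
    then obtain j z where "j < n" "z \<in> sector \<omega>" "w = rot n j * z" by (auto simp: n_sector_def)
    then have "j < n \<and> w / rot n j \<in> closed_sector \<omega>" using sector_subset_closed_sector[OF assms] by auto
    then show "w \<in> {w. \<exists>j<n. w / rot n j \<in> closed_sector \<omega>}" by blast
  qed
  have "{w. \<exists>j<n. w / rot n j \<in> closed_sector \<omega>} = (\<Union>j<n. (\<lambda>w. w / rot n j) -` closed_sector \<omega>)" by auto
  also have "closed \<dots>"
    by (intro closed_UN finite_lessThan ballI closed_vimage[OF closed_sector_closed] continuous_intros) simp
  finally show "closed {w. \<exists>j<n. w / rot n j \<in> closed_sector \<omega>}" .
qed

lemma pi_div_le_half:
  assumes "n > (1 :: nat)"
  shows "pi / n \<le> pi / 2" "pi / n > 0"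
proof -
  show "pi / n \<le> pi / 2" by (rule divide_left_mono) (use assms in auto)
  show "pi / n > 0" using assms by simp
qed

lemma closed_sector_subset_sector_pi:
  assumes "n > (1 :: nat)" "0 < \<omega>" "\<omega> < pi / n"
  shows "closed_sector \<omega> - {0} \<subseteq> sector (pi / n)"
proof -
  obtain \<theta> where \<theta>: "\<omega> < \<theta>" "\<theta> < pi / n" using dense[OF assms(3)] by blast
  then have "\<theta> < pi / 2" using pi_div_le_half(1)[OF assms(1)] by linarith
  have "closed_sector \<omega> - {0} \<subseteq> sector \<theta>" by (rule closed_sector_subset_sector) (use assms \<theta> \<open>\<theta> < pi / 2\<close> in auto)
  also have "sector \<theta> \<subseteq> sector (pi / n)" using \<theta> by (auto simp: sector_def)
  finally show ?thesis .
qed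

text \<open>The rotated sectors of half-angle pi / n are pairwise disjoint, so a point of the
  \<open>j\<close>-th one can only be met by the \<open>j\<close>-th petal.\<close>

lemma not_mem_closure_n_stolz:
  assumes n: "n > 1" and \<alpha>: "0 < \<alpha>" "\<alpha> < pi / n" and j: "j < n" and z: "z \<in> sector (pi / n)" "z \<notin> scaled_discs \<alpha>"
  shows "1 - rot n j * z \<notin> closure (n_stolz n \<alpha>)"
proof
  have \<alpha>2: "\<alpha> < pi / 2" using \<alpha> pi_div_le_half[OF n] by linarith
  assume "1 - rot n j * z \<in> closure (n_stolz n \<alpha>)"
  then obtain i where i: "i < n" "(rot n j * z) / rot n i \<in> scaled_discs \<alpha>"
    using closure_n_stolz_subset[OF \<alpha>(1) \<alpha>2] by force
  let ?p = "(rot n j * z) / rot n i"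
  have "z \<noteq> 0" using z(1) by (auto simp: sector_def)
  then have "?p \<in> closed_sector \<alpha> - {0}" using i(2) scaled_discs_subset_closed_sector[OF \<alpha>(1) \<alpha>2] by auto
  then have "?p \<in> sector (pi / n)" using closed_sector_subset_sector_pi[OF n \<alpha>] by blast
  moreover have "rot n j * z = rot n i * ?p" by simp
  ultimately have "i = j" using rot_mult_inj[of n i j z ?p] n j i(1) z(1) by simp
  then show False using i(2) z(2) by simp
qed

lemma not_mem_closure_n_sector:
  assumes n: "n > 1" and \<omega>: "0 < \<omega>" "\<omega> < pi / n" and j: "j < n" and z: "z \<in> sector (pi / n)" "z \<notin> closed_sector \<omega>"
  shows "rot n j * z \<notin> closure (n_sector n \<omega>)"
proof
  have \<omega>2: "\<omega> < pi / 2" using \<omega> pi_div_le_half[OF n] by linarith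
  assume "rot n j * z \<in> closure (n_sector n \<omega>)"
  then obtain i where i: "i < n" "(rot n j * z) / rot n i \<in> closed_sector \<omega>"
    using closure_n_sector_subset[OF \<omega>(1) \<omega>2] by force
  let ?p = "(rot n j * z) / rot n i"
  have "z \<noteq> 0" using z(1) by (auto simp: sector_def)
  then have "?p \<in> closed_sector \<omega> - {0}" using i(2) by auto
  then have "?p \<in> sector (pi / n)" using closed_sector_subset_sector_pi[OF n \<omega>] by blast
  moreover have "rot n j * z = rot n i * ?p" by simp
  ultimately have "i = j" using rot_mult_inj[of n i j z ?p] n j i(1) z(1) by simp
  then show False using i(2) z(2) by simp
qed

lemma scaled_discs_mono:
  assumes "0 < \<alpha>" "\<alpha> \<le> \<beta>" "\<beta> < pi / 2"
  shows "scaled_discs \<alpha> \<subseteq> scaled_discs \<beta>"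
proof
  fix z assume "z \<in> scaled_discs \<alpha>"
  then obtain t where t: "t \<in> {0..1}" "cmod (z - of_real t) \<le> t * sin \<alpha>" by (auto simp: scaled_discs_def)
  have "sin \<alpha> \<le> sin \<beta>" using sin_strict_mono[of \<alpha> \<beta>] assms by (cases "\<alpha> = \<beta>") auto
  then have "t * sin \<alpha> \<le> t * sin \<beta>" using t by (intro mult_left_mono) auto
  then show "z \<in> scaled_discs \<beta>" using t unfolding scaled_discs_def by (intro CollectI bexI[of _ t]) linarith+
qed

lemma connected_scaled_discs_Int_closed_sector: "connected (scaled_discs \<alpha> \<inter> closed_sector \<omega>)" "connected (scaled_discs \<alpha>)" "connected (- sector \<theta>)"
proof -
  \<comment> \<open>All three sets are star-shaped about the vertex.\<close>
  have conn: "connected X" if X: "0 \<in> X" "\<And>z u. z \<in> X \<Longrightarrow> 0 < u \<Longrightarrow> u \<le> 1 \<Longrightarrow> of_real u * z \<in> X" for X :: "complex set"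
  proof (rule starlike_imp_connected)
    have "closed_segment 0 z \<subseteq> X" if z: "z \<in> X" for z
    proof
      fix y assume "y \<in> closed_segment 0 z"
      then obtain u where u: "0 \<le> u" "u \<le> 1" "y = of_real u * z"
        by (auto simp: in_segment scaleR_conv_of_real)
      then show "y \<in> X" using X(2)[OF z, of u] X(1) by (cases "u = 0") auto
    qed
    then show "starlike X" using X(1) unfolding starlike_def by blast
  qed
  have z0: "0 \<in> closed_sector \<omega>" by (simp add: closed_sector_def)
  show "connected (scaled_discs \<alpha> \<inter> closed_sector \<omega>)"
    by (rule conn) (use zero_mem_scaled_discs z0 scaled_discs_scale closed_sector_scale in auto)
  show "connected (scaled_discs \<alpha>)"
    by (rule conn) (use zero_mem_scaled_discs scaled_discs_scale in auto)
  show "connected (- sector \<theta>)"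
    by (rule conn) (auto simp: sector_def)
qed

locale Ritt_op =
  fixes n :: nat and \<alpha>0 :: real and T :: "'a :: complex_banach \<Rightarrow>\<^sub>L 'a"
  assumes n: "n > 1" and T: "n_Ritt_type n \<alpha>0 T"
begin

definition A :: "'a \<Rightarrow>\<^sub>L 'a" where "A = id_blinfun - T"

definition RA :: "complex \<Rightarrow> ('a \<Rightarrow>\<^sub>L 'a)" where "RA = resolvent UNIV (blinfun_apply A)"

abbreviation \<sigma>A :: "complex set" where "\<sigma>A \<equiv> spectrum UNIV (blinfun_apply A)"

lemma \<alpha>0: "0 < \<alpha>0" "\<alpha>0 < pi / n" "\<alpha>0 < pi / 2"
proof -
  show a: "0 < \<alpha>0" "\<alpha>0 < pi / n" using T by (auto simp: n_Ritt_type_def)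
  show "\<alpha>0 < pi / 2" using a(2) pi_div_le_half(1)[OF n] by linarith
qed

lemma acute: "\<nu> < pi / n \<Longrightarrow> \<nu> < pi / 2"
  using pi_div_le_half[OF n] by linarith

lemma linear_A: "complex_linear_on UNIV (blinfun_apply A)"
  using T unfolding n_Ritt_type_def complex_linear_on_def A_def
  by (simp add: blinfun.diff_left scaleC_diff_right)

lemma spectrum_A: "z \<in> \<sigma>A \<longleftrightarrow> 1 - z \<in> spectrum UNIV (blinfun_apply T)"
proof -
  have "(\<exists>R. is_resolvent UNIV (blinfun_apply A) z R) \<longleftrightarrow> (\<exists>R. is_resolvent UNIV (blinfun_apply T) (1 - z) R)"
    unfolding A_def is_resolvent_id_minus by (metis minus_minus)
  then show ?thesis by (simp only: spectrum_def mem_Collect_eq)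
qed

lemma resolvent_T: "z \<notin> \<sigma>A \<Longrightarrow> resolvent UNIV (blinfun_apply T) (1 - z) = - RA z"
  using is_resolvent_resolvent[of z UNIV "blinfun_apply A"]
  by (intro resolvent_eqI) (simp add: A_def RA_def is_resolvent_id_minus)

lemma spectrum_T_subset: "spectrum UNIV (blinfun_apply T) \<subseteq> closure (n_stolz n \<alpha>0)"
  using T by (simp add: n_Ritt_type_def)

lemma rot_not_mem_spectrum:
  assumes "j < n" "z \<in> sector (pi / n)" "z \<notin> scaled_discs \<alpha>0"
  shows "rot n j * z \<notin> \<sigma>A"
  using not_mem_closure_n_stolz[OF n \<alpha>0(1,2) assms] spectrum_T_subset spectrum_A by blast

text \<open>The Ritt bound holds off the bounded petal, not merely off the cone around it. It
  therefore also controls \<open>RA\<close> near the axis far from the vertex, which is what closing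
  the contours at infinity needs.\<close>

lemma RA_bound_scaled_discs:
  assumes \<nu>: "\<alpha>0 < \<nu>" "\<nu> < pi / n"
  obtains C where "C \<ge> 0"
    "\<And>j z. j < n \<Longrightarrow> z \<in> sector (pi / n) \<Longrightarrow> z \<notin> scaled_discs \<nu> \<Longrightarrow> norm (RA (rot n j * z)) \<le> C / cmod z"
proof -
  have "bounded {(z - 1) *\<^sub>C resolvent UNIV (blinfun_apply T) z | z. z \<notin> closure (n_stolz n \<nu>)}"
    using T \<nu> by (auto simp: n_Ritt_type_def)
  then obtain C where C: "\<And>z. z \<notin> closure (n_stolz n \<nu>) \<Longrightarrow> norm ((z - 1) *\<^sub>C resolvent UNIV (blinfun_apply T) z) \<le> C"
    unfolding bounded_iff by blast
  have "norm (RA (rot n j * z)) \<le> \<bar>C\<bar> / cmod z" if z: "j < n" "z \<in> sector (pi / n)" "z \<notin> scaled_discs \<nu>" for j z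
  proof -
    have "z \<noteq> 0" using z(2) by (auto simp: sector_def)
    have "z \<notin> scaled_discs \<alpha>0" using scaled_discs_mono[of \<alpha>0 \<nu>] \<alpha>0 \<nu> acute z(3) by auto
    from resolvent_T[OF rot_not_mem_spectrum[OF z(1,2) this]]
    have R: "resolvent UNIV (blinfun_apply T) (1 - rot n j * z) = - RA (rot n j * z)" .
    have "norm ((1 - rot n j * z - 1) *\<^sub>C resolvent UNIV (blinfun_apply T) (1 - rot n j * z)) \<le> C"
      by (rule C[OF not_mem_closure_n_stolz[OF n _ \<nu>(2) z]]) (use \<alpha>0 \<nu> in simp)
    then have "cmod z * norm (RA (rot n j * z)) \<le> C"
      unfolding R by (simp add: norm_scaleC norm_mult)
    then show ?thesis using \<open>z \<noteq> 0\<close> by (simp add: field_simps)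
  qed
  then show thesis using that[of "\<bar>C\<bar>"] by auto
qed

text \<open>
  This holds for \<open>\<alpha>0\<close> and for every \<open>\<omega>\<close> such that \<open>A\<close> is \<open>n\<close>-sectorial of type \<open>\<omega>\<close>; the latter
  may be smaller than every type for which \<open>T\<close> is \<open>n\<close>-Ritt.
\<close>

definition angle_of_type :: "real \<Rightarrow> bool" where
  "angle_of_type \<omega> \<longleftrightarrow> 0 < \<omega> \<and> \<omega> < pi / n \<and>
     (\<forall>j<n. \<forall>z\<in>sector (pi / n) - closed_sector \<omega>. rot n j * z \<notin> \<sigma>A) \<and>
     (\<forall>\<nu>. \<omega> < \<nu> \<longrightarrow> \<nu> < pi / n \<longrightarrow>
       (\<exists>C\<ge>0. \<forall>j<n. \<forall>z\<in>sector (pi / n) - closed_sector \<nu>. norm (RA (rot n j * z)) \<le> C / cmod z))"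

lemma angle_of_type_\<alpha>0: "angle_of_type \<alpha>0"
  unfolding angle_of_type_def
proof (intro conjI allI impI ballI)
  fix j z assume "j < n" "z \<in> sector (pi / n) - closed_sector \<alpha>0"
  then show "rot n j * z \<notin> \<sigma>A" using scaled_discs_subset_closed_sector[of \<alpha>0] \<alpha>0 by (intro rot_not_mem_spectrum) auto
next
  fix \<nu> assume \<nu>: "\<alpha>0 < \<nu>" "\<nu> < pi / n"
  obtain C where "C \<ge> 0" "\<And>j z. j < n \<Longrightarrow> z \<in> sector (pi / n) \<Longrightarrow> z \<notin> scaled_discs \<nu> \<Longrightarrow> norm (RA (rot n j * z)) \<le> C / cmod z"
    using RA_bound_scaled_discs[OF \<nu>] by blast
  moreover have "scaled_discs \<nu> \<subseteq> closed_sector \<nu>" using scaled_discs_subset_closed_sector[of \<nu>] \<alpha>0 \<nu> acute by simp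
  ultimately show "\<exists>C\<ge>0. \<forall>j<n. \<forall>z\<in>sector (pi / n) - closed_sector \<nu>. norm (RA (rot n j * z)) \<le> C / cmod z"
    by blast
qed (use \<alpha>0 in auto)

lemma angle_of_type_sectorial:
  assumes "n_sectorial n \<omega> UNIV (blinfun_apply A)"
  shows "angle_of_type \<omega>"
  unfolding angle_of_type_def
proof (intro conjI allI impI ballI)
  have \<omega>: "0 < \<omega>" "\<omega> < pi / n" and sp: "\<sigma>A \<subseteq> closure (n_sector n \<omega>)"
    and bd: "\<And>\<nu>. \<nu> \<in> {\<omega><..<pi / n} \<Longrightarrow> bounded {z *\<^sub>C resolvent UNIV (blinfun_apply A) z | z. z \<notin> closure (n_sector n \<nu>)}"
    using assms by (auto simp: n_sectorial_def)
  show "0 < \<omega>" "\<omega> < pi / n" by fact+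
  show "rot n j * z \<notin> \<sigma>A" if "j < n" "z \<in> sector (pi / n) - closed_sector \<omega>" for j z
    using not_mem_closure_n_sector[OF n \<omega> that(1), of z] that(2) sp by auto
  fix \<nu> assume \<nu>: "\<omega> < \<nu>" "\<nu> < pi / n"
  then obtain C where C: "\<And>z. z \<notin> closure (n_sector n \<nu>) \<Longrightarrow> norm (z *\<^sub>C RA z) \<le> C"
    using bd[of \<nu>] unfolding bounded_iff RA_def by auto
  have "norm (RA (rot n j * z)) \<le> \<bar>C\<bar> / cmod z" if z: "j < n" "z \<in> sector (pi / n) - closed_sector \<nu>" for j z
  proof -
    have "z \<noteq> 0" using z(2) by (auto simp: sector_def)
    moreover have "norm ((rot n j * z) *\<^sub>C RA (rot n j * z)) \<le> C"
      by (rule C[OF not_mem_closure_n_sector[OF n _ \<nu>(2) z(1)]]) (use \<omega> \<nu> z in auto)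
    ultimately show ?thesis by (simp add: norm_scaleC norm_mult field_simps)
  qed
  then show "\<exists>C\<ge>0. \<forall>j<n. \<forall>z\<in>sector (pi / n) - closed_sector \<nu>. norm (RA (rot n j * z)) \<le> C / cmod z"
    by (intro exI[of _ "\<bar>C\<bar>"]) auto
qed

lemma one_minus_closure_n_stolz:
  assumes "0 < \<nu>" "\<nu> < pi / n" "1 - z \<in> closure (n_stolz n \<nu>)"
  shows "z \<in> closure (n_sector n \<nu>)"
proof -
  have "(\<lambda>w. 1 - w) ` n_stolz n \<nu> \<subseteq> n_sector n \<nu>"
    using stolz_delta_subset_sector[of \<nu>] assms acute by (fastforce simp: n_stolz_def n_sector_def)
  then have "(\<lambda>w. 1 - w) ` n_stolz n \<nu> \<subseteq> closure (n_sector n \<nu>)" using closure_subset by blast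
  then have "(\<lambda>w. 1 - w) ` closure (n_stolz n \<nu>) \<subseteq> closure (n_sector n \<nu>)"
    by (intro image_closure_subset continuous_intros) auto
  then have "1 - (1 - z) \<in> closure (n_sector n \<nu>)" using assms(3) by blast
  then show ?thesis by simp
qed

text \<open>Each petal lies in the sector of the same angle, so leaving the sectors means leaving
  the petals and no angle is lost.\<close>

lemma sectorial_A: "n_sectorial n \<alpha>0 UNIV (blinfun_apply A)"
  unfolding n_sectorial_def
proof (intro conjI ballI)
  have "{(x, A x) | x. x \<in> UNIV} = {p. snd p = A (fst p)}" by auto
  moreover have "closed {p :: 'a \<times> 'a. snd p = A (fst p)}"
    by (intro closed_Collect_eq continuous_intros)
  ultimately show "closed_densely_defined UNIV (blinfun_apply A)"
    using linear_A by (simp add: closed_densely_defined_def)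
  show "\<alpha>0 \<in> {0<..<pi / n}" using \<alpha>0 by simp
  show "\<sigma>A \<subseteq> closure (n_sector n \<alpha>0)"
    using spectrum_A spectrum_T_subset one_minus_closure_n_stolz[OF \<alpha>0(1,2)] by blast
  fix \<nu> assume \<nu>: "\<nu> \<in> {\<alpha>0<..<pi / n}"
  have "z *\<^sub>C resolvent UNIV (blinfun_apply A) z \<in> {(z - 1) *\<^sub>C resolvent UNIV (blinfun_apply T) z | z. z \<notin> closure (n_stolz n \<nu>)}"
    if z: "z \<notin> closure (n_sector n \<nu>)" for z
  proof -
    have \<nu>0: "0 < \<nu>" "\<nu> < pi / n" using \<nu> \<alpha>0 by auto
    have 1: "1 - z \<notin> closure (n_stolz n \<nu>)" using one_minus_closure_n_stolz[OF \<nu>0] z by blast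
    have "n_sector n \<alpha>0 \<subseteq> n_sector n \<nu>" using \<nu> by (force simp: n_sector_def sector_def)
    then have "z \<notin> closure (n_sector n \<alpha>0)" using z closure_mono by blast
    then have "z \<notin> \<sigma>A"
      using spectrum_A spectrum_T_subset one_minus_closure_n_stolz[OF \<alpha>0(1,2)] by blast
    then have "((1 - z) - 1) *\<^sub>C resolvent UNIV (blinfun_apply T) (1 - z) = z *\<^sub>C RA z"
      by (simp add: resolvent_T scaleC_minus_right)
    then show ?thesis using 1 unfolding RA_def by (metis (mono_tags, lifting) mem_Collect_eq)
  qed
  then have "{z *\<^sub>C resolvent UNIV (blinfun_apply A) z | z. z \<notin> closure (n_sector n \<nu>)} \<subseteq>
      {(z - 1) *\<^sub>C resolvent UNIV (blinfun_apply T) z | z. z \<notin> closure (n_stolz n \<nu>)}" by blast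
  moreover have "bounded {(z - 1) *\<^sub>C resolvent UNIV (blinfun_apply T) z | z. z \<notin> closure (n_stolz n \<nu>)}"
    using T \<nu> by (auto simp: n_Ritt_type_def)
  ultimately show "bounded {z *\<^sub>C resolvent UNIV (blinfun_apply A) z | z. z \<notin> closure (n_sector n \<nu>)}"
    using bounded_subset by blast
qed

text \<open>The integrand on the \<open>j\<close>-th sector, rotated to the sector about the positive axis.\<close>

definition \<Psi> :: "nat \<Rightarrow> (complex \<Rightarrow> complex) \<Rightarrow> complex \<Rightarrow> ('a \<Rightarrow>\<^sub>L 'a)" where
  "\<Psi> j f z = rot n j *\<^sub>C (f (rot n j * z) *\<^sub>C RA (rot n j * z))"

lemma norm_\<Psi>: "norm (\<Psi> j f z) = cmod (f (rot n j * z)) * norm (RA (rot n j * z))"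
  by (simp add: \<Psi>_def norm_scaleC)

lemma open_rot_image: "open S \<Longrightarrow> open ((\<lambda>z. rot n j * z) ` S)"
proof -
  assume S: "open S"
  have "(\<lambda>z. rot n j * z) ` S = (\<lambda>w. w / rot n j) -` S"
  proof (intro equalityI subsetI)
    fix w assume "w \<in> (\<lambda>w. w / rot n j) -` S"
    then show "w \<in> (\<lambda>z. rot n j * z) ` S" by (intro image_eqI[of _ _ "w / rot n j"]) auto
  qed auto
  then show ?thesis using S by (simp add: open_vimage continuous_intros)
qed

lemma \<Psi>_regular:
  assumes S: "open S" "\<And>z. z \<in> S \<Longrightarrow> rot n j * z \<notin> \<sigma>A" and f: "f holomorphic_on (\<lambda>z. rot n j * z) ` S"
  shows "continuous_on S (\<Psi> j f)" "clinear_functional l \<Longrightarrow> (\<lambda>z. l (\<Psi> j f z)) holomorphic_on S"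
proof -
  let ?r = "\<lambda>z. rot n j * z"
  have disj: "?r ` S \<inter> \<sigma>A = {}" using S(2) by auto
  have cr: "continuous_on S ?r" by (intro continuous_intros)
  have c1: "continuous_on S (\<lambda>z. RA (?r z))"
    unfolding RA_def by (rule continuous_on_compose2[OF continuous_on_resolvent[OF linear_A disj] cr]) auto
  have c2: "continuous_on S (\<lambda>z. f (?r z))"
    by (rule continuous_on_compose2[OF holomorphic_on_imp_continuous_on[OF f] cr]) auto
  have "continuous_on S (\<lambda>z. f (?r z) *\<^sub>C RA (?r z))"
    by (rule bounded_bilinear.continuous_on[OF bounded_bilinear_scaleC c2 c1])
  then show "continuous_on S (\<Psi> j f)"
    unfolding \<Psi>_def[abs_def]
    by (rule bounded_bilinear.continuous_on[OF bounded_bilinear_scaleC continuous_on_const])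
  assume l: "clinear_functional l"
  have "(\<lambda>z. l (RA z)) holomorphic_on ?r ` S"
    unfolding RA_def by (rule holomorphic_functional_resolvent[OF linear_A disj open_rot_image[OF S(1)] l])
  then have h1: "((\<lambda>z. l (RA z)) \<circ> ?r) holomorphic_on S"
    by (intro holomorphic_on_compose holomorphic_intros)
  have h2: "(f \<circ> ?r) holomorphic_on S"
    by (intro holomorphic_on_compose holomorphic_intros f)
  have "(\<lambda>z. rot n j * ((f \<circ> ?r) z * ((\<lambda>z. l (RA z)) \<circ> ?r) z)) holomorphic_on S"
    by (intro holomorphic_intros h1 h2)
  then show "(\<lambda>z. l (\<Psi> j f z)) holomorphic_on S"
    by (simp add: \<Psi>_def clinear_functional_simps[OF l] o_def)
qed

lemma sector_mono: "\<theta> \<le> \<theta>' \<Longrightarrow> sector \<theta> \<subseteq> sector \<theta>'"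
  by (auto simp: sector_def)

text \<open>Within the \<open>j\<close>-th sector the spectrum lies in the petal of the Ritt type
  and in the cone of the sectorial type. Only the intersection is removed: the petal alone may
  exceed the angle \<omega>, and the cone alone would cut the region at infinity. The intersection
  is star-shaped about the vertex, which keeps the complement of the region connected.\<close>

lemma cone_fun_inf_\<Psi>:
  assumes \<omega>: "angle_of_type \<omega>" and \<theta>: "\<omega> < \<theta>" "\<theta> < pi / n" and f: "f \<in> H0_sector n \<theta>" and j: "j < n"
  shows "\<exists>s. cone_fun_inf (\<Psi> j f) (sector \<theta> - (scaled_discs \<alpha>0 \<inter> closed_sector \<omega>)) \<omega> \<theta> 3 s"
proof -
  obtain c s where c: "c > 0" "s > 0" and fle: "\<And>z. z \<in> n_sector n \<theta> \<Longrightarrow> cmod (f z) \<le> c * (cmod z powr s / (1 + cmod z powr (2 * s)))"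
    and hol: "f holomorphic_on n_sector n \<theta>"
    using f by (auto simp: H0_sector_def)
  have w: "0 < \<omega>" "\<omega> < pi / n" using \<omega> by (auto simp: angle_of_type_def)
  let ?S = "sector \<theta> - (scaled_discs \<alpha>0 \<inter> closed_sector \<omega>)"
  have sub: "sector \<theta> \<subseteq> sector (pi / n)" using \<theta> by (intro sector_mono) simp
  have mem: "rot n j * z \<in> n_sector n \<theta>" if "z \<in> sector \<theta>" for z using that j by (auto simp: n_sector_def)
  have nospec: "rot n j * z \<notin> \<sigma>A" if "z \<in> ?S" for z
  proof (cases "z \<in> scaled_discs \<alpha>0")
    case True
    then show ?thesis using that \<omega> j sub unfolding angle_of_type_def by blast
  next
    case False
    then show ?thesis using that j sub by (intro rot_not_mem_spectrum) auto
  qed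
  have oS: "open ?S"
    using open_sector[of \<theta>] w \<theta> acute closed_scaled_discs closed_sector_closed by (intro open_Diff closed_Int) auto
  have fS: "f holomorphic_on (\<lambda>z. rot n j * z) ` ?S"
    by (rule holomorphic_on_subset[OF hol]) (use mem in auto)
  have Sc: "- ?S = - sector \<theta> \<union> (scaled_discs \<alpha>0 \<inter> closed_sector \<omega>)" by auto
  have fz: "cmod (f (rot n j * z)) \<le> c * cmod z powr s" "cmod (f (rot n j * z)) \<le> c * cmod z powr (- s)"
    if "z \<in> sector \<theta>" for z
  proof -
    have "cmod z > 0" using that by (auto simp: sector_def)
    have "cmod (f (rot n j * z)) \<le> c * (cmod z powr s / (1 + cmod z powr (2 * s)))"
      using fle[OF mem[OF that]] by (simp add: norm_mult)
    moreover have "c * (cmod z powr s / (1 + cmod z powr (2 * s))) \<le> c * cmod z powr s"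
      "c * (cmod z powr s / (1 + cmod z powr (2 * s))) \<le> c * cmod z powr (- s)"
      using powr_quotient_le[OF \<open>cmod z > 0\<close>] c by (intro mult_left_mono; simp)+
    ultimately show "cmod (f (rot n j * z)) \<le> c * cmod z powr s" "cmod (f (rot n j * z)) \<le> c * cmod z powr (- s)"
      by linarith+
  qed
  have "cone_fun_inf (\<Psi> j f) ?S \<omega> \<theta> 3 s"
  proof
    show "0 < \<omega>" "\<omega> < \<theta>" "\<theta> < pi / 2" "(0::real) < 3" "0 < s" using w \<theta> acute c by auto
    show "open ?S" by (rule oS)
    show "connected (- ?S)"
      unfolding Sc
    proof (rule connected_Un)
      have "0 \<in> - sector \<theta> \<inter> (scaled_discs \<alpha>0 \<inter> closed_sector \<omega>)" using zero_mem_scaled_discs by (simp add: sector_def closed_sector_def)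
      then show "- sector \<theta> \<inter> (scaled_discs \<alpha>0 \<inter> closed_sector \<omega>) \<noteq> {}" by blast
    qed (rule connected_scaled_discs_Int_closed_sector)+
    show "\<not> bounded (- ?S)"
    proof
      assume "bounded (- ?S)"
      then obtain B where B: "\<And>z. z \<in> - ?S \<Longrightarrow> cmod z \<le> B" unfolding bounded_iff by blast
      have "- of_real (\<bar>B\<bar> + 1) \<in> - sector \<theta>" using w \<theta> acute by (simp add: sector_iff)
      then have "cmod (- of_real (\<bar>B\<bar> + 1)) \<le> B" using B unfolding Sc by blast
      then show False unfolding norm_minus_cancel norm_of_real by simp
    qed
    show "z \<in> ?S" if "z \<in> sector \<theta> - closed_sector \<omega>" for z using that by auto
    then show "z \<in> ?S" if "z \<in> sector \<theta> - closed_sector \<omega>" for z using that by auto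
    show "continuous_on ?S (\<Psi> j f)" by (rule \<Psi>_regular(1)[OF oS nospec fS])
    show "(\<lambda>z. l (\<Psi> j f z)) holomorphic_on ?S" if "clinear_functional l" for l
      by (rule \<Psi>_regular(2)[OF oS nospec fS that])
    show "\<exists>C. \<forall>z\<in>sector \<theta> - closed_sector \<nu>. cmod z < 3 \<longrightarrow> norm (\<Psi> j f z) \<le> C * cmod z powr (s - 1)"
      if \<nu>: "\<omega> < \<nu>" "\<nu> < \<theta>" for \<nu>
    proof -
      obtain C where C: "C \<ge> 0" "\<And>z. z \<in> sector (pi / n) - closed_sector \<nu> \<Longrightarrow> norm (RA (rot n j * z)) \<le> C / cmod z"
        using \<omega> \<nu> \<theta> j unfolding angle_of_type_def by (meson less_trans)
      have "norm (\<Psi> j f z) \<le> (c * C) * cmod z powr (s - 1)" if z: "z \<in> sector \<theta> - closed_sector \<nu>" for z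
      proof -
        have zp: "cmod z > 0" using z by (auto simp: sector_def)
        have "norm (\<Psi> j f z) \<le> (c * cmod z powr s) * (C / cmod z)"
          unfolding norm_\<Psi> using fz(1)[of z] C z sub c by (intro mult_mono) auto
        also have "\<dots> = (c * C) * (cmod z powr s / cmod z powr 1)" using zp by simp
        also have "cmod z powr s / cmod z powr 1 = cmod z powr (s - 1)" by (rule powr_diff[symmetric])
        finally show ?thesis .
      qed
      then show ?thesis by blast
    qed
    have far: "z \<notin> scaled_discs \<nu>" if "cmod z \<ge> 2" "0 < \<nu>" "\<nu> < pi / 2" for z \<nu>
      using scaled_discs_norm_less[of \<nu> z] that by auto
    show "z \<in> ?S" if "z \<in> sector \<theta>" "cmod z \<ge> 2" for z
      using far[of z \<alpha>0] that \<alpha>0 by auto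
    show "\<exists>C. \<forall>z\<in>sector \<theta>. cmod z \<ge> 2 \<longrightarrow> norm (\<Psi> j f z) \<le> C * cmod z powr (- 1 - s)"
    proof -
      obtain \<nu> where \<nu>: "\<alpha>0 < \<nu>" "\<nu> < pi / n" using dense[OF \<alpha>0(2)] by blast
      obtain C where C: "C \<ge> 0" "\<And>j z. j < n \<Longrightarrow> z \<in> sector (pi / n) \<Longrightarrow> z \<notin> scaled_discs \<nu> \<Longrightarrow> norm (RA (rot n j * z)) \<le> C / cmod z"
        using RA_bound_scaled_discs[OF \<nu>] by blast
      have "norm (\<Psi> j f z) \<le> (c * C) * cmod z powr (- 1 - s)" if z: "z \<in> sector \<theta>" "cmod z \<ge> 2" for z
      proof -
        have zp: "cmod z > 0" using z by auto
        have "z \<notin> scaled_discs \<nu>" using far[of z \<nu>] z \<nu> \<alpha>0 acute by auto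
        then have "norm (\<Psi> j f z) \<le> (c * cmod z powr (- s)) * (C / cmod z)"
          unfolding norm_\<Psi> using fz(2)[of z] C z sub c j by (intro mult_mono) auto
        also have "\<dots> = (c * C) * (cmod z powr (- s) / cmod z powr 1)" using zp by simp
        also have "cmod z powr (- s) / cmod z powr 1 = cmod z powr (- s - 1)" by (rule powr_diff[symmetric])
        also have "- s - 1 = - 1 - s" by simp
        finally show ?thesis .
      qed
      then show ?thesis by blast
    qed
  qed simp
  then show ?thesis by blast
qed

text \<open>The function lives on the petal only, so the region is the petal minus the smaller
  closed petal around the spectrum; \<open>cos \<gamma>\<close> is the radius up to which petal and
  sector agree.\<close>

lemma cone_fun_\<Psi>:
  assumes \<gamma>: "\<alpha>0 < \<gamma>" "\<gamma> < pi / n" and \<phi>: "\<phi> \<in> H0_stolz n \<gamma>" and j: "j < n"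
  shows "\<exists>s. cone_fun (\<Psi> j (\<lambda>z. \<phi> (1 - z))) (stolz_delta \<gamma> - scaled_discs \<alpha>0) \<alpha>0 \<gamma> (cos \<gamma>) s"
proof -
  let ?f = "\<lambda>z. \<phi> (1 - z)"
  obtain c s where c: "c > 0" "s > 0" and fle: "\<And>z. z \<in> n_stolz n \<gamma> \<Longrightarrow> cmod (\<phi> z) \<le> c * cmod (1 - z) powr s"
    and hol: "\<phi> holomorphic_on n_stolz n \<gamma>"
    using \<phi> by (auto simp: H0_stolz_def)
  have \<gamma>0: "0 < \<gamma>" "\<gamma> < pi / 2" using \<alpha>0 \<gamma> acute by auto
  let ?S = "stolz_delta \<gamma> - scaled_discs \<alpha>0"
  have sub: "sector \<gamma> \<subseteq> sector (pi / n)" using \<gamma> by (intro sector_mono) simp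
  have sub2: "stolz_delta \<gamma> \<subseteq> sector (pi / n)" using sub stolz_delta_subset_sector[OF \<gamma>0] by blast
  have mem: "1 - rot n j * z \<in> n_stolz n \<gamma>" if "z \<in> stolz_delta \<gamma>" for z using that j by (auto simp: n_stolz_def)
  have nospec: "rot n j * z \<notin> \<sigma>A" if "z \<in> ?S" for z
    using that j sub2 by (intro rot_not_mem_spectrum) auto
  have oS: "open ?S" by (intro open_Diff open_stolz_delta closed_scaled_discs)
  have "\<phi> holomorphic_on (\<lambda>w. 1 - w) ` (\<lambda>z. rot n j * z) ` ?S"
    by (rule holomorphic_on_subset[OF hol]) (use mem in auto)
  then have "(\<phi> \<circ> (\<lambda>w. 1 - w)) holomorphic_on (\<lambda>z. rot n j * z) ` ?S"
    by (intro holomorphic_on_compose holomorphic_intros)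
  then have fS: "?f holomorphic_on (\<lambda>z. rot n j * z) ` ?S" by (simp add: o_def)
  have Sc: "- ?S = - stolz_delta \<gamma> \<union> scaled_discs \<alpha>0" by auto
  have bdd: "bounded (stolz_delta \<gamma>)"
    using scaled_discs_norm_less[OF \<gamma>0] stolz_delta_subset_scaled_discs[OF \<gamma>0] by (intro boundedI[of _ 2]) (auto intro: less_imp_le)
  have "cone_fun (\<Psi> j ?f) ?S \<alpha>0 \<gamma> (cos \<gamma>) s"
  proof
    show "0 < \<alpha>0" "\<alpha>0 < \<gamma>" "\<gamma> < pi / 2" "0 < cos \<gamma>" "0 < s"
      using \<alpha>0 \<gamma> acute c \<gamma>0 by (auto simp: cos_pos_acute)
    show "open ?S" by (rule oS)
    show "connected (- ?S)"
      unfolding Sc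
    proof (rule connected_Un)
      have "0 \<notin> stolz_delta \<gamma>" using stolz_delta_subset_sector[OF \<gamma>0] by (auto simp: sector_def)
      then show "- stolz_delta \<gamma> \<inter> scaled_discs \<alpha>0 \<noteq> {}" using zero_mem_scaled_discs by blast
      show "connected (- stolz_delta \<gamma>)"
        by (rule connected_complement_bounded_convex[OF bdd convex_stolz_delta]) simp
    qed (rule connected_scaled_discs_Int_closed_sector)
    have "bounded ?S" using bdd bounded_subset by blast
    then show "\<not> bounded (- ?S)"
      using cobounded_imp_unbounded by blast
    show "z \<in> ?S" if "z \<in> sector \<gamma> - closed_sector \<alpha>0" "cmod z < cos \<gamma>" for z
      using that sector_near_zero[OF \<gamma>0] scaled_discs_subset_closed_sector[of \<alpha>0] \<alpha>0 by auto
    show "continuous_on ?S (\<Psi> j ?f)" by (rule \<Psi>_regular(1)[OF oS nospec fS])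
    show "(\<lambda>z. l (\<Psi> j ?f z)) holomorphic_on ?S" if "clinear_functional l" for l
      by (rule \<Psi>_regular(2)[OF oS nospec fS that])
    show "\<exists>C. \<forall>z\<in>sector \<gamma> - closed_sector \<nu>. cmod z < cos \<gamma> \<longrightarrow> norm (\<Psi> j ?f z) \<le> C * cmod z powr (s - 1)"
      if \<nu>: "\<alpha>0 < \<nu>" "\<nu> < \<gamma>" for \<nu>
    proof -
      obtain C where C: "C \<ge> 0" "\<And>z. z \<in> sector (pi / n) - closed_sector \<nu> \<Longrightarrow> norm (RA (rot n j * z)) \<le> C / cmod z"
        using angle_of_type_\<alpha>0 \<nu> \<gamma> j unfolding angle_of_type_def by (meson less_trans)
      have "norm (\<Psi> j ?f z) \<le> (c * C) * cmod z powr (s - 1)" if z: "z \<in> sector \<gamma> - closed_sector \<nu>" "cmod z < cos \<gamma>" for z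
      proof -
        have zp: "cmod z > 0" using z by (auto simp: sector_def)
        have "z \<in> stolz_delta \<gamma>" using z sector_near_zero[OF \<gamma>0] by auto
        then have "cmod (?f (rot n j * z)) \<le> c * cmod z powr s"
          using fle[OF mem] by (simp add: norm_mult)
        then have "norm (\<Psi> j ?f z) \<le> (c * cmod z powr s) * (C / cmod z)"
          unfolding norm_\<Psi> using C z sub c by (intro mult_mono) auto
        also have "\<dots> = (c * C) * (cmod z powr s / cmod z powr 1)" using zp by simp
        also have "cmod z powr s / cmod z powr 1 = cmod z powr (s - 1)" by (rule powr_diff[symmetric])
        finally show ?thesis .
      qed
      then show ?thesis by blast
    qed
  qed
  then show ?thesis by blast
qed

section \<open>Values of the contour integrals and their independence of the angle\<close>

definition petal_val :: "real \<Rightarrow> (complex \<Rightarrow> complex) \<Rightarrow> ('a \<Rightarrow>\<^sub>L 'a)" where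
  "petal_val \<beta> f = (\<Sum>j<n. integral {0..1} (\<lambda>t. petal_deriv \<beta> t *\<^sub>C \<Psi> j f (petal \<beta> t)))"

definition sector_val :: "real \<Rightarrow> (complex \<Rightarrow> complex) \<Rightarrow> ('a \<Rightarrow>\<^sub>L 'a)" where
  "sector_val \<nu> f = sector_contour_integral n \<nu> (\<lambda>z. f z *\<^sub>C RA z)"

lemma petal_mem_sector:
  assumes "0 < \<beta>" "\<beta> < \<theta>" "\<theta> < pi / 2" "t \<in> {0<..<1}"
  shows "petal \<beta> t \<in> sector \<theta>" "petal \<beta> t \<in> stolz_delta \<theta>"
proof -
  have *: "petal \<beta> t \<in> scaled_discs \<beta> - {0}" by (rule petal_mem_scaled_discs) (use assms in auto)
  moreover have "scaled_discs \<beta> \<subseteq> closed_sector \<beta>" by (rule scaled_discs_subset_closed_sector) (use assms in auto)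
  ultimately show "petal \<beta> t \<in> sector \<theta>" using closed_sector_subset_sector[OF assms(1-3)] by blast
  show "petal \<beta> t \<in> stolz_delta \<theta>" using * scaled_discs_subset_stolz_delta[OF assms(1-3)] by blast
qed

lemma sector_val_eq: "sector_val \<nu> f = (\<Sum>j<n. ray_integral (cis (- \<nu>)) (\<Psi> j f) - ray_integral (cis \<nu>) (\<Psi> j f))"
proof -
  have "ray_integral (rot n j * cis a) (\<lambda>z. f z *\<^sub>C RA z) = ray_integral (cis a) (\<Psi> j f)" for j a
    by (simp add: ray_integral_def \<Psi>_def scaleC_scaleC mult_ac)
  then show ?thesis by (simp add: sector_val_def sector_contour_integral_def)
qed

lemma sector_val_indep:
  assumes "angle_of_type \<omega>" "\<omega> < \<theta>" "\<theta> < pi / n" "f \<in> H0_sector n \<theta>"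
    and "\<nu> \<in> {\<omega><..<\<theta>}" "\<nu>' \<in> {\<omega><..<\<theta>}"
  shows "sector_val \<nu> f = sector_val \<nu>' f"
  unfolding sector_val_eq
proof (rule sum.cong[OF refl])
  fix j assume "j \<in> {..<n}"
  then obtain s where "cone_fun_inf (\<Psi> j f) (sector \<theta> - (scaled_discs \<alpha>0 \<inter> closed_sector \<omega>)) \<omega> \<theta> 3 s"
    using cone_fun_inf_\<Psi>[OF assms(1-4)] by blast
  then show "ray_integral (cis (- \<nu>)) (\<Psi> j f) - ray_integral (cis \<nu>) (\<Psi> j f) =
    ray_integral (cis (- \<nu>')) (\<Psi> j f) - ray_integral (cis \<nu>') (\<Psi> j f)"
    by (rule cone_fun_inf.ray_difference_eq) (use assms in auto)
qed

lemma sector_val_eq_petal_val: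
  assumes "\<theta> < pi / n" "f \<in> H0_sector n \<theta>" "\<nu> \<in> {\<alpha>0<..<\<theta>}"
  shows "sector_val \<nu> f = petal_val \<nu> f"
  unfolding sector_val_eq petal_val_def
proof (rule sum.cong[OF refl])
  fix j assume "j \<in> {..<n}"
  then obtain s where "cone_fun_inf (\<Psi> j f) (sector \<theta> - (scaled_discs \<alpha>0 \<inter> closed_sector \<alpha>0)) \<alpha>0 \<theta> 3 s"
    using cone_fun_inf_\<Psi>[OF angle_of_type_\<alpha>0 _ assms(1,2)] assms(3) by fastforce
  then show "ray_integral (cis (- \<nu>)) (\<Psi> j f) - ray_integral (cis \<nu>) (\<Psi> j f) =
    integral {0..1} (\<lambda>t. petal_deriv \<nu> t *\<^sub>C \<Psi> j f (petal \<nu> t))"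
    by (rule cone_fun_inf.ray_difference_eq_petal_integral)
      (use assms \<alpha>0 acute petal_mem_sector[of \<nu> \<theta>] petal_not_mem_scaled_discs[of \<alpha>0 \<nu>] in auto)
qed

lemma petal_val_indep:
  assumes "\<gamma> < pi / n" "\<phi> \<in> H0_stolz n \<gamma>" "\<beta> \<in> {\<alpha>0<..<\<gamma>}" "\<beta>' \<in> {\<alpha>0<..<\<gamma>}"
  shows "petal_val \<beta> (\<lambda>z. \<phi> (1 - z)) = petal_val \<beta>' (\<lambda>z. \<phi> (1 - z))"
  unfolding petal_val_def
proof (rule sum.cong[OF refl])
  fix j assume "j \<in> {..<n}"
  then obtain s where *: "cone_fun (\<Psi> j (\<lambda>z. \<phi> (1 - z))) (stolz_delta \<gamma> - scaled_discs \<alpha>0) \<alpha>0 \<gamma> (cos \<gamma>) s"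
    using cone_fun_\<Psi>[OF _ assms(1,2)] assms(3) by fastforce
  have "petal b t \<in> stolz_delta \<gamma> - scaled_discs \<alpha>0" if "b \<in> {\<alpha>0<..<\<gamma>}" "t \<in> {0<..<1}" for b t
    using that assms(1) \<alpha>0 acute petal_mem_sector[of b \<gamma>] petal_not_mem_scaled_discs[of \<alpha>0 b] by auto
  then show "integral {0..1} (\<lambda>t. petal_deriv \<beta> t *\<^sub>C \<Psi> j (\<lambda>z. \<phi> (1 - z)) (petal \<beta> t)) =
     integral {0..1} (\<lambda>t. petal_deriv \<beta>' t *\<^sub>C \<Psi> j (\<lambda>z. \<phi> (1 - z)) (petal \<beta>' t))"
    by (intro cone_fun.petal_integral_eq[OF *]) (use assms in auto)
qed

text \<open>Under z -> 1 - z the derivative of the path and the resolvent both change sign, and the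
  two signs cancel. End points and corners form a finite exceptional set.\<close>

lemma stolz_contour_integral_eq:
  assumes "\<beta> \<in> {\<alpha>0<..<pi / n}"
  shows "stolz_contour_integral n \<beta> (\<lambda>z. \<phi> z *\<^sub>C resolvent UNIV (blinfun_apply T) z) = petal_val \<beta> (\<lambda>z. \<phi> (1 - z))"
  unfolding stolz_contour_integral_def petal_val_def vec_contour_integral_def
proof (intro sum.cong refl integral_spike[of "{0, 1/2, 3/4, 1}"])
  fix j t assume j: "j \<in> {..<n}" and "t \<in> {0..1} - {0, 1 / 2, 3 / 4, 1 :: real}"
  then have t: "t \<in> {0<..<1} - {1/2, 3/4}" by auto
  have pe: "stolz_petal_path n j \<beta> = (\<lambda>t. 1 - rot n j * petal \<beta> t)"
    by (simp add: stolz_petal_path_def stolz_path_eq fun_eq_iff)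
  have "(petal \<beta> has_derivative (\<lambda>x. x *\<^sub>R petal_deriv \<beta> t)) (at t)"
    using petal_has_vector_derivative[OF t] by (simp add: has_vector_derivative_def)
  then have "((\<lambda>t. 1 - rot n j * petal \<beta> t) has_vector_derivative - (rot n j * petal_deriv \<beta> t)) (at t)"
    unfolding has_vector_derivative_def by (auto intro!: derivative_eq_intros simp: mult_ac)
  from has_vector_derivative_at_within[OF this]
  have "vector_derivative (stolz_petal_path n j \<beta>) (at t within {0..1}) = - (rot n j * petal_deriv \<beta> t)"
    unfolding pe by (intro vector_derivative_within_closed_interval) (use t in auto)
  moreover have "rot n j * petal \<beta> t \<notin> \<sigma>A"
  proof (rule rot_not_mem_spectrum)
    have \<beta>: "0 < \<beta>" "\<beta> < pi / n" "\<beta> < pi / 2" using assms \<alpha>0(1) acute[of \<beta>] by simp_all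
    show "j < n" using j by simp
    have "petal \<beta> t \<in> scaled_discs \<beta> - {0}" by (rule petal_mem_scaled_discs) (use \<beta> t in auto)
    moreover have "scaled_discs \<beta> \<subseteq> closed_sector \<beta>" by (rule scaled_discs_subset_closed_sector) (use \<beta> in auto)
    ultimately show "petal \<beta> t \<in> sector (pi / n)" using closed_sector_subset_sector_pi[OF n \<beta>(1,2)] by blast
    show "petal \<beta> t \<notin> scaled_discs \<alpha>0" by (rule petal_not_mem_scaled_discs) (use \<beta> \<alpha>0(1) assms t in simp_all)
  qed
  ultimately show "petal_deriv \<beta> t *\<^sub>C \<Psi> j (\<lambda>z. \<phi> (1 - z)) (petal \<beta> t) =
    vector_derivative (stolz_petal_path n j \<beta>) (at t within {0..1}) *\<^sub>C
      (\<phi> (stolz_petal_path n j \<beta> t) *\<^sub>C resolvent UNIV (blinfun_apply T) (stolz_petal_path n j \<beta> t))"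
    by (simp add: pe resolvent_T \<Psi>_def scaleC_scaleC scaleC_minus_right mult_ac)
qed auto

lemma sectorial_calculus_eq:
  assumes \<omega>: "n_sectorial n \<omega> UNIV (blinfun_apply A)" "\<omega> < \<theta>" and \<theta>: "\<theta> < pi / n" and f: "f \<in> H0_sector n \<theta>"
    and \<nu>: "\<nu> \<in> {\<omega><..<\<theta>}"
  shows "sectorial_calculus n \<theta> UNIV (blinfun_apply A) f = (1 / (2 * of_real pi * \<i>)) *\<^sub>C sector_val \<nu> f"
  unfolding sectorial_calculus_def
proof (rule the_equality)
  have ind: "sector_val \<nu> f = sector_val \<nu>' f" if "\<nu>' \<in> {\<omega><..<\<theta>}" for \<nu>'
    using sector_val_indep[OF angle_of_type_sectorial[OF \<omega>(1)] \<omega>(2) \<theta> f \<nu> that] .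
  have "\<omega> \<in> {0<..<\<theta>}" using \<omega> by (auto simp: n_sectorial_def)
  then show "\<exists>\<omega>\<in>{0<..<\<theta>}. n_sectorial n \<omega> UNIV (blinfun_apply A) \<and>
       (\<forall>\<nu>'\<in>{\<omega><..<\<theta>}. (1 / (2 * of_real pi * \<i>)) *\<^sub>C sector_val \<nu> f = (1 / (2 * of_real pi * \<i>)) *\<^sub>C
          sector_contour_integral n \<nu>' (\<lambda>z. f z *\<^sub>C resolvent UNIV (blinfun_apply A) z))"
    using \<omega>(1) ind unfolding sector_val_def RA_def by (intro bexI[of _ \<omega>]) auto
  fix S assume "\<exists>\<omega>\<in>{0<..<\<theta>}. n_sectorial n \<omega> UNIV (blinfun_apply A) \<and>
       (\<forall>\<nu>'\<in>{\<omega><..<\<theta>}. S = (1 / (2 * of_real pi * \<i>)) *\<^sub>C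
          sector_contour_integral n \<nu>' (\<lambda>z. f z *\<^sub>C resolvent UNIV (blinfun_apply A) z))"
  then obtain \<omega>' where \<omega>': "\<omega>' < \<theta>" and S: "\<And>\<nu>'. \<nu>' \<in> {\<omega>'<..<\<theta>} \<Longrightarrow> S = (1 / (2 * of_real pi * \<i>)) *\<^sub>C sector_val \<nu>' f"
    unfolding sector_val_def RA_def by auto
  \<comment> \<open>Uniqueness in the definite description: two admissible types share the contours
    whose angle exceeds both.\<close>
  obtain \<nu>' where \<nu>': "max \<omega> \<omega>' < \<nu>'" "\<nu>' < \<theta>" using dense[of "max \<omega> \<omega>'" \<theta>] \<omega>' \<omega>(2) by auto
  have "S = (1 / (2 * of_real pi * \<i>)) *\<^sub>C sector_val \<nu>' f" by (rule S) (use \<nu>' in auto)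
  also have "sector_val \<nu>' f = sector_val \<nu> f" using ind[of \<nu>'] \<nu>' by simp
  finally show "S = (1 / (2 * of_real pi * \<i>)) *\<^sub>C sector_val \<nu> f" .
qed

lemma Ritt_calculus_eq:
  assumes \<gamma>: "\<alpha>0 < \<gamma>" "\<gamma> < pi / n" and \<phi>: "\<phi> \<in> H0_stolz n \<gamma>" and \<beta>: "\<beta> \<in> {\<alpha>0<..<\<gamma>}"
  shows "Ritt_calculus n \<gamma> T \<phi> = (1 / (2 * of_real pi * \<i>)) *\<^sub>C petal_val \<beta> (\<lambda>z. \<phi> (1 - z))"
  unfolding Ritt_calculus_def
proof (rule the_equality)
  have ind: "stolz_contour_integral n \<beta>' (\<lambda>z. \<phi> z *\<^sub>C resolvent UNIV (blinfun_apply T) z) = petal_val \<beta> (\<lambda>z. \<phi> (1 - z))"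
    if "\<beta>' \<in> {\<alpha>0<..<\<gamma>}" for \<beta>'
    using petal_val_indep[OF \<gamma>(2) \<phi> \<beta> that] stolz_contour_integral_eq[of \<beta>' \<phi>] that \<gamma> by simp
  then show "\<exists>\<alpha>\<in>{0<..<\<gamma>}. n_Ritt_type n \<alpha> T \<and>
       (\<forall>\<beta>'\<in>{\<alpha><..<\<gamma>}. (1 / (2 * of_real pi * \<i>)) *\<^sub>C petal_val \<beta> (\<lambda>z. \<phi> (1 - z)) = (1 / (2 * of_real pi * \<i>)) *\<^sub>C
          stolz_contour_integral n \<beta>' (\<lambda>z. \<phi> z *\<^sub>C resolvent UNIV (blinfun_apply T) z))"
    using T \<alpha>0 \<gamma> by (intro bexI[of _ \<alpha>0]) auto
  fix S assume "\<exists>\<alpha>\<in>{0<..<\<gamma>}. n_Ritt_type n \<alpha> T \<and>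
       (\<forall>\<beta>'\<in>{\<alpha><..<\<gamma>}. S = (1 / (2 * of_real pi * \<i>)) *\<^sub>C
          stolz_contour_integral n \<beta>' (\<lambda>z. \<phi> z *\<^sub>C resolvent UNIV (blinfun_apply T) z))"
  then obtain \<alpha> where \<alpha>: "\<alpha> < \<gamma>" and S: "\<And>\<beta>'. \<beta>' \<in> {\<alpha><..<\<gamma>} \<Longrightarrow> S = (1 / (2 * of_real pi * \<i>)) *\<^sub>C
          stolz_contour_integral n \<beta>' (\<lambda>z. \<phi> z *\<^sub>C resolvent UNIV (blinfun_apply T) z)"
    by auto
  obtain \<beta>' where \<beta>': "max \<alpha> \<alpha>0 < \<beta>'" "\<beta>' < \<gamma>" using dense[of "max \<alpha> \<alpha>0" \<gamma>] \<alpha> \<gamma> by auto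
  have "S = (1 / (2 * of_real pi * \<i>)) *\<^sub>C stolz_contour_integral n \<beta>' (\<lambda>z. \<phi> z *\<^sub>C resolvent UNIV (blinfun_apply T) z)"
    by (rule S) (use \<beta>' in auto)
  also have "stolz_contour_integral n \<beta>' (\<lambda>z. \<phi> z *\<^sub>C resolvent UNIV (blinfun_apply T) z) = petal_val \<beta> (\<lambda>z. \<phi> (1 - z))"
    by (rule ind) (use \<beta>' in auto)
  finally show "S = (1 / (2 * of_real pi * \<i>)) *\<^sub>C petal_val \<beta> (\<lambda>z. \<phi> (1 - z))" .
qed

end

section \<open>Comparison of the square function estimates\<close>

lemma square_function_bdd_above:
  assumes "\<And>k. k \<in> {1..N} \<Longrightarrow> bounded (g k ` \<Omega>)"
  shows "bdd_above ((\<lambda>z. sqrt (\<Sum>k=1..N. (cmod (g k z))\<^sup>2)) ` \<Omega>)"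
proof -
  have "\<forall>k\<in>{1..N}. \<exists>B. \<forall>z\<in>\<Omega>. cmod (g k z) \<le> B"
    using assms unfolding bounded_iff by blast
  then obtain B where B: "\<And>k z. k \<in> {1..N} \<Longrightarrow> z \<in> \<Omega> \<Longrightarrow> cmod (g k z) \<le> B k"
    by (metis (no_types))
  have "sqrt (\<Sum>k=1..N. (cmod (g k z))\<^sup>2) \<le> sqrt (\<Sum>k=1..N. (B k)\<^sup>2)" if "z \<in> \<Omega>" for z
    using B that by (intro real_sqrt_le_mono sum_mono power_mono) auto
  then show ?thesis by (rule bdd_aboveI2)
qed

lemma square_function_norm_upper:
  assumes "\<And>k. k \<in> {1..N} \<Longrightarrow> bounded (g k ` \<Omega>)" "z \<in> \<Omega>"
  shows "sqrt (\<Sum>k=1..N. (cmod (g k z))\<^sup>2) \<le> square_function_norm \<Omega> N g"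
  unfolding square_function_norm_def
  by (rule cSUP_upper[OF assms(2) square_function_bdd_above]) (use assms in auto)

lemma square_function_norm_least:
  assumes "\<Omega> \<noteq> {}" "\<And>z. z \<in> \<Omega> \<Longrightarrow> sqrt (\<Sum>k=1..N. (cmod (g k z))\<^sup>2) \<le> B"
  shows "square_function_norm \<Omega> N g \<le> B"
  unfolding square_function_norm_def by (rule cSUP_least) (use assms in auto)

text \<open>Each petal comes with its own constants, while \<open>H0_sector\<close> asks for one
  pair. The smallest exponent gives the weakest decay both at 0 and at infinity, so it serves all of
  them up to a factor 2.\<close>

lemma common_decay:
  assumes "finite J" "\<And>j. j \<in> J \<Longrightarrow> \<exists>c>0. \<exists>s>0. \<forall>w\<in>U. cmod (G j w) \<le> c * (cmod w powr s / (1 + cmod w powr (2 * s)))"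
    and U: "0 \<notin> U"
  shows "\<exists>c>0. \<exists>s>0. \<forall>j\<in>J. \<forall>w\<in>U. cmod (G j w) \<le> c * (cmod w powr s / (1 + cmod w powr (2 * s)))"
  using assms(1,2)
proof (induction J rule: finite_induct)
  case empty
  show ?case by (auto intro!: exI[of _ 1])
next
  case (insert i J)
  let ?q = "\<lambda>s w. cmod w powr s / (1 + cmod w powr (2 * s))"
  obtain c s where c: "c > 0" "s > 0" and le: "\<And>j w. j \<in> J \<Longrightarrow> w \<in> U \<Longrightarrow> cmod (G j w) \<le> c * ?q s w"
    using insert.IH insert.prems by auto
  obtain c' s' where c': "c' > 0" "s' > 0" and le': "\<And>w. w \<in> U \<Longrightarrow> cmod (G i w) \<le> c' * ?q s' w"
    using insert.prems[of i] by auto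
  define r where "r = min s s'"
  have r: "r > 0" using c c' by (simp add: r_def)
  have weaken: "?q t w \<le> 2 * ?q r w" if "w \<in> U" "r \<le> t" for t and w :: complex
  proof -
    have wp: "cmod w > 0" using U that by auto
    show ?thesis
    proof (cases "cmod w \<le> 1")
      case True
      have "?q t w \<le> cmod w powr t" by (rule powr_quotient_le(1)[OF wp])
      also have "\<dots> \<le> cmod w powr r" using powr_mono'[OF that(2)] True by simp
      also have "\<dots> \<le> 2 * ?q r w" by (rule powr_quotient_ge(1)[OF wp r True])
      finally show ?thesis .
    next
      case False
      have "?q t w \<le> cmod w powr (- t)" by (rule powr_quotient_le(2)[OF wp])
      also have "\<dots> \<le> cmod w powr (- r)" using that(2) False by (intro powr_mono) auto
      also have "\<dots> \<le> 2 * ?q r w" by (rule powr_quotient_ge(2)[OF wp r]) (use False in simp)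
      finally show ?thesis .
    qed
  qed
  have "cmod (G j w) \<le> (2 * (c + c')) * ?q r w" if j: "j \<in> insert i J" and w: "w \<in> U" for j w
  proof -
    have q0: "?q r w \<ge> 0" by simp
    from j consider "j = i" | "j \<in> J" by blast
    then show ?thesis
    proof cases
      case 1
      have "cmod (G j w) \<le> c' * ?q s' w" using le'[OF w] 1 by simp
      also have "\<dots> \<le> c' * (2 * ?q r w)"
        using weaken[OF w, of s'] c' by (intro mult_left_mono) (auto simp: r_def)
      also have "\<dots> = (2 * c') * ?q r w" by simp
      also have "\<dots> \<le> (2 * (c + c')) * ?q r w" using q0 c by (intro mult_right_mono) auto
      finally show ?thesis .
    next
      case 2
      have "cmod (G j w) \<le> c * ?q s w" using le[OF 2 w] .
      also have "\<dots> \<le> c * (2 * ?q r w)"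
        using weaken[OF w, of s] c by (intro mult_left_mono) (auto simp: r_def)
      also have "\<dots> = (2 * c) * ?q r w" by simp
      also have "\<dots> \<le> (2 * (c + c')) * ?q r w" using q0 c' by (intro mult_right_mono) auto
      finally show ?thesis .
    qed
  qed
  then show ?case using r c c' by (intro exI[of _ "2 * (c + c')"] exI[of _ r] conjI) auto
qed

context Ritt_op
begin

lemma \<Psi>_diff: "\<Psi> j (\<lambda>z. f z - g z) z = \<Psi> j f z - \<Psi> j g z"
proof -
  have "(c - d) *\<^sub>C v = c *\<^sub>C v - d *\<^sub>C v" for c d and v :: "'a \<Rightarrow>\<^sub>L 'a"
    using scaleC_add_left[of c "- d" v] by simp
  then show ?thesis by (simp add: \<Psi>_def scaleC_diff_right)
qed

lemma n_stolz_nonempty: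
  assumes "0 < \<gamma>" "\<gamma> < pi / n"
  shows "n_stolz n \<gamma> \<noteq> {}"
proof -
  have "petal (\<gamma> / 2) (1/2) \<in> stolz_delta \<gamma>"
    using assms acute[of \<gamma>] by (intro petal_mem_sector) auto
  then have "1 - rot n 0 * petal (\<gamma> / 2) (1/2) \<in> n_stolz n \<gamma>"
    unfolding n_stolz_def using n by (intro imageI UN_I[of 0]) auto
  then show ?thesis by blast
qed

lemma n_stolz_n_sector:
  assumes "0 < \<gamma>" "\<gamma> < pi / n" "w \<in> n_stolz n \<gamma>"
  shows "1 - w \<in> n_sector n \<gamma>"
proof -
  obtain j z where "j < n" "z \<in> stolz_delta \<gamma>" "w = 1 - rot n j * z"
    using assms(3) by (auto simp: n_stolz_def)
  moreover have "stolz_delta \<gamma> \<subseteq> sector \<gamma>"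
    using assms acute[of \<gamma>] by (intro stolz_delta_subset_sector) auto
  ultimately show ?thesis unfolding n_sector_def by (intro UN_I[of j]) auto
qed

lemma H0_stolz_of_sector:
  assumes \<gamma>: "0 < \<gamma>" "\<gamma> < pi / n" and g: "g \<in> H0_sector n \<gamma>"
  shows "(\<lambda>w. g (1 - w)) \<in> H0_stolz n \<gamma>"
proof -
  obtain c s where c: "c > 0" "s > 0" and gle: "\<And>z. z \<in> n_sector n \<gamma> \<Longrightarrow> cmod (g z) \<le> c * (cmod z powr s / (1 + cmod z powr (2 * s)))"
    and hol: "g holomorphic_on n_sector n \<gamma>" and bd: "bounded (g ` n_sector n \<gamma>)"
    using g by (auto simp: H0_sector_def)
  have sub: "(\<lambda>w. 1 - w) ` n_stolz n \<gamma> \<subseteq> n_sector n \<gamma>" using n_stolz_n_sector[OF \<gamma>] by auto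
  have "(g \<circ> (\<lambda>w. 1 - w)) holomorphic_on n_stolz n \<gamma>"
    by (intro holomorphic_on_compose holomorphic_intros holomorphic_on_subset[OF hol sub])
  moreover have "bounded ((\<lambda>w. g (1 - w)) ` n_stolz n \<gamma>)"
    by (rule bounded_subset[OF bd]) (use sub in auto)
  moreover have "cmod (g (1 - w)) \<le> c * cmod (1 - w) powr s" if "w \<in> n_stolz n \<gamma>" for w
  proof -
    have m: "1 - w \<in> n_sector n \<gamma>" by (rule n_stolz_n_sector[OF \<gamma> that])
    then have p: "cmod (1 - w) > 0" by (auto simp: n_sector_def sector_def)
    have "c * (cmod (1 - w) powr s / (1 + cmod (1 - w) powr (2 * s))) \<le> c * cmod (1 - w) powr s"
      using powr_quotient_le(1)[OF p] c by (intro mult_left_mono) auto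
    then show ?thesis using gle[OF m] by linarith
  qed
  ultimately show ?thesis using c by (auto simp: H0_stolz_def o_def)
qed

lemma H0_sector_mono:
  assumes "g \<in> H0_sector n \<theta>" "\<theta>' \<le> \<theta>"
  shows "g \<in> H0_sector n \<theta>'"
proof -
  have sub: "n_sector n \<theta>' \<subseteq> n_sector n \<theta>" using sector_mono[OF assms(2)] by (auto simp: n_sector_def)
  then have "g ` n_sector n \<theta>' \<subseteq> g ` n_sector n \<theta>" by blast
  moreover obtain c s where "c > 0" "s > 0" "\<forall>z\<in>n_sector n \<theta>. cmod (g z) \<le> c * (cmod z powr s / (1 + cmod z powr (2 * s)))"
    using assms(1) by (auto simp: H0_sector_def)
  ultimately show ?thesis
    using assms(1) sub bounded_subset holomorphic_on_subset unfolding H0_sector_def by blast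
qed

lemma Ritt_calculus_eq_sectorial_calculus:
  assumes \<gamma>: "\<alpha>0 < \<gamma>" "\<gamma> < pi / n" and g: "g \<in> H0_sector n \<gamma>"
  shows "Ritt_calculus n \<gamma> T (\<lambda>w. g (1 - w)) = sectorial_calculus n \<gamma> UNIV (blinfun_apply A) g"
proof -
  obtain \<beta> where \<beta>: "\<beta> \<in> {\<alpha>0<..<\<gamma>}" using dense[OF \<gamma>(1)] by auto
  have "Ritt_calculus n \<gamma> T (\<lambda>w. g (1 - w)) = (1 / (2 * of_real pi * \<i>)) *\<^sub>C petal_val \<beta> (\<lambda>z. g (1 - (1 - z)))"
    by (rule Ritt_calculus_eq[OF \<gamma> H0_stolz_of_sector \<beta>]) (use \<gamma> \<alpha>0 g in auto)
  also have "petal_val \<beta> (\<lambda>z. g (1 - (1 - z))) = petal_val \<beta> g" by simp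
  also have "\<dots> = sector_val \<beta> g" by (rule sector_val_eq_petal_val[OF \<gamma>(2) g \<beta>, symmetric])
  finally show ?thesis using sectorial_calculus_eq[OF sectorial_A \<gamma> g \<beta>] by simp
qed

lemma quadratic_sectorial_of_Ritt:
  assumes \<gamma>: "\<alpha>0 < \<gamma>" "\<gamma> < pi / n" and q: "quadratic_Ritt_calculus n \<gamma> T"
  shows "quadratic_sectorial_calculus n \<gamma> UNIV (blinfun_apply A)"
proof -
  have \<gamma>0: "0 < \<gamma>" using \<gamma> \<alpha>0 by simp
  obtain K where K: "K > 0" and le: "\<And>N \<phi> x. N \<ge> 1 \<Longrightarrow> (\<And>k. k \<in> {1..N} \<Longrightarrow> \<phi> k \<in> H0_stolz n \<gamma>) \<Longrightarrow>
      L2_Rad_norm (rademacher_sum N (\<lambda>k. blinfun_apply (Ritt_calculus n \<gamma> T (\<phi> k)) x))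
        \<le> K * norm x * square_function_norm (n_stolz n \<gamma>) N \<phi>"
    using q unfolding quadratic_Ritt_calculus_def by blast
  have "L2_Rad_norm (rademacher_sum N (\<lambda>k. blinfun_apply (sectorial_calculus n \<gamma> UNIV (blinfun_apply A) (g k)) x))
        \<le> K * norm x * square_function_norm (n_sector n \<gamma>) N g"
    if N: "N \<ge> 1" and g: "\<forall>k\<in>{1..N}. g k \<in> H0_sector n \<gamma>" for N g x
  proof -
    have bd: "bounded (g k ` n_sector n \<gamma>)" if "k \<in> {1..N}" for k
      using g that by (auto simp: H0_sector_def)
    have "L2_Rad_norm (rademacher_sum N (\<lambda>k. blinfun_apply (sectorial_calculus n \<gamma> UNIV (blinfun_apply A) (g k)) x))
      = L2_Rad_norm (rademacher_sum N (\<lambda>k. blinfun_apply (Ritt_calculus n \<gamma> T (\<lambda>w. g k (1 - w))) x))"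
      unfolding rademacher_sum_def using g
      by (intro arg_cong[of _ _ L2_Rad_norm] ext sum.cong refl) (simp add: Ritt_calculus_eq_sectorial_calculus[OF \<gamma>])
    also have "\<dots> \<le> K * norm x * square_function_norm (n_stolz n \<gamma>) N (\<lambda>k w. g k (1 - w))"
      by (rule le[OF N]) (use g H0_stolz_of_sector[OF \<gamma>0 \<gamma>(2)] in blast)
    also have "\<dots> \<le> K * norm x * square_function_norm (n_sector n \<gamma>) N g"
    proof (rule mult_left_mono)
      show "square_function_norm (n_stolz n \<gamma>) N (\<lambda>k w. g k (1 - w)) \<le> square_function_norm (n_sector n \<gamma>) N g"
        by (rule square_function_norm_least[OF n_stolz_nonempty[OF \<gamma>0 \<gamma>(2)]])
          (rule square_function_norm_upper[OF bd n_stolz_n_sector[OF \<gamma>0 \<gamma>(2)]])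
    qed (use K in simp)
    finally show ?thesis .
  qed
  then show ?thesis
    unfolding quadratic_sectorial_calculus_def using K sectorial_A \<alpha>0 \<gamma> by auto
qed

text \<open>The given calculus may have an angle below the Ritt type, too small for a petal contour
  around the spectrum. It passes to larger angles: functions restrict to the smaller sectors without
  increasing the square function norm, and both calculi are computed on one contour of angle \<nu>
  between \<omega> and \<theta>0.\<close>

lemma quadratic_sectorial_estimate:
  assumes q: "quadratic_sectorial_calculus n \<theta>0 UNIV (blinfun_apply A)" and \<theta>: "\<theta>0 \<le> \<theta>" "\<theta> < pi / n"
  obtains C where "C > 0" "\<And>N g x B. N \<ge> 1 \<Longrightarrow> (\<And>k. k \<in> {1..N} \<Longrightarrow> g k \<in> H0_sector n \<theta>) \<Longrightarrow> B \<ge> 0 \<Longrightarrow>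
      (\<And>z. z \<in> n_sector n \<theta> \<Longrightarrow> (\<Sum>k=1..N. (cmod (g k z))\<^sup>2) \<le> B\<^sup>2) \<Longrightarrow>
      L2_Rad_norm (rademacher_sum N (\<lambda>k. blinfun_apply (sectorial_calculus n \<theta> UNIV (blinfun_apply A) (g k)) x))
        \<le> C * norm x * B"
proof -
  obtain \<omega> where \<omega>: "\<omega> \<in> {0<..<\<theta>0}" and sect: "n_sectorial n \<omega> UNIV (blinfun_apply A)"
    using q unfolding quadratic_sectorial_calculus_def by blast
  obtain C where C: "C > 0" and le: "\<And>N g x. N \<ge> 1 \<Longrightarrow> (\<And>k. k \<in> {1..N} \<Longrightarrow> g k \<in> H0_sector n \<theta>0) \<Longrightarrow>
      L2_Rad_norm (rademacher_sum N (\<lambda>k. blinfun_apply (sectorial_calculus n \<theta>0 UNIV (blinfun_apply A) (g k)) x))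
        \<le> C * norm x * square_function_norm (n_sector n \<theta>0) N g"
    using q unfolding quadratic_sectorial_calculus_def by blast
  obtain \<nu> where \<nu>: "\<nu> \<in> {\<omega><..<\<theta>0}" using dense[of \<omega> \<theta>0] \<omega> by auto
  have eq: "sectorial_calculus n \<theta> UNIV (blinfun_apply A) f = sectorial_calculus n \<theta>0 UNIV (blinfun_apply A) f"
    if f: "f \<in> H0_sector n \<theta>" for f
  proof -
    have "sectorial_calculus n \<theta> UNIV (blinfun_apply A) f = (1 / (2 * of_real pi * \<i>)) *\<^sub>C sector_val \<nu> f"
      by (rule sectorial_calculus_eq[OF sect _ \<theta>(2) f]) (use \<omega> \<nu> \<theta> in auto)
    moreover have "sectorial_calculus n \<theta>0 UNIV (blinfun_apply A) f = (1 / (2 * of_real pi * \<i>)) *\<^sub>C sector_val \<nu> f"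
      by (rule sectorial_calculus_eq[OF sect _ _ H0_sector_mono[OF f \<theta>(1)] \<nu>]) (use \<omega> \<theta> in auto)
    ultimately show ?thesis by simp
  qed
  have sub: "n_sector n \<theta>0 \<subseteq> n_sector n \<theta>" using sector_mono[OF \<theta>(1)] by (auto simp: n_sector_def)
  have ne: "n_sector n \<theta>0 \<noteq> {}"
  proof -
    have "1 \<in> sector \<theta>0" using \<omega> by (simp add: sector_def)
    then have "rot n 0 * 1 \<in> n_sector n \<theta>0"
      unfolding n_sector_def using n by (intro UN_I[of 0] imageI) auto
    then show ?thesis by blast
  qed
  have "L2_Rad_norm (rademacher_sum N (\<lambda>k. blinfun_apply (sectorial_calculus n \<theta> UNIV (blinfun_apply A) (g k)) x))
        \<le> C * norm x * B"
    if N: "N \<ge> 1" and g: "\<And>k. k \<in> {1..N} \<Longrightarrow> g k \<in> H0_sector n \<theta>" and B: "B \<ge> 0"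
      "\<And>z. z \<in> n_sector n \<theta> \<Longrightarrow> (\<Sum>k=1..N. (cmod (g k z))\<^sup>2) \<le> B\<^sup>2" for N g x B
  proof -
    have "L2_Rad_norm (rademacher_sum N (\<lambda>k. blinfun_apply (sectorial_calculus n \<theta> UNIV (blinfun_apply A) (g k)) x))
      = L2_Rad_norm (rademacher_sum N (\<lambda>k. blinfun_apply (sectorial_calculus n \<theta>0 UNIV (blinfun_apply A) (g k)) x))"
      unfolding rademacher_sum_def using g
      by (intro arg_cong[of _ _ L2_Rad_norm] ext sum.cong refl) (simp add: eq)
    also have "\<dots> \<le> C * norm x * square_function_norm (n_sector n \<theta>0) N g"
      by (rule le[OF N H0_sector_mono[OF g \<theta>(1)]])
    also have "\<dots> \<le> C * norm x * B"
    proof (rule mult_left_mono[OF square_function_norm_least[OF ne]])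
      show "sqrt (\<Sum>k=1..N. (cmod (g k z))\<^sup>2) \<le> B" if "z \<in> n_sector n \<theta>0" for z
        using B sub that by (intro real_le_lsqrt) (auto intro: sum_nonneg)
    qed (use C in simp)
    finally show ?thesis .
  qed
  then show thesis using that C by blast
qed

text \<open>The factor |z| in the bound for \<open>e\<close> compensates the singularity 1 / |z| of
  the resolvent. For fixed signs the integrand is a scalar times a common operator; its norm is
  estimated pattern by pattern, and the mean over the patterns is then the square sum of the
  coefficients.\<close>

lemma petal_square_estimate:
  assumes b: "\<alpha>0 < b" "b < pi / n"
  obtains D where "D > 0" "\<And>N e B x. B \<ge> 0 \<Longrightarrow>
      (\<And>j k. j < n \<Longrightarrow> k \<in> {1..N} \<Longrightarrow> continuous_on {0<..<1} (\<lambda>t. e k (rot n j * petal b t))) \<Longrightarrow>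
      (\<And>j k. j < n \<Longrightarrow> k \<in> {1..N} \<Longrightarrow> (\<lambda>t. petal_deriv b t *\<^sub>C \<Psi> j (e k) (petal b t)) integrable_on {0..1}) \<Longrightarrow>
      (\<And>j t. j < n \<Longrightarrow> t \<in> {0<..<1} \<Longrightarrow> (\<Sum>k=1..N. (cmod (e k (rot n j * petal b t)))\<^sup>2) \<le> (B * cmod (petal b t))\<^sup>2) \<Longrightarrow>
      (L2_Rad_norm (rademacher_sum N (\<lambda>k. blinfun_apply ((1 / (2 * of_real pi * \<i>)) *\<^sub>C petal_val b (e k)) x)))\<^sup>2
        \<le> (D * B * norm x)\<^sup>2"
proof -
  obtain \<nu> where \<nu>: "\<alpha>0 < \<nu>" "\<nu> < b" using dense[OF b(1)] by blast
  have \<nu>n: "\<nu> < pi / n" using \<nu> b by simp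
  have b0: "0 < b" "b < pi / 2" using b \<alpha>0(1) acute[of b] by simp_all
  obtain C where C: "C \<ge> 0" "\<And>j z. j < n \<Longrightarrow> z \<in> sector (pi / n) \<Longrightarrow> z \<notin> scaled_discs \<nu> \<Longrightarrow> norm (RA (rot n j * z)) \<le> C / cmod z"
    using RA_bound_scaled_discs[OF \<nu>(1) \<nu>n] by blast
  obtain P where P: "P > 0" "\<And>t. cmod (petal_deriv b t) \<le> P" using petal_deriv_bounded by blast
  have pm: "petal b t \<noteq> 0" "petal b t \<in> sector (pi / n)" "petal b t \<notin> scaled_discs \<nu>" if "t \<in> {0<..<1}" for t
  proof -
    have "petal b t \<in> scaled_discs b - {0}" by (rule petal_mem_scaled_discs[OF b0 that])
    moreover have "scaled_discs b \<subseteq> closed_sector b" by (rule scaled_discs_subset_closed_sector[OF b0])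
    ultimately show "petal b t \<noteq> 0" "petal b t \<in> sector (pi / n)"
      using closed_sector_subset_sector_pi[OF n b0(1) b(2)] by blast+
    show "petal b t \<notin> scaled_discs \<nu>" by (rule petal_not_mem_scaled_discs) (use \<nu> \<alpha>0 b0 that in auto)
  qed
  \<comment> \<open>One factor \<open>P * C\<close> from path speed and resolvent bound, times the
    number of petals; the added 1 makes it positive even if \<open>C\<close> is 0.\<close>
  define D where "D = real n * (P * C) + 1"
  have D: "D > 0" using P C by (simp add: D_def add_nonneg_pos)
  have "(L2_Rad_norm (rademacher_sum N (\<lambda>k. blinfun_apply ((1 / (2 * of_real pi * \<i>)) *\<^sub>C petal_val b (e k)) x)))\<^sup>2
        \<le> (D * B * norm x)\<^sup>2"
    if B: "B \<ge> 0"
      and cont: "\<And>j k. j < n \<Longrightarrow> k \<in> {1..N} \<Longrightarrow> continuous_on {0<..<1} (\<lambda>t. e k (rot n j * petal b t))"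
      and int: "\<And>j k. j < n \<Longrightarrow> k \<in> {1..N} \<Longrightarrow> (\<lambda>t. petal_deriv b t *\<^sub>C \<Psi> j (e k) (petal b t)) integrable_on {0..1}"
      and sq: "\<And>j t. j < n \<Longrightarrow> t \<in> {0<..<1} \<Longrightarrow> (\<Sum>k=1..N. (cmod (e k (rot n j * petal b t)))\<^sup>2) \<le> (B * cmod (petal b t))\<^sup>2"
    for N e B and x :: 'a
  proof -
    define c where "c = P * C * norm x"
    have c: "c \<ge> 0" using P C by (simp add: c_def)
    define E where "E s j t = (\<Sum>k=1..N. s k *\<^sub>R e k (rot n j * petal b t))" for s :: "nat \<Rightarrow> real" and j t
    \<comment> \<open>A scalar majorant of the integrand for the pattern \<open>s\<close>. It is set
      to 0 at the end points, where the petal is at the vertex and the quotient is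
      meaningless.\<close>
    define u where "u s j t = (if t \<in> {0<..<1} then c * cmod (E s j t) / cmod (petal b t) else 0)" for s j t
    have mean: "(\<Sum>s\<in>signs N. 1 / 2 ^ N * (u s j t)\<^sup>2) \<le> (c * B)\<^sup>2" if j: "j < n" for j t
    proof (cases "t \<in> {0<..<1}")
      case True
      have "(\<Sum>s\<in>signs N. 1 / 2 ^ N * (u s j t)\<^sup>2) =
          (c / cmod (petal b t))\<^sup>2 * (\<Sum>s\<in>signs N. 1 / 2 ^ N * (cmod (E s j t))\<^sup>2)"
        using True by (simp add: u_def power_divide power_mult_distrib sum_distrib_left mult_ac)
      also have "(\<Sum>s\<in>signs N. 1 / 2 ^ N * (cmod (E s j t))\<^sup>2) = (\<Sum>k=1..N. (cmod (e k (rot n j * petal b t)))\<^sup>2)"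
        unfolding E_def by (rule signs_mean_square)
      also have "(c / cmod (petal b t))\<^sup>2 * \<dots> \<le> (c / cmod (petal b t))\<^sup>2 * (B * cmod (petal b t))\<^sup>2"
        by (intro mult_left_mono sq j True) simp
      also have "\<dots> = (c * B)\<^sup>2" using pm(1)[OF True] by (simp add: power_divide power_mult_distrib)
      finally show ?thesis .
    next
      case False
      then have "u s j t = 0" for s unfolding u_def by (rule if_not_P)
      then show ?thesis by simp
    qed
    \<comment> \<open>A single pattern has weight 2^(-N) in the mean, so the bound on the mean gives
      a crude pointwise bound; it serves integrability only.\<close>
    have u_int: "u s j integrable_on {0..1}" if s: "s \<in> signs N" and j: "j < n" for s j
    proof (rule integrable_dominated[where g = "\<lambda>_. sqrt (2 ^ N * (c * B)\<^sup>2)"])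
      have cp: "continuous_on {0<..<1} (petal b)" by (rule continuous_on_subset[OF continuous_on_petal]) auto
      have "continuous_on {0<..<1} (\<lambda>t. c * cmod (E s j t) / cmod (petal b t))"
        unfolding E_def using pm(1) by (intro continuous_intros cont j cp) auto
      then show "continuous_on {0<..<1} (u s j)"
        by (rule continuous_on_eq) (simp add: u_def)
      show "norm (u s j t) \<le> sqrt (2 ^ N * (c * B)\<^sup>2)" for t
      proof -
        have "1 / 2 ^ N * (u s j t)\<^sup>2 \<le> (\<Sum>s\<in>signs N. 1 / 2 ^ N * (u s j t)\<^sup>2)"
          by (rule member_le_sum[OF s _ finite_signs]) simp
        also have "\<dots> \<le> (c * B)\<^sup>2" by (rule mean[OF j])
        finally have "(u s j t)\<^sup>2 \<le> 2 ^ N * (c * B)\<^sup>2" by (simp add: field_simps)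
        then have "sqrt ((u s j t)\<^sup>2) \<le> sqrt (2 ^ N * (c * B)\<^sup>2)" by (rule real_sqrt_le_mono)
        then show ?thesis by (simp only: real_sqrt_abs real_norm_def)
      qed
    qed auto
    have each: "(\<Sum>s\<in>signs N. 1 / 2 ^ N * (integral {0..1} (u s j))\<^sup>2) \<le> (c * B)\<^sup>2" if j: "j < n" for j
      by (rule integral_square_sum_le[OF finite_signs _ u_int[OF _ j] mean[OF j]]) simp_all
    have bnd: "norm (\<Sum>k=1..N. s k *\<^sub>R blinfun_apply ((1 / (2 * of_real pi * \<i>)) *\<^sub>C petal_val b (e k)) x)
        \<le> (\<Sum>j<n. integral {0..1} (u s j))" if s: "s \<in> signs N" for s
    proof -
      let ?F = "\<lambda>j k t. petal_deriv b t *\<^sub>C \<Psi> j (e k) (petal b t)"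
      let ?I = "\<lambda>j k. blinfun_apply (integral {0..1} (?F j k)) x"
      have hi: "((\<lambda>t. \<Sum>k=1..N. s k *\<^sub>R blinfun_apply (?F j k t) x) has_integral (\<Sum>k=1..N. s k *\<^sub>R ?I j k)) {0..1}"
        if j: "j < n" for j
      proof (intro has_integral_sum has_integral_cmul)
        fix k assume k: "k \<in> {1..N}"
        have "((\<lambda>v. blinfun_apply v x) \<circ> ?F j k has_integral ?I j k) {0..1}"
          by (rule has_integral_linear[OF _ blinfun.bounded_linear_left])
            (use int[OF j k] in \<open>simp add: has_integral_integral\<close>)
        then show "((\<lambda>t. blinfun_apply (?F j k t) x) has_integral ?I j k) {0..1}" by (simp add: o_def)
      qed simp
      have "norm (\<Sum>k=1..N. s k *\<^sub>R ?I j k) \<le> integral {0..1} (u s j)" if j: "j < n" for j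
      proof -
        let ?G = "\<lambda>t. if t \<in> {0<..<1} then \<Sum>k=1..N. s k *\<^sub>R blinfun_apply (?F j k t) x else 0"
        have G: "(?G has_integral (\<Sum>k=1..N. s k *\<^sub>R ?I j k)) {0..1}"
        proof (rule has_integral_spike_finite[OF _ _ hi[OF j]])
          show "finite {0 :: real, 1}" by simp
          show "?G t = (\<Sum>k=1..N. s k *\<^sub>R blinfun_apply (?F j k t) x)" if "t \<in> {0..1} - {0, 1}" for t
            by (rule if_P) (use that in auto)
        qed
        have "norm (integral {0..1} ?G) \<le> integral {0..1} (u s j)"
        proof (rule integral_norm_bound_integral)
          show "?G integrable_on {0..1}" by (rule has_integral_integrable[OF G])
          show "u s j integrable_on {0..1}" by (rule u_int[OF s j])
          fix t :: real assume "t \<in> {0..1}"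
          show "norm (?G t) \<le> u s j t"
          proof (cases "t \<in> {0<..<1}")
            case True
            let ?R = "blinfun_apply (RA (rot n j * petal b t)) x"
            \<comment> \<open>The operator does not depend on \<open>k\<close>, so the sum over
              \<open>k\<close> collapses to the scalar \<open>E s j t\<close> in front of
              it.\<close>
            have sc: "s k *\<^sub>R blinfun_apply (?F j k t) x =
                (s k *\<^sub>R e k (rot n j * petal b t)) *\<^sub>C ((petal_deriv b t * rot n j) *\<^sub>C ?R)" for k
              by (simp add: \<Psi>_def scaleC_blinfun.rep_eq scaleC_scaleC scaleR_scaleC scaleR_conv_of_real mult_ac)
            have sumC: "(\<Sum>k=1..N. a k *\<^sub>C v) = (\<Sum>k=1..N. a k) *\<^sub>C v" for a and v :: 'a
              using bounded_bilinear.sum_left[OF bounded_bilinear_scaleC, of a "{1..N}" v] by simp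
            have "norm (\<Sum>k=1..N. s k *\<^sub>R blinfun_apply (?F j k t) x) =
                cmod (E s j t) * (cmod (petal_deriv b t) * norm ?R)"
              unfolding sc sumC E_def[symmetric] by (simp add: norm_scaleC norm_mult)
            also have "\<dots> \<le> cmod (E s j t) * (P * ((C / cmod (petal b t)) * norm x))"
            proof (intro mult_left_mono mult_mono)
              have "norm ?R \<le> norm (RA (rot n j * petal b t)) * norm x" by (rule norm_blinfun)
              also have "\<dots> \<le> (C / cmod (petal b t)) * norm x"
                using C(2)[OF j pm(2,3)[OF True]] by (intro mult_right_mono) auto
              finally show "norm ?R \<le> (C / cmod (petal b t)) * norm x" .
            qed (use P in \<open>auto intro: less_imp_le\<close>)
            also have "\<dots> = u s j t" using True by (simp add: u_def c_def)
            finally show ?thesis unfolding if_P[OF True] .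
          next
            case False
            then show ?thesis unfolding u_def by (simp only: if_False norm_zero)
          qed
        qed
        then show ?thesis by (simp only: integral_unique[OF G])
      qed
      then have "norm (\<Sum>j<n. \<Sum>k=1..N. s k *\<^sub>R ?I j k) \<le> (\<Sum>j<n. integral {0..1} (u s j))"
        by (rule sum_norm_le) simp
      moreover have "(\<Sum>k=1..N. s k *\<^sub>R blinfun_apply ((1 / (2 * of_real pi * \<i>)) *\<^sub>C petal_val b (e k)) x)
         = (1 / (2 * of_real pi * \<i>)) *\<^sub>C (\<Sum>j<n. \<Sum>k=1..N. s k *\<^sub>R ?I j k)"
      proof -
        have csum: "c *\<^sub>C sum f X = (\<Sum>i\<in>X. c *\<^sub>C f i)" for c X and f :: "nat \<Rightarrow> 'a"
          by (rule bounded_bilinear.sum_right[OF bounded_bilinear_scaleC])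
        have "s k *\<^sub>R blinfun_apply ((1 / (2 * of_real pi * \<i>)) *\<^sub>C petal_val b (e k)) x
          = (\<Sum>j<n. (1 / (2 * of_real pi * \<i>)) *\<^sub>C (s k *\<^sub>R ?I j k))" for k
          by (simp only: petal_val_def scaleC_blinfun.rep_eq blinfun.sum_left scaleR_scaleC scaleC_scaleC csum
              mult.commute[of "complex_of_real (s k)"])
        then show ?thesis
          by (simp only: csum) (rule sum.swap)
      qed
      moreover have "norm ((1 / (2 * of_real pi * \<i>)) *\<^sub>C v) \<le> norm v" for v :: 'a
      proof -
        have "cmod (1 / (2 * of_real pi * \<i>)) \<le> 1" using pi_gt3 by (simp add: norm_divide norm_mult)
        then show ?thesis by (simp only: norm_scaleC) (rule mult_left_le_one_le; simp)
      qed
      ultimately show ?thesis by (metis (no_types, lifting) order_trans)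
    qed
    have "(L2_Rad_norm (rademacher_sum N (\<lambda>k. blinfun_apply ((1 / (2 * of_real pi * \<i>)) *\<^sub>C petal_val b (e k)) x)))\<^sup>2
      \<le> (\<Sum>s\<in>signs N. 1 / 2 ^ N * (real n * (\<Sum>j<n. (integral {0..1} (u s j))\<^sup>2)))"
      unfolding L2_Rad_norm_rademacher_sum
    proof (intro sum_mono mult_left_mono)
      fix s assume s: "s \<in> signs N"
      have "(norm (\<Sum>k=1..N. s k *\<^sub>R blinfun_apply ((1 / (2 * of_real pi * \<i>)) *\<^sub>C petal_val b (e k)) x))\<^sup>2
         \<le> (\<Sum>j<n. integral {0..1} (u s j))\<^sup>2" by (rule power_mono[OF bnd[OF s]]) simp
      \<comment> \<open>Cauchy-Schwarz over the petals; this factor \<open>n\<close> and the later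
        sum over \<open>n\<close> petals make up the square of \<open>n\<close> in the
        constant.\<close>
      also have "\<dots> \<le> (\<Sum>j<n. (integral {0..1} (u s j))\<^sup>2) * card {..<n}" by (rule sum_squared_le_sum_of_squares)
      finally show "(norm (\<Sum>k=1..N. s k *\<^sub>R blinfun_apply ((1 / (2 * of_real pi * \<i>)) *\<^sub>C petal_val b (e k)) x))\<^sup>2
         \<le> real n * (\<Sum>j<n. (integral {0..1} (u s j))\<^sup>2)" by (simp add: mult.commute)
    qed simp
    also have "\<dots> = real n * (\<Sum>j<n. \<Sum>s\<in>signs N. 1 / 2 ^ N * (integral {0..1} (u s j))\<^sup>2)"
      by (subst sum.swap) (simp add: sum_distrib_left mult_ac)
    also have "\<dots> \<le> real n * (\<Sum>j<n. (c * B)\<^sup>2)"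
      by (intro mult_left_mono sum_mono each) auto
    also have "\<dots> = (real n * (P * C) * B * norm x)\<^sup>2"
      by (simp add: c_def power2_eq_square mult_ac)
    also have "\<dots> \<le> (D * B * norm x)\<^sup>2"
      using P C B by (intro power_mono mult_right_mono) (auto simp: D_def)
    finally show ?thesis .
  qed
  then show thesis using that D by blast
qed

end

section \<open>From the sectorial to the Ritt estimate\<close>

context Ritt_op
begin

lemma quadratic_Ritt_of_sectorial:
  assumes q: "quadratic_sectorial_calculus n \<theta>0 UNIV (blinfun_apply A)" and \<theta>0: "\<theta>0 < pi / n"
  shows "\<exists>\<gamma>\<in>{0<..<pi / n}. quadratic_Ritt_calculus n \<gamma> T"
proof -
  \<comment> \<open>The angles satisfy \<alpha>0 < b < \<theta> < \<beta> < \<gamma> < pi / n: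
    \<open>b\<close> carries the contour, \<theta> the sector of \<open>g\<close>, \<beta> the
    triangle, and \<gamma> the domain of \<open>\<phi>\<close>. The angle \<theta> exceeds \<theta>0
    for the estimate of \<open>g(A)\<close> and \<alpha>0 so that the contour fits between spectrum
    and sector.\<close>
  obtain \<theta> where \<theta>: "max \<theta>0 \<alpha>0 < \<theta>" "\<theta> < pi / n" using dense[of "max \<theta>0 \<alpha>0" "pi / n"] \<theta>0 \<alpha>0 by auto
  obtain \<gamma> where \<gamma>: "\<theta> < \<gamma>" "\<gamma> < pi / n" using dense[OF \<theta>(2)] by blast
  obtain \<beta> where \<beta>: "\<theta> < \<beta>" "\<beta> < \<gamma>" using dense[OF \<gamma>(1)] by blast
  obtain b where b: "\<alpha>0 < b" "b < \<theta>" using dense[of \<alpha>0 \<theta>] \<theta> by auto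
  have pos: "0 < \<theta>" "0 < \<gamma>" "0 < b" "\<alpha>0 < \<gamma>" "\<alpha>0 < \<theta>" "b < \<gamma>" "b < pi / n" using \<theta> \<gamma> b \<alpha>0 by auto
  have ac: "\<theta> < pi / 2" "\<gamma> < pi / 2" using acute \<theta> \<gamma> by auto
  interpret D: decomposition \<theta> \<beta> \<gamma>
    by unfold_locales (use pos \<beta> ac in auto)
  obtain C0 where C0: "C0 > 0" and C0_le: "\<And>N g x B. N \<ge> 1 \<Longrightarrow> (\<And>k. k \<in> {1..N} \<Longrightarrow> g k \<in> H0_sector n \<theta>) \<Longrightarrow> B \<ge> 0 \<Longrightarrow>
      (\<And>z. z \<in> n_sector n \<theta> \<Longrightarrow> (\<Sum>k=1..N. (cmod (g k z))\<^sup>2) \<le> B\<^sup>2) \<Longrightarrow>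
      L2_Rad_norm (rademacher_sum N (\<lambda>k. blinfun_apply (sectorial_calculus n \<theta> UNIV (blinfun_apply A) (g k)) x))
        \<le> C0 * norm x * B"
    using quadratic_sectorial_estimate[OF q _ \<theta>(2)] \<theta>(1) by (metis less_imp_le max_less_iff_conj)
  obtain D0 where D0: "D0 > 0" and D0_le: "\<And>N e B x. B \<ge> 0 \<Longrightarrow>
      (\<And>j k. j < n \<Longrightarrow> k \<in> {1..N} \<Longrightarrow> continuous_on {0<..<1} (\<lambda>t. e k (rot n j * petal b t))) \<Longrightarrow>
      (\<And>j k. j < n \<Longrightarrow> k \<in> {1..N} \<Longrightarrow> (\<lambda>t. petal_deriv b t *\<^sub>C \<Psi> j (e k) (petal b t)) integrable_on {0..1}) \<Longrightarrow>
      (\<And>j t. j < n \<Longrightarrow> t \<in> {0<..<1} \<Longrightarrow> (\<Sum>k=1..N. (cmod (e k (rot n j * petal b t)))\<^sup>2) \<le> (B * cmod (petal b t))\<^sup>2) \<Longrightarrow>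
      (L2_Rad_norm (rademacher_sum N (\<lambda>k. blinfun_apply ((1 / (2 * of_real pi * \<i>)) *\<^sub>C petal_val b (e k)) x)))\<^sup>2
        \<le> (D0 * B * norm x)\<^sup>2"
    using petal_square_estimate[OF b(1) pos(7)] by blast
  have p_sec: "petal b t \<in> sector \<theta>" and p_st: "petal b t \<in> stolz_delta \<gamma>" and p_K: "petal b t \<notin> scaled_discs \<alpha>0"
    if "t \<in> {0<..<1}" for t
    using petal_mem_sector(1)[OF pos(3) b(2) ac(1) that] petal_mem_sector(2)[OF pos(3) pos(6) ac(2) that]
      petal_not_mem_scaled_discs[OF \<alpha>0(1) b(1) _ that] pos b ac by auto
  define K where "K = 2 * (C0 * D.K3) + 2 * (D0 * D.K4)"
  have K: "K > 0" using C0 D0 D.K34_pos by (simp add: K_def add_pos_pos)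
  have main: "L2_Rad_norm (rademacher_sum N (\<lambda>k. blinfun_apply (Ritt_calculus n \<gamma> T (\<phi> k)) x))
      \<le> K * norm x * square_function_norm (n_stolz n \<gamma>) N \<phi>"
    if N: "N \<ge> 1" and \<phi>: "\<And>k. k \<in> {1..N} \<Longrightarrow> \<phi> k \<in> H0_stolz n \<gamma>" for N \<phi> x
  proof -
    define M where "M = square_function_norm (n_stolz n \<gamma>) N \<phi>"
    have bd: "bounded (\<phi> k ` n_stolz n \<gamma>)" if "k \<in> {1..N}" for k using \<phi>[OF that] by (simp add: H0_stolz_def)
    have Mw: "sqrt (\<Sum>k=1..N. (cmod (\<phi> k w))\<^sup>2) \<le> M" if "w \<in> n_stolz n \<gamma>" for w
      unfolding M_def by (rule square_function_norm_upper[OF bd that])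
    obtain w0 where "w0 \<in> n_stolz n \<gamma>" using n_stolz_nonempty[OF pos(2) \<gamma>(2)] by blast
    then have M: "M \<ge> 0" using Mw[of w0] by (meson order_trans real_sqrt_ge_zero sum_nonneg zero_le_power2)
    define f where "f k z = \<phi> k (1 - z)" for k z
    define F where "F j k z = f k (rot n j * z)" for j k z
    have mem: "1 - rot n j * z \<in> n_stolz n \<gamma>" if "j < n" "z \<in> stolz_delta \<gamma>" for j z
      using that by (auto simp: n_stolz_def)
    have van: "D.vanishing (F j k)" if j: "j < n" and k: "k \<in> {1..N}" for j k
    proof -
      obtain c s where c: "c > 0" "s > 0" and le: "\<And>z. z \<in> n_stolz n \<gamma> \<Longrightarrow> cmod (\<phi> k z) \<le> c * cmod (1 - z) powr s"
        and hol: "\<phi> k holomorphic_on n_stolz n \<gamma>"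
        using \<phi>[OF k] by (auto simp: H0_stolz_def)
      have "(\<phi> k \<circ> (\<lambda>z. 1 - rot n j * z)) holomorphic_on stolz_delta \<gamma>"
        by (intro holomorphic_on_compose holomorphic_intros holomorphic_on_subset[OF hol]) (use mem[OF j] in auto)
      moreover have "cmod (F j k z) \<le> c * cmod z powr s" if "z \<in> stolz_delta \<gamma>" for z
        using le[OF mem[OF j that]] by (simp add: F_def f_def norm_mult)
      ultimately show ?thesis
        unfolding D.vanishing_def using c by (auto simp: F_def[abs_def] f_def o_def)
    qed
    have MF: "(\<Sum>k=1..N. (cmod (F j k z))\<^sup>2) \<le> M\<^sup>2" if "j < n" "z \<in> stolz_delta \<gamma>" for j z
      using Mw[OF mem[OF that]] unfolding F_def f_def by (rule sqrt_le_D)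
    \<comment> \<open>The splitting is made petal by petal, and \<open>g\<close> is put together
      from the \<open>n\<close> transfers. On \<open>n_sector n \<theta>\<close> the choice is
      forced, because the rotated sectors are disjoint.\<close>
    define idx where "idx w = (SOME j. j < n \<and> w / rot n j \<in> sector \<theta>)" for w
    have idx: "idx (rot n j * z) = j" if j: "j < n" and z: "z \<in> sector \<theta>" for j z
    proof -
      have sub: "sector \<theta> \<subseteq> sector (pi / n)" using \<theta> by (intro sector_mono) simp
      let ?i = "idx (rot n j * z)"
      have "?i < n \<and> (rot n j * z) / rot n ?i \<in> sector \<theta>"
        unfolding idx_def by (rule someI[of _ j]) (use j z in auto)
      moreover have "rot n j * z = rot n ?i * ((rot n j * z) / rot n ?i)" by simp
      ultimately show ?thesis using rot_mult_inj[of n ?i j z "(rot n j * z) / rot n ?i"] sub z j n by blast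
    qed
    define g where "g k w = D.transfer (F (idx w) k) (w / rot n (idx w))" for k w
    have g_rot: "g k (rot n j * z) = D.transfer (F j k) z" if "j < n" "z \<in> sector \<theta>" for k j z
      using idx[OF that] by (simp add: g_def)
    have g_sq: "(\<Sum>k=1..N. (cmod (g k w))\<^sup>2) \<le> (D.K3 * M)\<^sup>2" if w: "w \<in> n_sector n \<theta>" for w
    proof -
      obtain j z where j: "j < n" and z: "z \<in> sector \<theta>" and w: "w = rot n j * z" using w by (auto simp: n_sector_def)
      have "(\<Sum>k\<in>{1..N}. (cmod (D.transfer (F j k) z))\<^sup>2) \<le> (D.K3 * M)\<^sup>2"
        by (rule D.transfer_bounded[OF finite_atLeastAtMost van[OF j] MF[OF j] M z])
      then show ?thesis unfolding w g_rot[OF j z] .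
    qed
    have gH: "g k \<in> H0_sector n \<theta>" if k: "k \<in> {1..N}" for k
    proof -
      have open_rot: "open ((\<lambda>z. rot n j * z) ` sector \<theta>)" for j
        by (rule open_rot_image[OF open_sector[OF pos(1) ac(1)]])
      have "g k holomorphic_on n_sector n \<theta>"
        unfolding n_sector_def
      proof (rule holomorphic_on_UN_open[OF _ open_rot])
        fix j assume "j \<in> {..<n}"
        then have j: "j < n" by simp
        have "(D.transfer (F j k) \<circ> (\<lambda>w. w / rot n j)) holomorphic_on (\<lambda>z. rot n j * z) ` sector \<theta>"
          by (intro holomorphic_on_compose holomorphic_intros holomorphic_on_subset[OF D.holomorphic_transfer[OF van[OF j k]]]) auto
        then show "g k holomorphic_on (\<lambda>z. rot n j * z) ` sector \<theta>"
          by (rule holomorphic_transform) (auto simp: g_rot[OF j])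
      qed
      moreover have "bounded (g k ` n_sector n \<theta>)"
      proof (rule boundedI)
        fix y assume "y \<in> g k ` n_sector n \<theta>"
        then obtain w where w: "w \<in> n_sector n \<theta>" "y = g k w" by blast
        have "(cmod (g k w))\<^sup>2 \<le> (\<Sum>k=1..N. (cmod (g k w))\<^sup>2)" by (rule member_le_sum[OF k]) auto
        also have "\<dots> \<le> (D.K3 * M)\<^sup>2" by (rule g_sq[OF w(1)])
        finally have "cmod (g k w) \<le> D.K3 * M"
          by (rule power2_le_imp_le) (use D.K34_pos M in simp)
        then show "norm y \<le> D.K3 * M" using w by simp
      qed
      moreover have "\<exists>c>0. \<exists>s>0. \<forall>w\<in>n_sector n \<theta>. cmod (g k w) \<le> c * (cmod w powr s / (1 + cmod w powr (2 * s)))"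
      proof -
        have "\<exists>c>0. \<exists>s>0. \<forall>w\<in>sector \<theta>. cmod (D.transfer (F j k) w) \<le> c * (cmod w powr s / (1 + cmod w powr (2 * s)))"
          if "j \<in> {..<n}" for j
        proof (rule D.transfer_decay[OF van[OF _ k]])
          fix z assume z: "z \<in> stolz_delta \<gamma>"
          have "(cmod (F j k z))\<^sup>2 \<le> (\<Sum>k=1..N. (cmod (F j k z))\<^sup>2)" by (rule member_le_sum[OF k]) auto
          also have "\<dots> \<le> M\<^sup>2" by (rule MF[OF _ z]) (use that in simp)
          finally show "cmod (F j k z) \<le> M" using M by (rule power2_le_imp_le)
        qed (use that in simp)
        then have "\<exists>c>0. \<exists>s>0. \<forall>j\<in>{..<n}. \<forall>w\<in>sector \<theta>.
            cmod (D.transfer (F j k) w) \<le> c * (cmod w powr s / (1 + cmod w powr (2 * s)))"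
          by (rule common_decay[OF finite_lessThan]) (auto simp: sector_def)
        then obtain c s where c: "c > 0" "s > 0" and le: "\<And>j w. j < n \<Longrightarrow> w \<in> sector \<theta> \<Longrightarrow>
            cmod (D.transfer (F j k) w) \<le> c * (cmod w powr s / (1 + cmod w powr (2 * s)))"
          by auto
        have "cmod (g k w) \<le> c * (cmod w powr s / (1 + cmod w powr (2 * s)))" if w: "w \<in> n_sector n \<theta>" for w
        proof -
          obtain j z where j: "j < n" and z: "z \<in> sector \<theta>" and w: "w = rot n j * z" using w by (auto simp: n_sector_def)
          have "cmod w = cmod z" by (simp add: w norm_mult)
          then show ?thesis using le[OF j z] unfolding w g_rot[OF j z] by simp
        qed
        then show ?thesis using c by blast
      qed
      ultimately show ?thesis by (simp add: H0_sector_def)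
    qed
    define e where "e k z = f k z - g k z" for k z
    have e_sq: "(\<Sum>k=1..N. (cmod (e k (rot n j * petal b t)))\<^sup>2) \<le> (D.K4 * M * cmod (petal b t))\<^sup>2"
      if j: "j < n" and t: "t \<in> {0<..<1}" for j t
    proof -
      have "(\<Sum>k\<in>{1..N}. (cmod (F j k (petal b t) - D.transfer (F j k) (petal b t)))\<^sup>2) \<le> (D.K4 * M * cmod (petal b t))\<^sup>2"
        by (rule D.transfer_diff_bounded[OF finite_atLeastAtMost van[OF j] MF[OF j] M p_sec[OF t] p_st[OF t]])
      then show ?thesis unfolding e_def g_rot[OF j p_sec[OF t]] F_def .
    qed
    have e_cont: "continuous_on {0<..<1} (\<lambda>t. e k (rot n j * petal b t))" if j: "j < n" and k: "k \<in> {1..N}" for j k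
    proof -
      have cp: "continuous_on {0<..<1} (petal b)" by (rule continuous_on_subset[OF continuous_on_petal]) auto
      have "F j k holomorphic_on stolz_delta \<gamma>" using van[OF j k] by (simp add: D.vanishing_def)
      then have 1: "continuous_on {0<..<1} (\<lambda>t. F j k (petal b t))"
        by (intro continuous_on_compose2[OF holomorphic_on_imp_continuous_on cp]) (use p_st in auto)
      have 2: "continuous_on {0<..<1} (\<lambda>t. D.transfer (F j k) (petal b t))"
        by (rule continuous_on_compose2[OF holomorphic_on_imp_continuous_on[OF D.holomorphic_transfer[OF van[OF j k]]] cp])
          (use p_sec in auto)
      show ?thesis
        by (rule continuous_on_eq[OF continuous_on_diff[OF 1 2]]) (simp add: e_def F_def g_rot[OF j p_sec])
    qed
    have f_int: "(\<lambda>t. petal_deriv b t *\<^sub>C \<Psi> j (f k) (petal b t)) integrable_on {0..1}"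
      and g_int: "(\<lambda>t. petal_deriv b t *\<^sub>C \<Psi> j (g k) (petal b t)) integrable_on {0..1}"
      if j: "j < n" and k: "k \<in> {1..N}" for j k
    proof -
      obtain s where "cone_fun (\<Psi> j (\<lambda>z. \<phi> k (1 - z))) (stolz_delta \<gamma> - scaled_discs \<alpha>0) \<alpha>0 \<gamma> (cos \<gamma>) s"
        using cone_fun_\<Psi>[OF pos(4) \<gamma>(2) \<phi>[OF k] j] by blast
      from cone_fun.petal_integrable[OF this b(1) pos(6)]
      show "(\<lambda>t. petal_deriv b t *\<^sub>C \<Psi> j (f k) (petal b t)) integrable_on {0..1}"
        using p_st p_K by (simp add: f_def[abs_def])
      obtain s where "cone_fun_inf (\<Psi> j (g k)) (sector \<theta> - (scaled_discs \<alpha>0 \<inter> closed_sector \<alpha>0)) \<alpha>0 \<theta> 3 s"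
        using cone_fun_inf_\<Psi>[OF angle_of_type_\<alpha>0 pos(5) \<theta>(2) gH[OF k] j] by blast
      from cone_fun.petal_integrable[OF cone_fun_inf.axioms(1)[OF this] b]
      show "(\<lambda>t. petal_deriv b t *\<^sub>C \<Psi> j (g k) (petal b t)) integrable_on {0..1}"
        using p_sec p_K by simp
    qed
    have e_eq: "(\<lambda>t. petal_deriv b t *\<^sub>C \<Psi> j (e k) (petal b t)) =
        (\<lambda>t. petal_deriv b t *\<^sub>C \<Psi> j (f k) (petal b t) - petal_deriv b t *\<^sub>C \<Psi> j (g k) (petal b t))" for j k
      by (simp add: e_def[abs_def] \<Psi>_diff scaleC_diff_right)
    have e_int: "(\<lambda>t. petal_deriv b t *\<^sub>C \<Psi> j (e k) (petal b t)) integrable_on {0..1}"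
      if "j < n" "k \<in> {1..N}" for j k
      unfolding e_eq by (intro integrable_diff f_int g_int that)
    have e_val: "petal_val b (e k) = petal_val b (f k) - petal_val b (g k)" if k: "k \<in> {1..N}" for k
      unfolding petal_val_def e_eq sum_subtractf[symmetric]
      by (intro sum.cong refl Henstock_Kurzweil_Integration.integral_diff f_int g_int k) auto
    let ?c = "1 / (2 * of_real pi * \<i>) :: complex"
    have Ritt: "Ritt_calculus n \<gamma> T (\<phi> k) = ?c *\<^sub>C petal_val b (f k)" if "k \<in> {1..N}" for k
      unfolding f_def[abs_def] by (rule Ritt_calculus_eq[OF pos(4) \<gamma>(2) \<phi>[OF that]]) (use b pos in simp)
    have sect: "sectorial_calculus n \<theta> UNIV (blinfun_apply A) (g k) = ?c *\<^sub>C petal_val b (g k)" if "k \<in> {1..N}" for k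
    proof -
      have "b \<in> {\<alpha>0<..<\<theta>}" using b by simp
      from sectorial_calculus_eq[OF sectorial_A pos(5) \<theta>(2) gH[OF that] this] sector_val_eq_petal_val[OF \<theta>(2) gH[OF that] this]
      show ?thesis by simp
    qed
    let ?L = "\<lambda>S. L2_Rad_norm (rademacher_sum N (\<lambda>k. blinfun_apply (S k) x))"
    have "(?L (\<lambda>k. Ritt_calculus n \<gamma> T (\<phi> k)))\<^sup>2 \<le>
        2 * (?L (\<lambda>k. sectorial_calculus n \<theta> UNIV (blinfun_apply A) (g k)))\<^sup>2 + 2 * (?L (\<lambda>k. ?c *\<^sub>C petal_val b (e k)))\<^sup>2"
    proof (rule L2_Rad_norm_add_le)
      fix k assume k: "k \<in> {1..N}"
      have "Ritt_calculus n \<gamma> T (\<phi> k) = sectorial_calculus n \<theta> UNIV (blinfun_apply A) (g k) + ?c *\<^sub>C petal_val b (e k)"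
        unfolding Ritt[OF k] sect[OF k] e_val[OF k] scaleC_diff_right by simp
      then show "blinfun_apply (Ritt_calculus n \<gamma> T (\<phi> k)) x =
          blinfun_apply (sectorial_calculus n \<theta> UNIV (blinfun_apply A) (g k)) x + blinfun_apply (?c *\<^sub>C petal_val b (e k)) x"
        by (simp only: blinfun.add_left)
    qed
    also have "\<dots> \<le> 2 * (C0 * norm x * (D.K3 * M))\<^sup>2 + 2 * (D0 * (D.K4 * M) * norm x)\<^sup>2"
    proof (intro add_mono mult_left_mono)
      have "?L (\<lambda>k. sectorial_calculus n \<theta> UNIV (blinfun_apply A) (g k)) \<le> C0 * norm x * (D.K3 * M)"
        by (rule C0_le[OF N gH _ g_sq]) (use D.K34_pos M in auto)
      then show "(?L (\<lambda>k. sectorial_calculus n \<theta> UNIV (blinfun_apply A) (g k)))\<^sup>2 \<le> (C0 * norm x * (D.K3 * M))\<^sup>2"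
        by (rule power_mono[OF _ L2_Rad_norm_nonneg])
      show "(?L (\<lambda>k. ?c *\<^sub>C petal_val b (e k)))\<^sup>2 \<le> (D0 * (D.K4 * M) * norm x)\<^sup>2"
        by (rule D0_le[OF _ e_cont e_int e_sq]) (use D.K34_pos M in auto)
    qed auto
    also have "\<dots> \<le> (2 * (C0 * norm x * (D.K3 * M)) + 2 * (D0 * (D.K4 * M) * norm x))\<^sup>2"
    proof -
      have "2 * p\<^sup>2 + 2 * r\<^sup>2 \<le> (2 * p + 2 * r)\<^sup>2" if "p \<ge> 0" "r \<ge> 0" for p r :: real
      proof -
        have "(2 * p + 2 * r)\<^sup>2 = 2 * p\<^sup>2 + 2 * r\<^sup>2 + (2 * p\<^sup>2 + 2 * r\<^sup>2 + 8 * (p * r))"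
          by (simp add: power2_eq_square algebra_simps)
        moreover have "2 * p\<^sup>2 + 2 * r\<^sup>2 + 8 * (p * r) \<ge> 0" using that by simp
        ultimately show ?thesis by linarith
      qed
      then show ?thesis using C0 D0 D.K34_pos M by simp
    qed
    also have "2 * (C0 * norm x * (D.K3 * M)) + 2 * (D0 * (D.K4 * M) * norm x) = K * norm x * M"
      by (simp add: K_def algebra_simps)
    finally have "?L (\<lambda>k. Ritt_calculus n \<gamma> T (\<phi> k)) \<le> K * norm x * M"
      by (rule power2_le_imp_le) (use K M in simp)
    then show ?thesis by (simp add: M_def)
  qed
  have "quadratic_Ritt_calculus n \<gamma> T"
    unfolding quadratic_Ritt_calculus_def
  proof (intro conjI)
    show "\<exists>\<alpha>\<in>{0<..<\<gamma>}. n_Ritt_type n \<alpha> T" using T \<alpha>0 pos by (intro bexI[of _ \<alpha>0]) auto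
    show "\<exists>K>0. \<forall>N\<ge>1. \<forall>\<phi>. (\<forall>k\<in>{1..N}. \<phi> k \<in> H0_stolz n \<gamma>) \<longrightarrow> (\<forall>x.
        L2_Rad_norm (rademacher_sum N (\<lambda>k. blinfun_apply (Ritt_calculus n \<gamma> T (\<phi> k)) x))
          \<le> K * norm x * square_function_norm (n_stolz n \<gamma>) N \<phi>)"
      using K main by (intro exI[of _ K]) blast
  qed
  then show ?thesis using pos \<gamma> by (intro bexI[of _ \<gamma>]) auto
qed

end

theorem theorem5p3:
  fixes n :: nat and T A :: "'a :: complex_banach \<Rightarrow>\<^sub>L 'a"
  assumes "n > 1" and "n_Ritt n T" and "A = id_blinfun - T"
  shows "(\<exists>\<gamma>\<in>{0<..<pi / real n}. quadratic_Ritt_calculus n \<gamma> T) \<longleftrightarrow>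
         (\<exists>\<theta>\<in>{0<..<pi / real n}. quadratic_sectorial_calculus n \<theta> UNIV (blinfun_apply A))"
proof
  assume "\<exists>\<gamma>\<in>{0<..<pi / real n}. quadratic_Ritt_calculus n \<gamma> T"
  then obtain \<gamma> where \<gamma>: "0 < \<gamma>" "\<gamma> < pi / real n" and q: "quadratic_Ritt_calculus n \<gamma> T" by auto
  \<comment> \<open>The type is taken from the quadratic calculus, since it has to lie below
    \<gamma>; an arbitrary Ritt type of \<open>T\<close> need not.\<close>
  then obtain \<alpha> where \<alpha>: "\<alpha> < \<gamma>" "n_Ritt_type n \<alpha> T"
    unfolding quadratic_Ritt_calculus_def by auto
  interpret Ritt_op n \<alpha> T using assms(1) \<alpha>(2) by unfold_locales
  have "quadratic_sectorial_calculus n \<gamma> UNIV (blinfun_apply A)"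
    using quadratic_sectorial_of_Ritt[OF \<alpha>(1) \<gamma>(2) q] by (simp add: A_def assms(3))
  then show "\<exists>\<theta>\<in>{0<..<pi / real n}. quadratic_sectorial_calculus n \<theta> UNIV (blinfun_apply A)"
    using \<gamma> by (intro bexI[of _ \<gamma>]) auto
next
  assume "\<exists>\<theta>\<in>{0<..<pi / real n}. quadratic_sectorial_calculus n \<theta> UNIV (blinfun_apply A)"
  then obtain \<theta> where \<theta>: "\<theta> < pi / real n" and q: "quadratic_sectorial_calculus n \<theta> UNIV (blinfun_apply A)" by auto
  obtain \<alpha> where \<alpha>: "n_Ritt_type n \<alpha> T" using assms(2) by (auto simp: n_Ritt_def)
  interpret Ritt_op n \<alpha> T using assms(1) \<alpha> by unfold_locales
  show "\<exists>\<gamma>\<in>{0<..<pi / real n}. quadratic_Ritt_calculus n \<gamma> T"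
    by (rule quadratic_Ritt_of_sectorial[OF _ \<theta>]) (use q in \<open>simp add: A_def assms(3)\<close>)
qed

end
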